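(* Assume that the current step satisfies: (i) the mesh and history transfers described in the context are admissible, $0<\rho_*\le\rho_h^{n+1}\le\rho^*$, $0<\eta_*\le\eta_h^{n+1}\le\eta^*$, $s>0$, $m_E^{n+1}\ge0$, $C_A>0$, and $q^n>0$; (ii) the saddle-point pair $(V_h^{n+1},P_{h,0}^{n+1})$ satisfies the discrete inf--sup condition; (iii) the density-weighted pressure form $(\pi,\alpha)\mapsto(\rho_h^{n+1}\nabla_{\rho,h}^{n+1}\pi,\nabla_{\rho,h}^{n+1}\alpha)_{n+1}$ used in the pressure-correction scheme is positive definite on $P_{h,0}^{n+1}$. Then one BE ($k=1$) or BDF2 ($k=2$) step of either formulation (the saddle-point scheme or the pressure-correction scheme of the context) has a unique discrete solution (with $q^{n+1}>0$), and the quadratic equation $$A_q(q^{n+1})^2+B_qq^{n+1}-C_q=0,$$ to which the scalar equation of the respective scheme reduces, has exactly one positive root $q^{n+1}$. Here, for the saddle-point scheme, $$A_q=\frac{\gamma_k}{\alpha_q}+\gamma_k\|(\rho_h^{n+1})^{1/2}\boldsymbol u_{1,h}^{n+1}\|_{n+1}^2+\frac{2\tau}{Re}\|(\eta_h^{n+1})^{1/2}D(\boldsymbol u_{1,h}^{n+1})\|_{n+1}^2,$$ $$B_q=-\frac{\gamma_k}{\alpha_q}q_H^{n+1}+E_{\phi,r,k}^n+\frac\tau{We\,Cn}\langle\phi_E^{n+1}\boldsymbol u_{c,h}^{n+1},\nabla\mu_h^{n+1}\rangle_\times-\frac\tau{We\,Cn}(\phi_h^{n+1}\nabla\mu_h^{n+1},\boldsymbol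 u_{0,h}^{n+1})_{n+1},$$ $$C_q=q^nE_{\phi,r,k}^n,$$ where $\boldsymbol u_h(q)=\boldsymbol u_{0,h}^{n+1}+q\,\boldsymbol u_{1,h}^{n+1}$ is the affine dependence on $q$ of the velocity solving the saddle-point momentum--pressure equations with $q^{n+1}$ replaced by a parameter $q$; for the pressure-correction scheme, $\boldsymbol u_{0,h}^{n+1},\boldsymbol u_{1,h}^{n+1}$ are replaced by the coefficients of the tentative velocity $\boldsymbol u_{*,h}(q)=\boldsymbol u_{*,0,h}^{n+1}+q\,\boldsymbol u_{*,1,h}^{n+1}$.
   Context: Domain and spaces. $\Omega\subset\mathbb R^d$ ($d=2,3$) is a fixed bounded polygonal or polyhedral domain, $\partial\Omega=\overline{\Gamma_D}\cup\overline{\Gamma_S}$ with disjoint relative interiors. For each accepted time level $\ell$, $\mathcal T_h^\ell$ is a conforming shape-regular triangulation of $\Omega$ preserving the boundary partition, with finite element spaces $S_h^\ell\subset H^1(\Omega)$, $V_h^\ell\subset\{\boldsymbol v\in[H^1(\Omega)]^d:\boldsymbol v=0\text{ on }\Gamma_D,\ \boldsymbol v\cdot\boldsymbol n=0\text{ on }\Gamma_S\}$, $P_h^\ell\subset L^2(\Omega)$ (finite-dimensional, with functions regular enough, as standard piecewise polynomials are, for all integrals below to be finite), $1\in S_h^\ell\cap P_h^\ell$, and zero-mean subspaces $S_{h,0}^\ell$, $P_{h,0}^\ell$. $(\cdot,\cdot)_\ell$, $\|\cdot\|_\ell$ and the cross-mesh pairing $\langle\cdot,\cdot\rangle_\times$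 all denote the $L^2(\Omega)$ inner product/norm (Frobenius product for tensors); the notation only records on which mesh(es) the arguments live. $D(\boldsymbol v)=\frac12(\nabla\boldsymbol v+\nabla\boldsymbol v^T)$. Each update $n\to n+1$ is either a fixed-topology (ALE) update or a topology-changing (remeshing) update. For fixed-topology updates there are maps $\boldsymbol X_h^\ell:\widehat\Omega\to\Omega$ from a common reference triangulation onto $\mathcal T_h^\ell$, with uniformly admissible inverses, $\boldsymbol F_h^\ell=\widehat\nabla\boldsymbol X_h^\ell$, $J_h^\ell=\det\boldsymbol F_h^\ell>0$ (a function on $\widehat\Omega$), and a reference scalar space $\widehat S_h$ containing $\chi_h\circ\boldsymbol X_h^\ell$ for $\chi_h\in S_h^\ell$, with zero-mean subspace $\widehat S_{h,0}$. Data. $Cn,Pe,Re,We,\alpha_q>0$, $C_A>0$, time step $\tau>0$; $\rho(\phi)=\rho_0+\rho_\phi\phi$, $\eta(\phi)=\eta_0+\eta_\phi\phi$; mobility $m\ge0$; $F(\phi)=\frac s2\phi^2+G(\phi)$, $s>0$; $C_G>0$; $\boldsymbol f^{n+1}$ a given force. Accepted states satisfy $0<\rho_*\le\rho(\phi_h^\ell)\le\rho^*$ and $0<\eta_*\le\eta(\phi_h^\ell)\le\eta^*$. $k\in\{1,2\}$ ($n\ge1$ if $k=2$), $\gamma_1=1$, $\gamma_2=3/2$. For any history $z$: $z_H^{n+1}=z^n$, $z_E^{n+1}=z^n$ if $k=1$; $z_H^{n+1}=(4z^n-z^{n-1})/3$, $z_E^{n+1}=2z^n-z^{n-1}$ if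 $k=2$; $D_\tau^{(k)}z^{n+1}=\frac{\gamma_k}\tau(z^{n+1}-z_H^{n+1})$. $\|v\|_{Cn,s}^2=Cn^2\|\nabla v\|^2+s\|v\|^2$. All previous accepted states are given; initially $r^0=((G(\phi_h^0),1)_0+C_G)^{1/2}$, $q^0=1$. Step 1 (histories). $m_E^{n+1}=m(\phi_E^{n+1})$, and $\phi_{H,h}^{n+1}\in S_h^{n+1}$ solves $Cn^2(\nabla\phi_{H,h}^{n+1},\nabla\chi_h)_{n+1}+s(\phi_{H,h}^{n+1},\chi_h)_{n+1}=Cn^2\langle\nabla\phi_H^{n+1},\nabla\chi_h\rangle_\times+s\langle\phi_H^{n+1},\chi_h\rangle_\times$ for all $\chi_h\in S_h^{n+1}$. With $\boldsymbol\zeta_h^\ell=(\rho_h^\ell)^{1/2}\boldsymbol u_h^\ell$, the kinetic histories $\boldsymbol g_{j,h}^n$ ($j=0$, and $j=1$ if $k=2$) are transferred by $\boldsymbol g_{j,H}^{n+1}=[(J_h^{n+1})^{-1/2}(J_h^n)^{1/2}(\boldsymbol g_{j,h}^n\circ\boldsymbol X_h^n)]\circ(\boldsymbol X_h^{n+1})^{-1}$ (fixed topology), or by $\boldsymbol g_{j,H}^{n+1}=\frac{\|\boldsymbol g_{j,h}^n\|_n}{\|\mathcal P\boldsymbol g_{j,h}^n\|_{n+1}}\mathcal P\boldsymbol g_{j,h}^n$ (topology change; $=0$ if $\boldsymbol g_{j,h}^n=0$), where $\mathcal P$ is the $L^2$-orthogonal projection onto a chosen piecewise-polynomial history space on $\mathcal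 T_h^{n+1}$ and admissibility means $\mathcal P\boldsymbol g_{j,h}^n\ne0$ whenever $\boldsymbol g_{j,h}^n\ne0$. Then $\boldsymbol\zeta_{H,h}^{n+1}=\boldsymbol g_{0,H}^{n+1}$ ($k=1$), $\boldsymbol\zeta_{H,h}^{n+1}=\frac13(2\boldsymbol g_{0,H}^{n+1}+\boldsymbol g_{1,H}^{n+1})$ ($k=2$). After the step one sets $\boldsymbol g_{0,h}^{n+1}=\boldsymbol\zeta_h^{n+1}$ and (at each BDF2 level, and at level $1$ after the BE start-up) $\boldsymbol g_{1,h}^{n+1}=2\boldsymbol\zeta_h^{n+1}-\boldsymbol g_{0,H}^{n+1}$. Step 2 (carrier). Topology change: with $\boldsymbol u_{E,h}^{n+1}$ the extrapolation of the accepted velocities, find $\lambda_h^{n+1}\in S_{h,0}^{n+1}$ with $(\nabla\lambda_h^{n+1},\nabla\chi_h)_{n+1}=\langle\boldsymbol u_{E,h}^{n+1},\nabla\chi_h\rangle_\times$ for all $\chi_h\in S_{h,0}^{n+1}$ and set $\boldsymbol u_{c,h}^{n+1}=\boldsymbol u_{E,h}^{n+1}-\nabla\lambda_h^{n+1}$. Fixed topology: with $\widehat{\boldsymbol u}_h^m=J_h^m(\boldsymbol F_h^m)^{-1}(\boldsymbol u_h^m\circ\boldsymbol X_h^m)$ and $\widehat{\boldsymbol u}_E^{n+1}$ their extrapolation, find $\widehat\lambda_h^{n+1}\in\widehat S_{h,0}$ with $(\widehat\nabla\widehat\lambda_h^{n+1},\widehat\nabla\widehat\chi_h)_{\widehat\Omega}=(\widehat{\boldsymbol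 u}_E^{n+1},\widehat\nabla\widehat\chi_h)_{\widehat\Omega}$ for all $\widehat\chi_h\in\widehat S_{h,0}$ and set $\boldsymbol u_{c,h}^{n+1}\circ\boldsymbol X_h^{n+1}=\frac1{J_h^{n+1}}\boldsymbol F_h^{n+1}(\widehat{\boldsymbol u}_E^{n+1}-\widehat\nabla\widehat\lambda_h^{n+1})$. In either case $\langle\boldsymbol u_{c,h}^{n+1},\nabla\chi_h\rangle_\times=0$ for all $\chi_h\in S_h^{n+1}$. Step 3 (phase--SAV). With $U_E^{n+1}=(\langle G(\phi_E^{n+1}),1\rangle_\times+C_G)^{1/2}>0$, find $(\phi_h^{n+1},\mu_h^{n+1},r^{n+1})\in S_h^{n+1}\times S_h^{n+1}\times\mathbb R$ such that for all $\omega_h,\chi_h\in S_h^{n+1}$ $$\bigl(\tfrac{\gamma_k}\tau(\phi_h^{n+1}-\phi_{H,h}^{n+1}),\omega_h\bigr)_{n+1}-\langle\phi_E^{n+1}\boldsymbol u_{c,h}^{n+1},\nabla\omega_h\rangle_\times+\tfrac1{Pe}\langle m_E^{n+1}\nabla\mu_h^{n+1},\nabla\omega_h\rangle_\times=0,$$ $$(\mu_h^{n+1},\chi_h)_{n+1}=Cn^2(\nabla\phi_h^{n+1},\nabla\chi_h)_{n+1}+s(\phi_h^{n+1},\chi_h)_{n+1}+\tfrac{r^{n+1}}{U_E^{n+1}}\langle G'(\phi_E^{n+1}),\chi_h\rangle_\times,$$ $$D_\tau^{(k)}r^{n+1}=\tfrac1{2U_E^{n+1}}\bigl\langle G'(\phi_E^{n+1}),\tfrac{\gamma_k}\tau(\phi_h^{n+1}-\phi_{H,h}^{n+1})\bigr\rangle_\times.$$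 Set $\rho_h^{n+1}=\rho(\phi_h^{n+1})$, $\eta_h^{n+1}=\eta(\phi_h^{n+1})$, $\rho_E^{n+1}=\rho(\phi_E^{n+1})$, $\boldsymbol J_{\rho,h}^{n+1}=\rho_E^{n+1}\boldsymbol u_{c,h}^{n+1}-\frac{\rho_\phi}{Pe}m_E^{n+1}\nabla\mu_h^{n+1}$; let $\boldsymbol w_h^{n+1,(k)}=[D_\tau^{(k)}\boldsymbol X_h^{n+1}]\circ(\boldsymbol X_h^{n+1})^{-1}$ for a fixed-topology update and $0$ for a topology-changing step; and $$C_{\rho,h}^{n+1}(\boldsymbol v,\boldsymbol z)=\tfrac12\bigl[\langle(\boldsymbol J_{\rho,h}^{n+1}-\rho_h^{n+1}\boldsymbol w_h^{n+1,(k)})\cdot\nabla\boldsymbol v,\boldsymbol z\rangle_\times-\langle(\boldsymbol J_{\rho,h}^{n+1}-\rho_h^{n+1}\boldsymbol w_h^{n+1,(k)})\cdot\nabla\boldsymbol z,\boldsymbol v\rangle_\times\bigr].$$ Also $E_{\phi,r,1}^\ell=\frac1{2We\,Cn}\|\phi_h^\ell\|_{Cn,s}^2+\frac1{We\,Cn}(r^\ell)^2+C_A$ and $E_{\phi,r,2}^\ell=\frac1{4We\,Cn}[\|\phi_h^\ell\|_{Cn,s}^2+\|2\phi_h^\ell-\phi_h^{\ell-1}\|_{Cn,s}^2]+\frac1{2We\,Cn}[(r^\ell)^2+(2r^\ell-r^{\ell-1})^2]+C_A$. Saddle-point scheme (after Steps 1--3). Find $(\boldsymbol u_h^{n+1},p_h^{n+1},q^{n+1})\in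 V_h^{n+1}\times P_{h,0}^{n+1}\times\mathbb R_{>0}$ such that for all $\boldsymbol v_h\in V_h^{n+1}$, $\alpha_h\in P_{h,0}^{n+1}$ $$\tfrac{\gamma_k}\tau((\rho_h^{n+1})^{1/2}\boldsymbol u_h^{n+1}-\boldsymbol\zeta_{H,h}^{n+1},(\rho_h^{n+1})^{1/2}\boldsymbol v_h)_{n+1}+C_{\rho,h}^{n+1}(\boldsymbol u_h^{n+1},\boldsymbol v_h)+\tfrac2{Re}(\eta_h^{n+1}D(\boldsymbol u_h^{n+1}),D(\boldsymbol v_h))_{n+1}-(p_h^{n+1},\nabla\cdot\boldsymbol v_h)_{n+1}$$ $$=(\boldsymbol f^{n+1},\boldsymbol v_h)_{n+1}-\tfrac{q^{n+1}}{We\,Cn}(\phi_h^{n+1}\nabla\mu_h^{n+1},\boldsymbol v_h)_{n+1},\qquad(\nabla\cdot\boldsymbol u_h^{n+1},\alpha_h)_{n+1}=0,$$ $$\tfrac{\gamma_kq^{n+1}}{\alpha_q\tau}(q^{n+1}-q_H^{n+1})+\tfrac{q^{n+1}-q^n}\tau E_{\phi,r,k}^n+\tfrac{q^{n+1}}{We\,Cn}\langle\phi_E^{n+1}\boldsymbol u_{c,h}^{n+1},\nabla\mu_h^{n+1}\rangle_\times-\tfrac{q^{n+1}}{We\,Cn}(\phi_h^{n+1}\nabla\mu_h^{n+1},\boldsymbol u_h^{n+1})_{n+1}=0.$$ Pressure-correction scheme (after Steps 1--3). $\pi_h^0\in P_{h,0}^0$ is prescribed. $\nabla_{\rho,h}^\ell:P_{h,0}^\ell\to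 V_h^\ell$ is the discrete gradient $(\rho_h^\ell\nabla_{\rho,h}^\ell\pi_h,\boldsymbol v_h)_\ell=-(\pi_h,\nabla\cdot\boldsymbol v_h)_\ell$ for all $\boldsymbol v_h\in V_h^\ell$. Set $\boldsymbol\xi_{p,h}^{n+1}=[(J_h^{n+1})^{-1/2}(J_h^n)^{1/2}((\rho_h^n)^{1/2}\nabla_{\rho,h}^n\pi_h^n)\circ\boldsymbol X_h^n]\circ(\boldsymbol X_h^{n+1})^{-1}$ (fixed topology) or $\boldsymbol\xi_{p,h}^{n+1}=(\rho_h^n)^{1/2}\nabla_{\rho,h}^n\pi_h^n$ (topology change). Find $\pi_{\rm tr,h}^{n+1},\bar\pi_h^{n+1}\in P_{h,0}^{n+1}$ such that for all $\alpha_h\in P_{h,0}^{n+1}$ $$(\rho_h^{n+1}\nabla_{\rho,h}^{n+1}\pi_{\rm tr,h}^{n+1},\nabla_{\rho,h}^{n+1}\alpha_h)_{n+1}=\langle\boldsymbol\xi_{p,h}^{n+1},(\rho_h^{n+1})^{1/2}\nabla_{\rho,h}^{n+1}\alpha_h\rangle_\times,$$ $$(\rho_h^{n+1}\nabla_{\rho,h}^{n+1}\bar\pi_h^{n+1},\nabla_{\rho,h}^{n+1}\alpha_h)_{n+1}=\langle\boldsymbol\xi_{p,h}^{n+1}+\tfrac{\gamma_k}\tau\boldsymbol\zeta_{H,h}^{n+1},(\rho_h^{n+1})^{1/2}\nabla_{\rho,h}^{n+1}\alpha_h\rangle_\times.$$ Find $\boldsymbol u_{*,h}^{n+1}(q)\in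 V_h^{n+1}$ and $q^{n+1}>0$ with, for all $\boldsymbol v_h\in V_h^{n+1}$, $$\tfrac{\gamma_k}\tau((\rho_h^{n+1})^{1/2}\boldsymbol u_{*,h}^{n+1}(q)-\boldsymbol\zeta_{H,h}^{n+1},(\rho_h^{n+1})^{1/2}\boldsymbol v_h)_{n+1}+C_{\rho,h}^{n+1}(\boldsymbol u_{*,h}^{n+1}(q),\boldsymbol v_h)+\tfrac2{Re}(\eta_h^{n+1}D(\boldsymbol u_{*,h}^{n+1}(q)),D(\boldsymbol v_h))_{n+1}$$ $$=(\bar\pi_h^{n+1},\nabla\cdot\boldsymbol v_h)_{n+1}+(\boldsymbol f^{n+1},\boldsymbol v_h)_{n+1}-\tfrac q{We\,Cn}(\phi_h^{n+1}\nabla\mu_h^{n+1},\boldsymbol v_h)_{n+1},$$ and the same scalar equation as in the saddle-point scheme with $\boldsymbol u_h^{n+1}$ replaced by $\boldsymbol u_{*,h}^{n+1}(q^{n+1})$; set $\boldsymbol u_{*,h}^{n+1}=\boldsymbol u_{*,h}^{n+1}(q^{n+1})$. Finally find $\delta\pi_h^{n+1}\in P_{h,0}^{n+1}$ with $(\rho_h^{n+1}\nabla_{\rho,h}^{n+1}\delta\pi_h^{n+1},\nabla_{\rho,h}^{n+1}\alpha_h)_{n+1}=-\frac{\gamma_k}\tau(\nabla\cdot\boldsymbol u_{*,h}^{n+1},\alpha_h)_{n+1}$ for all $\alpha_h\in P_{h,0}^{n+1}$, and set $\boldsymbol u_h^{n+1}=\boldsymbol u_{*,h}^{n+1}-\frac\tau{\gamma_k}\nabla_{\rho,h}^{n+1}\delta\pi_h^{n+1}$,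 $\pi_h^{n+1}=\pi_{\rm tr,h}^{n+1}+\delta\pi_h^{n+1}$. *)

theory Defs
  imports "HOL-Analysis.Analysis"
begin

section \<open>Lebesgue and Sobolev spaces\<close>

type_synonym 'd sfun = "real ^ 'd \<Rightarrow> real"
type_synonym 'd vfun = "real ^ 'd \<Rightarrow> real ^ 'd"
type_synonym 'd tfun = "real ^ 'd \<Rightarrow> real ^ 'd ^ 'd"

text \<open>On matrices of type \<^typ>\<open>real ^ 'd ^ 'd\<close> the inner product \<open>\<bullet>\<close> is the Frobenius product, so the
  following covers scalar, vector and tensor fields.\<close>

definition l2in :: "'a::euclidean_space set \<Rightarrow> ('a \<Rightarrow> 'b::euclidean_space) \<Rightarrow> ('a \<Rightarrow> 'b) \<Rightarrow> real"
  where "l2in A f g = (LINT x:A|lebesgue. f x \<bullet> g x)"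

definition l2norm :: "'a::euclidean_space set \<Rightarrow> ('a \<Rightarrow> 'b::euclidean_space) \<Rightarrow> real"
  where "l2norm A f = sqrt (l2in A f f)"

definition L2 :: "'a::euclidean_space set \<Rightarrow> ('a \<Rightarrow> 'b::euclidean_space) set"
  where "L2 A = {f. f \<in> borel_measurable (lebesgue_on A) \<and>
                    set_integrable lebesgue A (\<lambda>x. f x \<bullet> f x)}"

text \<open>Continuously differentiable functions \<open>\<psi>\<close> of compact support, with gradient \<open>d\<psi>\<close>.\<close>

definition C1_compact :: "'d::finite sfun \<Rightarrow> 'd vfun \<Rightarrow> bool"
  where "C1_compact \<psi> d\<psi> \<longleftrightarrow>
    (\<forall>x. GDERIV \<psi> x :> d\<psi> x) \<and> continuous_on UNIV d\<psi> \<and> compact (closure {x. \<psi> x \<noteq> 0})"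

text \<open>Weak gradients are tested with \<open>C\<^sup>1\<close> functions of compact support in the domain, as in Brezis'
  definition of \<open>W\<^sup>1\<^sup>,\<^sup>p\<close>.  They are unique up to null sets only; \<open>wgrad\<close> picks one of them.\<close>

definition is_weak_grad :: "(real ^ 'd::finite) set \<Rightarrow> 'd sfun \<Rightarrow> 'd vfun \<Rightarrow> bool"
  where "is_weak_grad A u g \<longleftrightarrow> g \<in> L2 A \<and>
    (\<forall>\<psi> d\<psi>. C1_compact \<psi> d\<psi> \<and> closure {x. \<psi> x \<noteq> 0} \<subseteq> A \<longrightarrow>
       (LINT x:A|lebesgue. u x *\<^sub>R d\<psi> x) = - (LINT x:A|lebesgue. \<psi> x *\<^sub>R g x))"

definition H1 :: "(real ^ 'd::finite) set \<Rightarrow> 'd sfun set"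
  where "H1 A = {u \<in> L2 A. \<exists>g. is_weak_grad A u g}"

definition wgrad :: "(real ^ 'd::finite) set \<Rightarrow> 'd sfun \<Rightarrow> 'd vfun"
  where "wgrad A u = (SOME g. is_weak_grad A u g)"

definition H1v :: "(real ^ 'd::finite) set \<Rightarrow> 'd vfun set"
  where "H1v A = {v. \<forall>i. (\<lambda>x. v x $ i) \<in> H1 A}"

text \<open>Row \<open>i\<close> of \<open>wjac A v\<close> is the gradient of the \<open>i\<close>-th component, so that
  \<open>(a \<cdot> \<nabla>) v\<close> is \<open>wjac A v x *v a x\<close>.\<close>

definition wjac :: "(real ^ 'd::finite) set \<Rightarrow> 'd vfun \<Rightarrow> 'd tfun"
  where "wjac A v x = (\<chi> i. wgrad A (\<lambda>y. v y $ i) x)"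

definition wdiv :: "(real ^ 'd::finite) set \<Rightarrow> 'd vfun \<Rightarrow> 'd sfun"
  where "wdiv A v x = trace (wjac A v x)"

definition symgrad :: "(real ^ 'd::finite) set \<Rightarrow> 'd vfun \<Rightarrow> 'd tfun"
  where "symgrad A v x = (1/2) *\<^sub>R (wjac A v x + transpose (wjac A v x))"

definition h1norm :: "(real ^ 'd::finite) set \<Rightarrow> 'd vfun \<Rightarrow> real"
  where "h1norm A v = sqrt ((l2norm A v)\<^sup>2 + (l2norm A (wjac A v))\<^sup>2)"

text \<open>Boundary conditions on a part \<open>\<Gamma>\<close> of the boundary, in the sense of traces, expressed through
  Green's formula: the left-hand sides are the boundary integrals of \<open>\<psi> v\<^sub>i n\<close> and of \<open>\<psi> v \<cdot> n\<close>,
  and the test functions \<open>\<psi>\<close> are those whose support meets the boundary only inside \<open>\<Gamma>\<close>.\<close>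

definition boundary_test :: "(real ^ 'd::finite) set \<Rightarrow> (real ^ 'd) set \<Rightarrow> 'd sfun \<Rightarrow> 'd vfun \<Rightarrow> bool"
  where "boundary_test A \<Gamma> \<psi> d\<psi> \<longleftrightarrow>
    C1_compact \<psi> d\<psi> \<and> closure {x. \<psi> x \<noteq> 0} \<inter> frontier A \<subseteq> \<Gamma>"

definition zero_trace :: "(real ^ 'd::finite) set \<Rightarrow> (real ^ 'd) set \<Rightarrow> 'd vfun \<Rightarrow> bool"
  where "zero_trace A \<Gamma> v \<longleftrightarrow> (\<forall>\<psi> d\<psi>. boundary_test A \<Gamma> \<psi> d\<psi> \<longrightarrow>
    (\<forall>i. (LINT x:A|lebesgue. (v x $ i) *\<^sub>R d\<psi> x + \<psi> x *\<^sub>R wgrad A (\<lambda>y. v y $ i) x) = 0))"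

definition zero_normal_trace :: "(real ^ 'd::finite) set \<Rightarrow> (real ^ 'd) set \<Rightarrow> 'd vfun \<Rightarrow> bool"
  where "zero_normal_trace A \<Gamma> v \<longleftrightarrow> (\<forall>\<psi> d\<psi>. boundary_test A \<Gamma> \<psi> d\<psi> \<longrightarrow>
    (LINT x:A|lebesgue. v x \<bullet> d\<psi> x + \<psi> x * wdiv A v x) = 0)"

section \<open>Domains, triangulations and discrete spaces\<close>

text \<open>\<open>interior (closure A) = A\<close> excludes slits.\<close>

definition polyhedral_domain :: "'a::euclidean_space set \<Rightarrow> bool"
  where "polyhedral_domain A \<longleftrightarrow> open A \<and> connected A \<and> bounded A \<and> A \<noteq> {} \<and>
    interior (closure A) = A \<and> (\<exists>\<P>. finite \<P> \<and> (\<forall>Q\<in>\<P>. polytope Q) \<and> closure A = \<Union>\<P>)"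

text \<open>\<open>triangulation\<close> already contains conformity: two cells meet in a common face.\<close>

definition mesh_of :: "(real ^ 'd::finite) set \<Rightarrow> (real ^ 'd) set set \<Rightarrow> bool"
  where "mesh_of A \<T> \<longleftrightarrow> triangulation \<T> \<and> (\<forall>T\<in>\<T>. int CARD('d) simplex T) \<and> \<Union>\<T> = closure A"

definition shape_regular :: "real \<Rightarrow> 'a::euclidean_space set set \<Rightarrow> bool"
  where "shape_regular \<sigma> \<T> \<longleftrightarrow> (\<forall>T\<in>\<T>. \<exists>x. cball x (diameter T / \<sigma>) \<subseteq> T)"

definition preserves_boundary :: "'a::euclidean_space set \<Rightarrow> 'a set \<Rightarrow> 'a set \<Rightarrow> 'a set set \<Rightarrow> bool"
  where "preserves_boundary A \<Gamma>D \<Gamma>S \<T> \<longleftrightarrow>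
    (\<forall>T\<in>\<T>. \<forall>E. E facet_of T \<and> E \<subseteq> frontier A \<longrightarrow> E \<subseteq> closure \<Gamma>D \<or> E \<subseteq> closure \<Gamma>S)"

text \<open>A finite-dimensional subspace of \<open>L\<^sup>2(A)\<close>, given by the span of chosen representatives of a
  basis.  The second conjunct says that each element of the \<open>L\<^sup>2\<close> space has one representative only,
  so that uniqueness in \<open>L\<^sup>2(A)\<close> is equality of functions.\<close>

definition fin_dim_space :: "'a::euclidean_space set \<Rightarrow> ('a \<Rightarrow> 'b::euclidean_space) set \<Rightarrow> bool"
  where "fin_dim_space A M \<longleftrightarrow> M \<subseteq> L2 A \<and>
    (\<exists>B. finite B \<and> M = range (\<lambda>c x. \<Sum>b\<in>B. c b *\<^sub>R b x)) \<and>
    (\<forall>f\<in>M. (AE x\<in>A in lebesgue. f x = 0) \<longrightarrow> f = (\<lambda>_. 0))"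

definition contains_one :: "'a::euclidean_space set \<Rightarrow> ('a \<Rightarrow> real) set \<Rightarrow> bool"
  where "contains_one A M \<longleftrightarrow> (\<exists>e\<in>M. AE x\<in>A in lebesgue. e x = 1)"

definition zero_mean :: "'a::euclidean_space set \<Rightarrow> ('a \<Rightarrow> real) set \<Rightarrow> ('a \<Rightarrow> real) set"
  where "zero_mean A M = {f \<in> M. (LINT x:A|lebesgue. f x) = 0}"

definition piecewise_polynomial ::
  "'a::euclidean_space set set \<Rightarrow> ('a \<Rightarrow> 'b::euclidean_space) \<Rightarrow> bool"
  where "piecewise_polynomial \<T> w \<longleftrightarrow>
    (\<forall>T\<in>\<T>. \<exists>p. polynomial_function p \<and> (\<forall>x\<in>interior T. w x = p x))"

definition l2proj ::
  "'a::euclidean_space set \<Rightarrow> ('a \<Rightarrow> 'b::euclidean_space) set \<Rightarrow> ('a \<Rightarrow> 'b) \<Rightarrow> ('a \<Rightarrow> 'b)"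
  where "l2proj A W g = (THE w. w \<in> W \<and> (\<forall>z\<in>W. l2in A w z = l2in A g z))"

section \<open>Data of the scheme\<close>

text \<open>Index \<open>l\<close> refers to a time level, index \<open>m\<close> to the update \<open>m \<rightarrow> m + 1\<close>.  \<open>ALE m\<close> says that
  this update has fixed topology; \<open>RefDom\<close>, \<open>RefMesh\<close>, \<open>RefSh\<close> are then its reference domain,
  triangulation and scalar space, and \<open>Xmap m l\<close> is the map from the reference domain of the
  update \<open>m\<close> to the mesh of level \<open>l\<close>.  \<open>Hist m\<close> is the history space of a topology-changing
  update.  The last five fields are the states of the levels (the values at levels beyond the last
  accepted one are never used).\<close>

record ('d::finite) scheme =
  Omega :: "(real ^ 'd) set"
  GammaD :: "(real ^ 'd) set"
  GammaS :: "(real ^ 'd) set"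
  Mesh :: "nat \<Rightarrow> (real ^ 'd) set set"
  Sh :: "nat \<Rightarrow> 'd sfun set"
  Vh :: "nat \<Rightarrow> 'd vfun set"
  Ph :: "nat \<Rightarrow> 'd sfun set"
  ALE :: "nat \<Rightarrow> bool"
  RefDom :: "nat \<Rightarrow> (real ^ 'd) set"
  RefMesh :: "nat \<Rightarrow> (real ^ 'd) set set"
  RefSh :: "nat \<Rightarrow> 'd sfun set"
  Xmap :: "nat \<Rightarrow> nat \<Rightarrow> 'd vfun"
  Hist :: "nat \<Rightarrow> 'd vfun set"
  Cahn :: real
  Pec :: real
  Rey :: real
  Web :: real
  alphaq :: real
  CA :: real
  tau :: real
  rho0 :: real
  rhophi :: real
  eta0 :: real
  etaphi :: real
  mobility :: "real \<Rightarrow> real"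
  spar :: real
  Gpot :: "real \<Rightarrow> real"
  CG :: real
  force :: "nat \<Rightarrow> 'd vfun"
  rho_lo :: real
  rho_hi :: real
  eta_lo :: real
  eta_hi :: real
  phist :: "nat \<Rightarrow> 'd sfun"
  ust :: "nat \<Rightarrow> 'd vfun"
  rst :: "nat \<Rightarrow> real"
  qst :: "nat \<Rightarrow> real"
  pist :: "nat \<Rightarrow> 'd sfun"

definition S0 :: "('d::finite) scheme \<Rightarrow> nat \<Rightarrow> 'd sfun set"
  where "S0 d l = zero_mean (Omega d) (Sh d l)"

definition P0 :: "('d::finite) scheme \<Rightarrow> nat \<Rightarrow> 'd sfun set"
  where "P0 d l = zero_mean (Omega d) (Ph d l)"

definition rho :: "('d::finite) scheme \<Rightarrow> real \<Rightarrow> real"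
  where "rho d a = rho0 d + rhophi d * a"

definition eta :: "('d::finite) scheme \<Rightarrow> real \<Rightarrow> real"
  where "eta d a = eta0 d + etaphi d * a"

definition gam :: "nat \<Rightarrow> real"
  where "gam k = (if k = 1 then 1 else 3/2)"

text \<open>\<open>z\<^sub>H\<close> and \<open>z\<^sub>E\<close> at level \<open>n + 1\<close>, for \<open>k = 1, 2\<close>.\<close>

definition histH :: "nat \<Rightarrow> (nat \<Rightarrow> 'a::real_vector) \<Rightarrow> nat \<Rightarrow> 'a"
  where "histH k z n = (if k = 1 then z n else (4 *\<^sub>R z n - z (n - 1)) /\<^sub>R 3)"

definition histE :: "nat \<Rightarrow> (nat \<Rightarrow> 'a::real_vector) \<Rightarrow> nat \<Rightarrow> 'a"
  where "histE k z n = (if k = 1 then z n else 2 *\<^sub>R z n - z (n - 1))"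

definition cns_in :: "('d::finite) scheme \<Rightarrow> 'd sfun \<Rightarrow> 'd sfun \<Rightarrow> real"
  where "cns_in d f g = (Cahn d)\<^sup>2 * l2in (Omega d) (wgrad (Omega d) f) (wgrad (Omega d) g)
                        + spar d * l2in (Omega d) f g"

definition cns_norm2 :: "('d::finite) scheme \<Rightarrow> 'd sfun \<Rightarrow> real"
  where "cns_norm2 d f = (Cahn d)\<^sup>2 * (l2norm (Omega d) (wgrad (Omega d) f))\<^sup>2
                         + spar d * (l2norm (Omega d) f)\<^sup>2"

section \<open>Step 1: histories\<close>

definition phiH_old :: "('d::finite) scheme \<Rightarrow> nat \<Rightarrow> nat \<Rightarrow> 'd sfun"
  where "phiH_old d k n x = histH k (\<lambda>l. phist d l x) n"

definition phiE :: "('d::finite) scheme \<Rightarrow> nat \<Rightarrow> nat \<Rightarrow> 'd sfun"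
  where "phiE d k n x = histE k (\<lambda>l. phist d l x) n"

definition mE :: "('d::finite) scheme \<Rightarrow> nat \<Rightarrow> nat \<Rightarrow> 'd sfun"
  where "mE d k n x = mobility d (phiE d k n x)"

definition phase_history :: "('d::finite) scheme \<Rightarrow> nat \<Rightarrow> nat \<Rightarrow> 'd sfun \<Rightarrow> bool"
  where "phase_history d k n phiH \<longleftrightarrow> phiH \<in> Sh d (n+1) \<and>
    (\<forall>\<theta>\<in>Sh d (n+1). cns_in d phiH \<theta> = cns_in d (phiH_old d k n) \<theta>)"

text \<open>\<open>Fmat\<close> is meaningful off the skeleton of the reference triangulation, i.e. almost
  everywhere.\<close>

definition Fmat :: "('d::finite) scheme \<Rightarrow> nat \<Rightarrow> nat \<Rightarrow> 'd tfun"
  where "Fmat d m l x = jacobian (Xmap d m l) (at x)"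

definition Jdet :: "('d::finite) scheme \<Rightarrow> nat \<Rightarrow> nat \<Rightarrow> 'd sfun"
  where "Jdet d m l x = det (Fmat d m l x)"

definition Xinv :: "('d::finite) scheme \<Rightarrow> nat \<Rightarrow> nat \<Rightarrow> 'd vfun"
  where "Xinv d m l = inv_into (RefDom d m) (Xmap d m l)"

definition ale_transfer :: "('d::finite) scheme \<Rightarrow> nat \<Rightarrow> 'd vfun \<Rightarrow> 'd vfun"
  where "ale_transfer d m g =
    (\<lambda>xh. (sqrt (Jdet d m m xh) / sqrt (Jdet d m (m+1) xh)) *\<^sub>R g (Xmap d m m xh)) \<circ> Xinv d m (m+1)"

definition remesh_transfer :: "('d::finite) scheme \<Rightarrow> nat \<Rightarrow> 'd vfun \<Rightarrow> 'd vfun"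
  where "remesh_transfer d m g =
    (let A = Omega d; Pg = l2proj A (Hist d m) g in
     if l2norm A g = 0 then (\<lambda>_. 0) else (\<lambda>x. (l2norm A g / l2norm A Pg) *\<^sub>R Pg x))"

definition transfer :: "('d::finite) scheme \<Rightarrow> nat \<Rightarrow> 'd vfun \<Rightarrow> 'd vfun"
  where "transfer d m g = (if ALE d m then ale_transfer d m g else remesh_transfer d m g)"

text \<open>The kinetic histories \<open>g\<^sub>0\<close>, \<open>g\<^sub>1\<close> at level \<open>l\<close>; \<open>g\<^sub>1\<close> at level \<open>l\<close> uses the transfer of
  \<open>g\<^sub>0\<close> by the update \<open>l - 1 \<rightarrow> l\<close>.\<close>

definition g0 :: "('d::finite) scheme \<Rightarrow> nat \<Rightarrow> 'd vfun"
  where "g0 d l x = sqrt (rho d (phist d l x)) *\<^sub>R ust d l x"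

definition g1 :: "('d::finite) scheme \<Rightarrow> nat \<Rightarrow> 'd vfun"
  where "g1 d l x = 2 *\<^sub>R g0 d l x - transfer d (l - 1) (g0 d (l - 1)) x"

definition zetaH :: "('d::finite) scheme \<Rightarrow> nat \<Rightarrow> nat \<Rightarrow> 'd vfun"
  where "zetaH d k n x = (if k = 1 then transfer d n (g0 d n) x
     else (2 *\<^sub>R transfer d n (g0 d n) x + transfer d n (g1 d n) x) /\<^sub>R 3)"

section \<open>Step 2: carrier velocity\<close>

definition uE :: "('d::finite) scheme \<Rightarrow> nat \<Rightarrow> nat \<Rightarrow> 'd vfun"
  where "uE d k n x = histE k (\<lambda>l. ust d l x) n"

definition uhat :: "('d::finite) scheme \<Rightarrow> nat \<Rightarrow> nat \<Rightarrow> 'd vfun"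
  where "uhat d m l xh =
    Jdet d m l xh *\<^sub>R (matrix_inv (Fmat d m l xh) *v ust d l (Xmap d m l xh))"

definition uhatE :: "('d::finite) scheme \<Rightarrow> nat \<Rightarrow> nat \<Rightarrow> 'd vfun"
  where "uhatE d k n xh = histE k (\<lambda>l. uhat d n l xh) n"

definition carrier_potential :: "('d::finite) scheme \<Rightarrow> nat \<Rightarrow> nat \<Rightarrow> 'd sfun \<Rightarrow> bool"
  where "carrier_potential d k n lam \<longleftrightarrow>
   (if ALE d n then
      lam \<in> zero_mean (RefDom d n) (RefSh d n) \<and>
      (\<forall>\<theta>\<in>zero_mean (RefDom d n) (RefSh d n).
         l2in (RefDom d n) (wgrad (RefDom d n) lam) (wgrad (RefDom d n) \<theta>)
         = l2in (RefDom d n) (uhatE d k n) (wgrad (RefDom d n) \<theta>))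
    else
      lam \<in> S0 d (n+1) \<and>
      (\<forall>\<theta>\<in>S0 d (n+1).
         l2in (Omega d) (wgrad (Omega d) lam) (wgrad (Omega d) \<theta>)
         = l2in (Omega d) (uE d k n) (wgrad (Omega d) \<theta>)))"

definition carrier :: "('d::finite) scheme \<Rightarrow> nat \<Rightarrow> nat \<Rightarrow> 'd sfun \<Rightarrow> 'd vfun"
  where "carrier d k n lam =
   (if ALE d n then
      (\<lambda>xh. (1 / Jdet d n (n+1) xh) *\<^sub>R
         (Fmat d n (n+1) xh *v (uhatE d k n xh - wgrad (RefDom d n) lam xh))) \<circ> Xinv d n (n+1)
    else (\<lambda>x. uE d k n x - wgrad (Omega d) lam x))"

section \<open>Step 3: phase field and scalar auxiliary variable\<close>

definition UE2 :: "('d::finite) scheme \<Rightarrow> nat \<Rightarrow> nat \<Rightarrow> real"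
  where "UE2 d k n = (LINT x:Omega d|lebesgue. Gpot d (phiE d k n x)) + CG d"

definition UE :: "('d::finite) scheme \<Rightarrow> nat \<Rightarrow> nat \<Rightarrow> real"
  where "UE d k n = sqrt (UE2 d k n)"

definition dGE :: "('d::finite) scheme \<Rightarrow> nat \<Rightarrow> nat \<Rightarrow> 'd sfun"
  where "dGE d k n x = deriv (Gpot d) (phiE d k n x)"

definition phase_sav ::
  "('d::finite) scheme \<Rightarrow> nat \<Rightarrow> nat \<Rightarrow> 'd sfun \<Rightarrow> 'd vfun \<Rightarrow> 'd sfun \<Rightarrow> 'd sfun \<Rightarrow> real \<Rightarrow> bool"
  where "phase_sav d k n phiH uc phi mu r \<longleftrightarrow>
   (let A = Omega d; gr = wgrad A; c = gam k / tau d in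
    phi \<in> Sh d (n+1) \<and> mu \<in> Sh d (n+1) \<and>
    (\<forall>\<omega>\<in>Sh d (n+1).
       l2in A (\<lambda>x. c * (phi x - phiH x)) \<omega>
       - l2in A (\<lambda>x. phiE d k n x *\<^sub>R uc x) (gr \<omega>)
       + 1 / Pec d * l2in A (\<lambda>x. mE d k n x *\<^sub>R gr mu x) (gr \<omega>) = 0) \<and>
    (\<forall>\<theta>\<in>Sh d (n+1).
       l2in A mu \<theta> = (Cahn d)\<^sup>2 * l2in A (gr phi) (gr \<theta>) + spar d * l2in A phi \<theta>
                     + r / UE d k n * l2in A (dGE d k n) \<theta>) \<and>
    c * (r - histH k (rst d) n)
      = 1 / (2 * UE d k n) * l2in A (dGE d k n) (\<lambda>x. c * (phi x - phiH x)))"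

definition steps_1_to_3 ::
  "('d::finite) scheme \<Rightarrow> nat \<Rightarrow> nat \<Rightarrow> 'd sfun \<Rightarrow> 'd sfun \<Rightarrow> 'd sfun \<Rightarrow> 'd sfun \<Rightarrow> real \<Rightarrow> bool"
  where "steps_1_to_3 d k n phiH lam phi mu r \<longleftrightarrow>
    phase_history d k n phiH \<and> carrier_potential d k n lam \<and>
    phase_sav d k n phiH (carrier d k n lam) phi mu r"

definition mass_flux :: "('d::finite) scheme \<Rightarrow> nat \<Rightarrow> nat \<Rightarrow> 'd vfun \<Rightarrow> 'd sfun \<Rightarrow> 'd vfun"
  where "mass_flux d k n uc mu x =
    rho d (phiE d k n x) *\<^sub>R uc x - (rhophi d / Pec d * mE d k n x) *\<^sub>R wgrad (Omega d) mu x"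

definition mesh_velocity :: "('d::finite) scheme \<Rightarrow> nat \<Rightarrow> nat \<Rightarrow> 'd vfun"
  where "mesh_velocity d k n =
   (if ALE d n then
      (\<lambda>xh. (gam k / tau d) *\<^sub>R (Xmap d n (n+1) xh - histH k (\<lambda>l. Xmap d n l xh) n)) \<circ> Xinv d n (n+1)
    else (\<lambda>_. 0))"

text \<open>\<open>((J\<^sub>\<rho> - \<rho> w) \<cdot> \<nabla>) v\<close>\<close>

definition advect ::
  "('d::finite) scheme \<Rightarrow> nat \<Rightarrow> nat \<Rightarrow> 'd vfun \<Rightarrow> 'd sfun \<Rightarrow> 'd sfun \<Rightarrow> 'd vfun \<Rightarrow> 'd vfun"
  where "advect d k n uc phi mu v x =
    wjac (Omega d) v x *v (mass_flux d k n uc mu x - rho d (phi x) *\<^sub>R mesh_velocity d k n x)"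

definition Crho ::
  "('d::finite) scheme \<Rightarrow> nat \<Rightarrow> nat \<Rightarrow> 'd vfun \<Rightarrow> 'd sfun \<Rightarrow> 'd sfun \<Rightarrow> 'd vfun \<Rightarrow> 'd vfun \<Rightarrow> real"
  where "Crho d k n uc phi mu v z =
    1/2 * (l2in (Omega d) (advect d k n uc phi mu v) z - l2in (Omega d) (advect d k n uc phi mu z) v)"

text \<open>\<open>E\<^sub>\<phi>\<^sub>,\<^sub>r\<^sub>,\<^sub>k\<close> at level \<open>l\<close>\<close>

definition Ephir :: "('d::finite) scheme \<Rightarrow> nat \<Rightarrow> nat \<Rightarrow> real"
  where "Ephir d k l =
   (if k = 1 then
      1 / (2 * Web d * Cahn d) * cns_norm2 d (phist d l) + 1 / (Web d * Cahn d) * (rst d l)\<^sup>2 + CA d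
    else
      1 / (4 * Web d * Cahn d) *
        (cns_norm2 d (phist d l) + cns_norm2 d (\<lambda>x. 2 * phist d l x - phist d (l - 1) x))
      + 1 / (2 * Web d * Cahn d) * ((rst d l)\<^sup>2 + (2 * rst d l - rst d (l - 1))\<^sup>2) + CA d)"

section \<open>The two schemes\<close>

definition capillary :: "('d::finite) scheme \<Rightarrow> 'd sfun \<Rightarrow> 'd sfun \<Rightarrow> 'd vfun \<Rightarrow> real"
  where "capillary d phi mu v = l2in (Omega d) (\<lambda>x. phi x *\<^sub>R wgrad (Omega d) mu x) v"

text \<open>Inertial, convective and viscous terms of the momentum equation.\<close>

definition momentum_lhs ::
  "('d::finite) scheme \<Rightarrow> nat \<Rightarrow> nat \<Rightarrow> 'd vfun \<Rightarrow> 'd sfun \<Rightarrow> 'd sfun \<Rightarrow> 'd vfun \<Rightarrow> 'd vfun \<Rightarrow> real"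
  where "momentum_lhs d k n uc phi mu u v =
    gam k / tau d * l2in (Omega d) (\<lambda>x. sqrt (rho d (phi x)) *\<^sub>R u x - zetaH d k n x)
                                   (\<lambda>x. sqrt (rho d (phi x)) *\<^sub>R v x)
    + Crho d k n uc phi mu u v
    + 2 / Rey d * l2in (Omega d) (\<lambda>x. eta d (phi x) *\<^sub>R symgrad (Omega d) u x) (symgrad (Omega d) v)"

definition scalar_eq ::
  "('d::finite) scheme \<Rightarrow> nat \<Rightarrow> nat \<Rightarrow> 'd vfun \<Rightarrow> 'd sfun \<Rightarrow> 'd sfun \<Rightarrow> 'd vfun \<Rightarrow> real \<Rightarrow> bool"
  where "scalar_eq d k n uc phi mu u q \<longleftrightarrow>
    gam k * q / (alphaq d * tau d) * (q - histH k (qst d) n)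
    + (q - qst d n) / tau d * Ephir d k n
    + q / (Web d * Cahn d) *
        l2in (Omega d) (\<lambda>x. phiE d k n x *\<^sub>R uc x) (wgrad (Omega d) mu)
    - q / (Web d * Cahn d) * capillary d phi mu u = 0"

definition saddle_momentum ::
  "('d::finite) scheme \<Rightarrow> nat \<Rightarrow> nat \<Rightarrow> 'd vfun \<Rightarrow> 'd sfun \<Rightarrow> 'd sfun \<Rightarrow> real \<Rightarrow>
   'd vfun \<Rightarrow> 'd sfun \<Rightarrow> bool"
  where "saddle_momentum d k n uc phi mu q u p \<longleftrightarrow>
   (let A = Omega d in
    u \<in> Vh d (n+1) \<and> p \<in> P0 d (n+1) \<and>
    (\<forall>v\<in>Vh d (n+1).
       momentum_lhs d k n uc phi mu u v - l2in A p (wdiv A v)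
       = l2in A (force d (n+1)) v - q / (Web d * Cahn d) * capillary d phi mu v) \<and>
    (\<forall>\<alpha>\<in>P0 d (n+1). l2in A (wdiv A u) \<alpha> = 0))"

definition saddle_step ::
  "('d::finite) scheme \<Rightarrow> nat \<Rightarrow> nat \<Rightarrow> 'd sfun \<Rightarrow> 'd sfun \<Rightarrow> 'd sfun \<Rightarrow> 'd sfun \<Rightarrow> real \<Rightarrow>
   'd vfun \<Rightarrow> 'd sfun \<Rightarrow> real \<Rightarrow> bool"
  where "saddle_step d k n phiH lam phi mu r u p q \<longleftrightarrow>
   (let uc = carrier d k n lam in
    steps_1_to_3 d k n phiH lam phi mu r \<and> 0 < q \<and>
    saddle_momentum d k n uc phi mu q u p \<and> scalar_eq d k n uc phi mu u q)"

text \<open>The density-weighted discrete gradient at level \<open>l\<close>, with density \<open>\<rho>(ph)\<close>.\<close>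

definition dgrad :: "('d::finite) scheme \<Rightarrow> nat \<Rightarrow> 'd sfun \<Rightarrow> 'd sfun \<Rightarrow> 'd vfun"
  where "dgrad d l ph \<pi> =
    (THE g. g \<in> Vh d l \<and> (\<forall>v\<in>Vh d l.
       l2in (Omega d) (\<lambda>x. rho d (ph x) *\<^sub>R g x) v = - l2in (Omega d) \<pi> (wdiv (Omega d) v)))"

definition pressure_form :: "('d::finite) scheme \<Rightarrow> nat \<Rightarrow> 'd sfun \<Rightarrow> 'd sfun \<Rightarrow> 'd sfun \<Rightarrow> real"
  where "pressure_form d l ph \<pi> \<alpha> =
    l2in (Omega d) (\<lambda>x. rho d (ph x) *\<^sub>R dgrad d l ph \<pi> x) (dgrad d l ph \<alpha>)"

definition xi_p :: "('d::finite) scheme \<Rightarrow> nat \<Rightarrow> 'd vfun"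
  where "xi_p d n =
   (let g = (\<lambda>x. sqrt (rho d (phist d n x)) *\<^sub>R dgrad d n (phist d n) (pist d n) x) in
    if ALE d n then ale_transfer d n g else g)"

definition pc_transported :: "('d::finite) scheme \<Rightarrow> nat \<Rightarrow> 'd sfun \<Rightarrow> 'd sfun \<Rightarrow> bool"
  where "pc_transported d n phi pitr \<longleftrightarrow> pitr \<in> P0 d (n+1) \<and>
    (\<forall>\<alpha>\<in>P0 d (n+1). pressure_form d (n+1) phi pitr \<alpha>
       = l2in (Omega d) (xi_p d n) (\<lambda>x. sqrt (rho d (phi x)) *\<^sub>R dgrad d (n+1) phi \<alpha> x))"

definition pc_predicted :: "('d::finite) scheme \<Rightarrow> nat \<Rightarrow> nat \<Rightarrow> 'd sfun \<Rightarrow> 'd sfun \<Rightarrow> bool"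
  where "pc_predicted d k n phi pibar \<longleftrightarrow> pibar \<in> P0 d (n+1) \<and>
    (\<forall>\<alpha>\<in>P0 d (n+1). pressure_form d (n+1) phi pibar \<alpha>
       = l2in (Omega d) (\<lambda>x. xi_p d n x + (gam k / tau d) *\<^sub>R zetaH d k n x)
                        (\<lambda>x. sqrt (rho d (phi x)) *\<^sub>R dgrad d (n+1) phi \<alpha> x))"

definition pc_momentum ::
  "('d::finite) scheme \<Rightarrow> nat \<Rightarrow> nat \<Rightarrow> 'd vfun \<Rightarrow> 'd sfun \<Rightarrow> 'd sfun \<Rightarrow> 'd sfun \<Rightarrow> real \<Rightarrow>
   'd vfun \<Rightarrow> bool"
  where "pc_momentum d k n uc phi mu pibar q us \<longleftrightarrow>
   (let A = Omega d in
    us \<in> Vh d (n+1) \<and>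
    (\<forall>v\<in>Vh d (n+1).
       momentum_lhs d k n uc phi mu us v
       = l2in A pibar (wdiv A v) + l2in A (force d (n+1)) v
         - q / (Web d * Cahn d) * capillary d phi mu v))"

definition pc_correction ::
  "('d::finite) scheme \<Rightarrow> nat \<Rightarrow> nat \<Rightarrow> 'd sfun \<Rightarrow> 'd vfun \<Rightarrow> 'd sfun \<Rightarrow> bool"
  where "pc_correction d k n phi us dpi \<longleftrightarrow> dpi \<in> P0 d (n+1) \<and>
    (\<forall>\<alpha>\<in>P0 d (n+1). pressure_form d (n+1) phi dpi \<alpha>
       = - (gam k / tau d) * l2in (Omega d) (wdiv (Omega d) us) \<alpha>)"

definition pc_step ::
  "('d::finite) scheme \<Rightarrow> nat \<Rightarrow> nat \<Rightarrow> 'd sfun \<Rightarrow> 'd sfun \<Rightarrow> 'd sfun \<Rightarrow> 'd sfun \<Rightarrow> real \<Rightarrow>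
   'd sfun \<Rightarrow> 'd sfun \<Rightarrow> 'd vfun \<Rightarrow> real \<Rightarrow> 'd sfun \<Rightarrow> 'd vfun \<Rightarrow> 'd sfun \<Rightarrow> bool"
  where "pc_step d k n phiH lam phi mu r pitr pibar us q dpi u p \<longleftrightarrow>
   (let uc = carrier d k n lam in
    steps_1_to_3 d k n phiH lam phi mu r \<and>
    pc_transported d n phi pitr \<and> pc_predicted d k n phi pibar \<and>
    0 < q \<and> pc_momentum d k n uc phi mu pibar q us \<and> scalar_eq d k n uc phi mu us q \<and>
    pc_correction d k n phi us dpi \<and>
    u = (\<lambda>x. us x - (tau d / gam k) *\<^sub>R dgrad d (n+1) phi dpi x) \<and>
    p = (\<lambda>x. pitr x + dpi x))"

section \<open>The scalar quadratic\<close>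

text \<open>Affine dependence on \<open>q\<close> of the velocity: for every \<open>q\<close>, \<open>u0 + q u1\<close> is the one and only
  velocity solving the momentum(--pressure) equations with parameter \<open>q\<close>.\<close>

definition saddle_affine ::
  "('d::finite) scheme \<Rightarrow> nat \<Rightarrow> nat \<Rightarrow> 'd vfun \<Rightarrow> 'd sfun \<Rightarrow> 'd sfun \<Rightarrow> 'd vfun \<Rightarrow> 'd vfun \<Rightarrow> bool"
  where "saddle_affine d k n uc phi mu u0 u1 \<longleftrightarrow>
    (\<forall>q u. (\<exists>p. saddle_momentum d k n uc phi mu q u p) \<longleftrightarrow> u = (\<lambda>x. u0 x + q *\<^sub>R u1 x))"

definition pc_affine ::
  "('d::finite) scheme \<Rightarrow> nat \<Rightarrow> nat \<Rightarrow> 'd vfun \<Rightarrow> 'd sfun \<Rightarrow> 'd sfun \<Rightarrow> 'd sfun \<Rightarrow>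
   'd vfun \<Rightarrow> 'd vfun \<Rightarrow> bool"
  where "pc_affine d k n uc phi mu pibar u0 u1 \<longleftrightarrow>
    (\<forall>q u. pc_momentum d k n uc phi mu pibar q u \<longleftrightarrow> u = (\<lambda>x. u0 x + q *\<^sub>R u1 x))"

definition Aq :: "('d::finite) scheme \<Rightarrow> nat \<Rightarrow> 'd sfun \<Rightarrow> 'd vfun \<Rightarrow> real"
  where "Aq d k phi u1 =
    gam k / alphaq d
    + gam k * (l2norm (Omega d) (\<lambda>x. sqrt (rho d (phi x)) *\<^sub>R u1 x))\<^sup>2
    + 2 * tau d / Rey d *
        (l2norm (Omega d) (\<lambda>x. sqrt (eta d (phi x)) *\<^sub>R symgrad (Omega d) u1 x))\<^sup>2"

definition Bq ::
  "('d::finite) scheme \<Rightarrow> nat \<Rightarrow> nat \<Rightarrow> 'd vfun \<Rightarrow> 'd sfun \<Rightarrow> 'd sfun \<Rightarrow> 'd vfun \<Rightarrow> real"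
  where "Bq d k n uc phi mu u0 =
    - (gam k / alphaq d) * histH k (qst d) n + Ephir d k n
    + tau d / (Web d * Cahn d) *
        l2in (Omega d) (\<lambda>x. phiE d k n x *\<^sub>R uc x) (wgrad (Omega d) mu)
    - tau d / (Web d * Cahn d) * capillary d phi mu u0"

definition Cq :: "('d::finite) scheme \<Rightarrow> nat \<Rightarrow> nat \<Rightarrow> real"
  where "Cq d k n = qst d n * Ephir d k n"

definition q_root ::
  "('d::finite) scheme \<Rightarrow> nat \<Rightarrow> nat \<Rightarrow> 'd vfun \<Rightarrow> 'd sfun \<Rightarrow> 'd sfun \<Rightarrow> 'd vfun \<Rightarrow> 'd vfun \<Rightarrow>
   real \<Rightarrow> bool"
  where "q_root d k n uc phi mu u0 u1 q \<longleftrightarrow>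
    Aq d k phi u1 * q\<^sup>2 + Bq d k n uc phi mu u0 * q - Cq d k n = 0"

section \<open>Hypotheses\<close>

definition admissible_parameters :: "('d::finite) scheme \<Rightarrow> bool"
  where "admissible_parameters d \<longleftrightarrow>
    0 < Cahn d \<and> 0 < Pec d \<and> 0 < Rey d \<and> 0 < Web d \<and> 0 < alphaq d \<and> 0 < CA d \<and> 0 < tau d \<and>
    0 < spar d \<and> 0 < CG d \<and> (\<forall>a. 0 \<le> mobility d a) \<and> (\<forall>a. Gpot d field_differentiable at a) \<and>
    0 < rho_lo d \<and> rho_lo d \<le> rho_hi d \<and> 0 < eta_lo d \<and> eta_lo d \<le> eta_hi d"

definition discretization :: "('d::finite) scheme \<Rightarrow> nat \<Rightarrow> bool"
  where "discretization d n \<longleftrightarrow>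
    polyhedral_domain (Omega d) \<and>
    GammaD d \<subseteq> frontier (Omega d) \<and> GammaS d \<subseteq> frontier (Omega d) \<and>
    frontier (Omega d) = closure (GammaD d) \<union> closure (GammaS d) \<and>
    (top_of_set (frontier (Omega d)) interior_of GammaD d) \<inter>
      (top_of_set (frontier (Omega d)) interior_of GammaS d) = {} \<and>
    (\<exists>\<sigma>>0. \<forall>l\<le>n+1. shape_regular \<sigma> (Mesh d l)) \<and>
    (\<forall>l\<le>n+1.
       mesh_of (Omega d) (Mesh d l) \<and>
       preserves_boundary (Omega d) (GammaD d) (GammaS d) (Mesh d l) \<and>
       fin_dim_space (Omega d) (Sh d l) \<and> Sh d l \<subseteq> H1 (Omega d) \<and>
       contains_one (Omega d) (Sh d l) \<and>
       fin_dim_space (Omega d) (Vh d l) \<and>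
       Vh d l \<subseteq> {v \<in> H1v (Omega d). zero_trace (Omega d) (GammaD d) v \<and>
                                   zero_normal_trace (Omega d) (GammaS d) v} \<and>
       fin_dim_space (Omega d) (Ph d l) \<and> contains_one (Omega d) (Ph d l))"

text \<open>The bounds \<open>0 < \<rho>\<^sub>* \<le> \<rho>(ph) \<le> \<rho>\<^sup>*\<close>, \<open>0 < \<eta>\<^sub>* \<le> \<eta>(ph) \<le> \<eta>\<^sup>*\<close>; positivity of the constants is
  part of \<open>admissible_parameters\<close>.\<close>

definition within_bounds :: "('d::finite) scheme \<Rightarrow> 'd sfun \<Rightarrow> bool"
  where "within_bounds d ph \<longleftrightarrow> (AE x\<in>Omega d in lebesgue.
    rho_lo d \<le> rho d (ph x) \<and> rho d (ph x) \<le> rho_hi d \<and>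
    eta_lo d \<le> eta d (ph x) \<and> eta d (ph x) \<le> eta_hi d)"

definition accepted_states :: "('d::finite) scheme \<Rightarrow> nat \<Rightarrow> bool"
  where "accepted_states d n \<longleftrightarrow>
    (\<forall>l\<le>n. phist d l \<in> Sh d l \<and> ust d l \<in> Vh d l \<and> pist d l \<in> P0 d l \<and> within_bounds d (phist d l)) \<and>
    rst d 0 = sqrt ((LINT x:Omega d|lebesgue. Gpot d (phist d 0 x)) + CG d) \<and> qst d 0 = 1"

text \<open>The update \<open>m\<close> is a fixed-topology update whose reference triangulation is mapped onto the
  meshes of the levels in \<open>Ls\<close>.  Uniform admissibility of the maps and their inverses is the
  two-sided Lipschitz bound.\<close>

definition ale_admissible :: "('d::finite) scheme \<Rightarrow> nat \<Rightarrow> nat set \<Rightarrow> bool"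
  where "ale_admissible d m Ls \<longleftrightarrow>
    polyhedral_domain (RefDom d m) \<and> mesh_of (RefDom d m) (RefMesh d m) \<and>
    fin_dim_space (RefDom d m) (RefSh d m) \<and> RefSh d m \<subseteq> H1 (RefDom d m) \<and>
    (\<exists>L>0. \<forall>l\<in>Ls. \<forall>x\<in>closure (RefDom d m). \<forall>y\<in>closure (RefDom d m).
       dist (Xmap d m l x) (Xmap d m l y) \<le> L * dist x y \<and>
       dist x y \<le> L * dist (Xmap d m l x) (Xmap d m l y)) \<and>
    (\<forall>l\<in>Ls.
       Xmap d m l ` RefDom d m = Omega d \<and>
       (image (Xmap d m l)) ` RefMesh d m = Mesh d l \<and>
       (\<forall>T\<in>RefMesh d m. continuous_on (interior T) (Fmat d m l) \<and>
          (\<forall>x\<in>interior T. Xmap d m l differentiable at x \<and> 0 < Jdet d m l x)) \<and>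
       (\<forall>\<theta>\<in>Sh d l. \<exists>\<theta>h\<in>RefSh d m. AE x\<in>RefDom d m in lebesgue. \<theta>h x = \<theta> (Xmap d m l x)))"

definition proj_admissible :: "('d::finite) scheme \<Rightarrow> nat \<Rightarrow> 'd vfun \<Rightarrow> bool"
  where "proj_admissible d m g \<longleftrightarrow>
    (l2norm (Omega d) g \<noteq> 0 \<longrightarrow> l2norm (Omega d) (l2proj (Omega d) (Hist d m) g) \<noteq> 0)"

text \<open>For the BDF2 step the maps of a fixed-topology update are also needed at level \<open>n - 1\<close>, and
  the history \<open>g\<^sub>1\<close> has to be transferred as well.\<close>

definition admissible_transfers :: "('d::finite) scheme \<Rightarrow> nat \<Rightarrow> nat \<Rightarrow> bool"
  where "admissible_transfers d k n \<longleftrightarrow>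
    (\<forall>m\<le>n. if ALE d m then ale_admissible d m {m, m+1}
       else fin_dim_space (Omega d) (Hist d m) \<and>
            (\<forall>w\<in>Hist d m. piecewise_polynomial (Mesh d (m+1)) w) \<and>
            proj_admissible d m (g0 d m)) \<and>
    (k = 2 \<longrightarrow> (if ALE d n then ale_admissible d n {n-1, n, n+1} else proj_admissible d n (g1 d n)))"

text \<open>Finiteness of those integrals of the scheme whose integrands are not products of two square
  integrable fields.\<close>

definition finite_integrals :: "('d::finite) scheme \<Rightarrow> nat \<Rightarrow> nat \<Rightarrow> bool"
  where "finite_integrals d k n \<longleftrightarrow>
   (let A = Omega d; gr = wgrad A; S = Sh d (n+1); V = Vh d (n+1) in
    set_integrable lebesgue A (\<lambda>x. Gpot d (phiE d k n x)) \<and>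
    (\<forall>\<theta>\<in>S. set_integrable lebesgue A (\<lambda>x. dGE d k n x * \<theta> x)) \<and>
    (\<forall>\<mu>\<in>S. \<forall>\<omega>\<in>S. set_integrable lebesgue A (\<lambda>x. (mE d k n x *\<^sub>R gr \<mu> x) \<bullet> gr \<omega> x)) \<and>
    (\<forall>\<phi>\<in>S. \<forall>\<mu>\<in>S. \<forall>v\<in>V. set_integrable lebesgue A (\<lambda>x. (\<phi> x *\<^sub>R gr \<mu> x) \<bullet> v x)) \<and>
    (\<forall>lam. carrier_potential d k n lam \<longrightarrow>
      (\<forall>\<omega>\<in>S. set_integrable lebesgue A (\<lambda>x. (phiE d k n x *\<^sub>R carrier d k n lam x) \<bullet> gr \<omega> x)) \<and>
      (\<forall>\<phi>\<in>S. \<forall>\<mu>\<in>S. \<forall>v\<in>V. \<forall>z\<in>V.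
         set_integrable lebesgue A (\<lambda>x. advect d k n (carrier d k n lam) \<phi> \<mu> v x \<bullet> z x))))"

text \<open>Extended reals are used since a supremum or infimum may range over the empty set when a space
  is trivial.\<close>

definition inf_sup_condition :: "('d::finite) scheme \<Rightarrow> nat \<Rightarrow> bool"
  where "inf_sup_condition d l \<longleftrightarrow>
    (\<exists>\<beta>>0. ereal \<beta> \<le>
      (INF \<alpha>\<in>P0 d l - {\<lambda>_. 0}. SUP v\<in>Vh d l - {\<lambda>_. 0}.
         ereal (l2in (Omega d) \<alpha> (wdiv (Omega d) v) / (h1norm (Omega d) v * l2norm (Omega d) \<alpha>))))"

definition pressure_form_pos_def :: "('d::finite) scheme \<Rightarrow> nat \<Rightarrow> 'd sfun \<Rightarrow> bool"
  where "pressure_form_pos_def d l ph \<longleftrightarrow>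
    (\<forall>\<alpha>\<in>P0 d l. \<alpha> \<noteq> (\<lambda>_. 0) \<longrightarrow> 0 < pressure_form d l ph \<alpha> \<alpha>)"

end

(* Each problem of the step is a linear system on a finite-dimensional space of functions, so by the
   Fredholm alternative it suffices that the homogeneous and the transposed homogeneous system have
   the trivial solution only.  Testing with the unknowns gives an energy identity that forces this:
   s > 0 and the square of r for the phase-SAV system, the density-weighted mass together with the
   antisymmetry of the convective form for the velocity, inf-sup or definiteness of the pressure
   form for the pressures.  For the carrier potential the energy is the Dirichlet integral, and one
   needs that a function with vanishing weak gradient on a connected open set is constant.

   The velocity is affine in q, and testing with its linear part u1 turns the capillary work in the
   scalar equation into the dissipation of u1.  Hence the leading coefficient of the quadratic is
   positive while its constant term is - q^n E < 0: exactly one root is positive.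

   All forms are Lebesgue integrals of weak derivatives, which are determined up to null sets only.
   Linearity therefore rests on the a.e. uniqueness of weak gradients and on the square
   integrability of every transferred history.  The latter is a change of variables under
   bi-Lipschitz maps, for which the one-sided estimate of the measure of a Lipschitz image is enough. *)

theory Submission
  imports Defs "HOL-Library.Function_Algebras"
begin

section \<open>Finite-dimensional variational problems\<close>

text \<open>The discrete spaces are sets of functions, not types of class
  \<open>euclidean_space\<close>. Pointwise operations make functions a \<open>real_vector\<close>,
  and spans of finite sets replace coordinates; solvability is then a least squares argument on a
  spanning set, not a dimension count. Since \<open>wgrad\<close> is an arbitrary choice among a.e.
  equal gradients, even \<open>wgrad (u + v)\<close> and the sum of the two gradients may differ on
  a null set. The forms are nevertheless exactly linear on the spaces concerned, and
  \<open>fin_dim_space\<close>, which keeps one representative of each class, turns a.e. uniqueness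
  back into equality of functions. That a zero weak gradient forces a constant is proved without
  mollification: the pairing with a shifted test function does not depend on the shift, so the
  function itself is invariant almost everywhere under each small shift, and Fubini exchanges shift
  and point. Positivity of \<open>CA d\<close> is what keeps the constant term of the quadratic
  strictly negative even for a vanishing state.\<close>

instantiation "fun" :: (type, real_vector) real_vector
begin

definition scaleR_fun_def: "c *\<^sub>R f = (\<lambda>x. c *\<^sub>R f x)"

instance
  by standard (auto simp: scaleR_fun_def plus_fun_def scaleR_add_right scaleR_add_left)

end

lemmas fun_vec_defs = plus_fun_def fun_diff_def zero_fun_def scaleR_fun_def

text \<open>Linearity is asked on \<open>W\<close> only: integrals are additive only where the
  integrands are integrable, and weak gradients carry meaning only on \<open>H1\<close>.\<close>

definition linear_on_set :: "'a::real_vector set \<Rightarrow> ('a \<Rightarrow> real) \<Rightarrow> bool"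
  where "linear_on_set W f \<longleftrightarrow>
    (\<forall>x\<in>W. \<forall>y\<in>W. f (x + y) = f x + f y) \<and> (\<forall>c. \<forall>x\<in>W. f (c *\<^sub>R x) = c * f x)"

definition finite_span :: "'a::real_vector set \<Rightarrow> bool"
  where "finite_span W \<longleftrightarrow> (\<exists>B. finite B \<and> W = span B)"

lemma linear_on_setI:
  assumes "\<And>x y. x \<in> W \<Longrightarrow> y \<in> W \<Longrightarrow> f (x + y) = f x + f y"
    and "\<And>c x. x \<in> W \<Longrightarrow> f (c *\<^sub>R x) = c * f x"
  shows "linear_on_set W f"
  using assms by (auto simp: linear_on_set_def)

lemma linear_on_set_add: "linear_on_set W f \<Longrightarrow> x \<in> W \<Longrightarrow> y \<in> W \<Longrightarrow> f (x + y) = f x + f y"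
  and linear_on_set_scale: "linear_on_set W f \<Longrightarrow> x \<in> W \<Longrightarrow> f (c *\<^sub>R x) = c * f x"
  by (auto simp: linear_on_set_def)

lemma linear_on_set_diff:
  assumes "linear_on_set W f" "subspace W" "x \<in> W" "y \<in> W"
  shows "f (x - y) = f x - f y"
proof -
  have "f (x - y) = f (x + (-1) *\<^sub>R y)" by simp
  also have "\<dots> = f x - f y"
    using linear_on_set_add[OF assms(1,3) subspace_scale[OF assms(2,4)], of "-1"]
      linear_on_set_scale[OF assms(1,4), where c="-1"] by simp
  finally show ?thesis .
qed

lemma linear_on_set_0: "linear_on_set W f \<Longrightarrow> 0 \<in> W \<Longrightarrow> f 0 = 0"
  using linear_on_set_scale[of W f 0 0] by simp

lemma linear_on_set_mono: "linear_on_set W f \<Longrightarrow> V \<subseteq> W \<Longrightarrow> linear_on_set V f"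
  unfolding linear_on_set_def by blast

lemma linear_on_set_plus:
  "linear_on_set W f \<Longrightarrow> linear_on_set W g \<Longrightarrow> linear_on_set W (\<lambda>x. f x + g x)"
  by (simp add: linear_on_set_def algebra_simps)

lemma linear_on_set_minus:
  "linear_on_set W f \<Longrightarrow> linear_on_set W g \<Longrightarrow> linear_on_set W (\<lambda>x. f x - g x)"
  by (simp add: linear_on_set_def algebra_simps)

lemma linear_on_set_cmult: "linear_on_set W f \<Longrightarrow> linear_on_set W (\<lambda>x. c * f x)"
  by (simp add: linear_on_set_def algebra_simps)

lemma linear_on_set_zero: "linear_on_set W (\<lambda>x. 0)"
  by (simp add: linear_on_set_def)

lemma linear_on_set_sum:
  assumes "linear_on_set W f" "subspace W" "B \<subseteq> W" "finite B"
  shows "f (\<Sum>b\<in>B. c b *\<^sub>R b) = (\<Sum>b\<in>B. c b * f b)"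
  using assms(4,3)
proof (induction B rule: finite_induct)
  case empty
  then show ?case using linear_on_set_0[OF assms(1)] subspace_0[OF assms(2)] by simp
next
  case (insert a F)
  then have "(\<Sum>b\<in>F. c b *\<^sub>R b) \<in> W"
    by (auto intro!: subspace_sum[OF assms(2)] subspace_scale[OF assms(2)])
  with insert show ?case
    using subspace_scale[OF assms(2)]
    by (simp add: linear_on_set_add[OF assms(1)] linear_on_set_scale[OF assms(1)])
qed

lemma finite_span_subspace: "finite_span W \<Longrightarrow> subspace W"
  unfolding finite_span_def by auto

lemma finite_span_subset:
  assumes "finite_span W" "subspace V" "V \<subseteq> W"
  shows "finite_span V"
proof -
  obtain B where B: "finite B" "W = span B" using assms(1) by (auto simp: finite_span_def)
  obtain C where C: "C \<subseteq> V" "independent C" "V \<subseteq> span C"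
    using basis_exists[of V] by metis
  have "finite C"
    using independent_span_bound[OF B(1) C(2)] C(1) assms(3) B(2) by auto
  moreover have "V = span C"
    using C assms(2) by (metis span_minimal subset_antisym)
  ultimately show ?thesis by (auto simp: finite_span_def)
qed

lemma finite_span_UNIV_real: "finite_span (UNIV :: real set)"
proof -
  have "span {1::real} = UNIV"
    by (auto simp: span_singleton)
  then show ?thesis unfolding finite_span_def by (intro exI[of _ "{1}"]) auto
qed

lemma finite_span_Times:
  assumes "finite_span V" "finite_span W"
  shows "finite_span (V \<times> W)"
proof -
  obtain B C where B: "finite B" "V = span B" and C: "finite C" "W = span C"
    using assms by (auto simp: finite_span_def)
  have "V \<times> W \<subseteq> span (B \<times> {0} \<union> {0} \<times> C)"
  proof clarify
    fix x y assume "x \<in> V" "y \<in> W"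
    have "(x, 0) \<in> span (B \<times> {0::'b})"
    proof -
      have "linear (\<lambda>x. (x, 0::'b))" by (auto intro!: linearI)
      then have "span ((\<lambda>x. (x, 0)) ` B) = (\<lambda>x. (x, 0::'b)) ` span B"
        by (rule linear_span_image)
      moreover have "(\<lambda>x. (x, 0::'b)) ` B = B \<times> {0}" by auto
      ultimately show ?thesis using \<open>x \<in> V\<close> B(2) by auto
    qed
    moreover have "(0, y) \<in> span ({0::'a} \<times> C)"
    proof -
      have "linear (\<lambda>y. (0::'a, y))" by (auto intro!: linearI)
      then have "span ((\<lambda>y. (0, y)) ` C) = (\<lambda>y. (0::'a, y)) ` span C"
        by (rule linear_span_image)
      moreover have "(\<lambda>y. (0::'a, y)) ` C = {0} \<times> C" by auto
      ultimately show ?thesis using \<open>y \<in> W\<close> C(2) by auto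
    qed
    ultimately have "(x, 0) + (0, y) \<in> span (B \<times> {0} \<union> {0} \<times> C)"
      by (intro span_add) (auto elim: subsetD[OF span_mono, rotated])
    then show "(x, y) \<in> span (B \<times> {0} \<union> {0} \<times> C)" by simp
  qed
  moreover have "subspace (V \<times> W)"
    using finite_span_subspace[OF assms(1)] finite_span_subspace[OF assms(2)]
    by (rule subspace_Times)
  moreover have "finite_span (span (B \<times> {0} \<union> {0} \<times> C))"
    unfolding finite_span_def using B(1) C(1) by (intro exI[of _ "B \<times> {0} \<union> {0} \<times> C"]) simp
  ultimately show ?thesis using finite_span_subset by blast
qed

text \<open>The least squares residual of \<open>b\<close> against the rows \<open>A i\<close>, built as in Gram-Schmidt.\<close>

lemma orthogonal_residual_exists:
  fixes A :: "'i \<Rightarrow> 'j \<Rightarrow> real"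
  assumes "finite J" "finite I"
  shows "\<exists>c. \<forall>i\<in>I. (\<Sum>j\<in>J. (b j - (\<Sum>i'\<in>I. c i' * A i' j)) * A i j) = 0"
  using assms(2)
proof (induction I arbitrary: b rule: finite_induct)
  case empty
  then show ?case by simp
next
  case (insert a I)
  define R where "R b c j = b j - (\<Sum>i'\<in>I. c i' * A i' j)" for b c :: "_ \<Rightarrow> real" and j
  obtain c where c: "\<forall>i\<in>I. (\<Sum>j\<in>J. R b c j * A i j) = 0"
    using insert.IH[of b] unfolding R_def by blast
  \<comment> \<open>\<open>R (A a) e\<close> is the part of the new row orthogonal to the old rows;
    correcting along it keeps the orthogonality already reached.\<close>
  obtain e where e: "\<forall>i\<in>I. (\<Sum>j\<in>J. R (A a) e j * A i j) = 0"
    using insert.IH[of "A a"] unfolding R_def by blast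
  define N where "N = (\<Sum>j\<in>J. R (A a) e j * R (A a) e j)"
  define t where "t = (\<Sum>j\<in>J. R b c j * R (A a) e j) / N"
  define c' where "c' i = (if i = a then t else c i - t * e i)" for i
  have res: "b j - (\<Sum>i\<in>insert a I. c' i * A i j) = R b c j - t * R (A a) e j" for j
  proof -
    have "(\<Sum>i\<in>I. c' i * A i j) = (\<Sum>i\<in>I. c i * A i j) - t * (\<Sum>i\<in>I. e i * A i j)"
      unfolding c'_def using insert.hyps
      unfolding sum_distrib_left sum_subtractf[symmetric]
      by (intro sum.cong) (auto simp: algebra_simps)
    then show ?thesis
      using insert.hyps by (simp add: R_def c'_def algebra_simps)
  qed
  have ort: "(\<Sum>j\<in>J. (R b c j - t * R (A a) e j) * A i j) = 0" if "i \<in> I" for i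
  proof -
    have "(\<Sum>j\<in>J. (R b c j - t * R (A a) e j) * A i j)
      = (\<Sum>j\<in>J. R b c j * A i j) - t * (\<Sum>j\<in>J. R (A a) e j * A i j)"
      unfolding sum_distrib_left sum_subtractf[symmetric]
      by (intro sum.cong) (auto simp: algebra_simps)
    then show ?thesis using c e that by simp
  qed
  \<comment> \<open>The row \<open>A a\<close> is its residual plus a combination of old rows. The
    latter contribute nothing by \<open>ort\<close>, so only the residual direction has to be
    tested.\<close>
  have "(\<Sum>j\<in>J. (R b c j - t * R (A a) e j) * A a j)
    = (\<Sum>j\<in>J. (R b c j - t * R (A a) e j) * R (A a) e j)
      + (\<Sum>j\<in>J. \<Sum>i\<in>I. e i * ((R b c j - t * R (A a) e j) * A i j))"
    unfolding sum.distrib[symmetric]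
  proof (intro sum.cong refl)
    fix j
    have "A a j = R (A a) e j + (\<Sum>i\<in>I. e i * A i j)" by (simp add: R_def)
    then show "(R b c j - t * R (A a) e j) * A a j
      = (R b c j - t * R (A a) e j) * R (A a) e j
        + (\<Sum>i\<in>I. e i * ((R b c j - t * R (A a) e j) * A i j))"
      by (simp add: distrib_left sum_distrib_left mult.left_commute)
  qed
  also have "(\<Sum>j\<in>J. \<Sum>i\<in>I. e i * ((R b c j - t * R (A a) e j) * A i j))
    = (\<Sum>i\<in>I. e i * (\<Sum>j\<in>J. (R b c j - t * R (A a) e j) * A i j))"
    by (subst sum.swap) (simp add: sum_distrib_left)
  also have "\<dots> = 0" using ort by simp
  also have "(\<Sum>j\<in>J. (R b c j - t * R (A a) e j) * R (A a) e j)
      = (\<Sum>j\<in>J. R b c j * R (A a) e j) - t * N"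
    unfolding N_def sum_distrib_left sum_subtractf[symmetric]
    by (intro sum.cong) (auto simp: algebra_simps)
  also have "\<dots> = 0"
  \<comment> \<open>If \<open>N = 0\<close>, the new row is a combination of the old ones on
    \<open>J\<close>: its residual vanishes there, so both terms are zero whatever \<open>t\<close>
    is. Otherwise \<open>t\<close> is the projection coefficient.\<close>
  proof (cases "N = 0")
    case True
    then have "\<forall>j\<in>J. R (A a) e j * R (A a) e j = 0"
      unfolding N_def by (subst (asm) sum_nonneg_eq_0_iff) (auto simp: assms(1))
    then show ?thesis by (simp add: True)
  qed (simp add: t_def)
  finally have "(\<Sum>j\<in>J. (R b c j - t * R (A a) e j) * A a j) = 0" by simp
  with ort show ?case
    unfolding res[symmetric] by blast
qed

text \<open>The least squares residual \<open>y\<close> of \<open>b\<close> is orthogonal to every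
  row, so it is one of the kernel vectors to which \<open>ker\<close> applies. Then \<open>b\<close>
  is orthogonal to \<open>y\<close>, and so is \<open>b - y\<close>, a combination of rows; hence
  \<open>y\<close> has square norm zero.\<close>

lemma fredholm_alternative:
  fixes A :: "'i \<Rightarrow> 'j \<Rightarrow> real"
  assumes fin: "finite J" "finite I"
    and ker: "\<And>y. (\<And>i. i \<in> I \<Longrightarrow> (\<Sum>j\<in>J. A i j * y j) = 0) \<Longrightarrow> (\<Sum>j\<in>J. b j * y j) = 0"
  shows "\<exists>c. \<forall>j\<in>J. (\<Sum>i\<in>I. c i * A i j) = b j"
proof -
  obtain c where c: "\<forall>i\<in>I. (\<Sum>j\<in>J. (b j - (\<Sum>i'\<in>I. c i' * A i' j)) * A i j) = 0"
    using orthogonal_residual_exists[OF fin] by blast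
  define y where "y j = b j - (\<Sum>i\<in>I. c i * A i j)" for j
  have yA: "(\<Sum>j\<in>J. A i j * y j) = 0" if "i \<in> I" for i
    using c that by (simp add: y_def mult.commute)
  have "(\<Sum>j\<in>J. y j * y j) = (\<Sum>j\<in>J. b j * y j) - (\<Sum>j\<in>J. \<Sum>i\<in>I. c i * (A i j * y j))"
    unfolding sum_subtractf[symmetric]
    by (intro sum.cong refl) (simp add: y_def left_diff_distrib sum_distrib_right mult.assoc)
  also have "(\<Sum>j\<in>J. \<Sum>i\<in>I. c i * (A i j * y j)) = (\<Sum>i\<in>I. c i * (\<Sum>j\<in>J. A i j * y j))"
    by (subst sum.swap) (simp add: sum_distrib_left)
  also have "\<dots> = 0" using yA by simp
  also have "(\<Sum>j\<in>J. b j * y j) = 0" using ker yA by blast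
  finally have "\<forall>j\<in>J. y j * y j = 0"
    by (subst (asm) diff_self, subst (asm) sum_nonneg_eq_0_iff) (auto simp: fin)
  then have "\<forall>j\<in>J. (\<Sum>i\<in>I. c i * A i j) = b j" by (simp add: y_def)
  then show ?thesis by blast
qed

text \<open>The spanning set \<open>B\<close> may be dependent. A coefficient vector killed by the
  matrix \<open>a i j\<close> represents some \<open>w\<close> with \<open>a u w = 0\<close> for all
  \<open>u\<close>, hence \<open>w = 0\<close> by \<open>nondeg\<close> and \<open>l w = 0\<close>.
  This is exactly the solvability condition of the matrix system, so redundant coefficients do no
  harm.\<close>

proposition form_solution_exists:
  assumes W: "finite_span W"
    and lin1: "\<And>w. w \<in> W \<Longrightarrow> linear_on_set W (\<lambda>u. a u w)"
    and lin2: "\<And>u. u \<in> W \<Longrightarrow> linear_on_set W (a u)"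
    and l: "linear_on_set W l"
    and nondeg: "\<And>w. w \<in> W \<Longrightarrow> (\<And>u. u \<in> W \<Longrightarrow> a u w = 0) \<Longrightarrow> w = 0"
  shows "\<exists>u\<in>W. \<forall>w\<in>W. a u w = l w"
proof -
  obtain B where B: "finite B" "W = span B" using W by (auto simp: finite_span_def)
  have sW: "subspace W" and BW: "B \<subseteq> W" using B span_superset by auto
  have comb: "(\<Sum>b\<in>B. c b *\<^sub>R b) \<in> W" for c
    using BW by (intro subspace_sum[OF sW] subspace_scale[OF sW]) auto
  have "\<exists>c. \<forall>j\<in>B. (\<Sum>i\<in>B. c i * a i j) = l j"
  proof (rule fredholm_alternative[OF B(1) B(1)])
    fix y assume y: "\<And>i. i \<in> B \<Longrightarrow> (\<Sum>j\<in>B. a i j * y j) = 0"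
    define w where "w = (\<Sum>b\<in>B. y b *\<^sub>R b)"
    have wW: "w \<in> W" unfolding w_def by (rule comb)
    have 1: "a i w = 0" if "i \<in> B" for i
      unfolding w_def using that BW linear_on_set_sum[OF lin2 sW BW B(1), of i y] y
      by (auto simp: mult.commute)
    have "w = 0"
    proof (rule nondeg[OF wW])
      fix u assume "u \<in> W"
      then obtain c where c: "u = (\<Sum>b\<in>B. c b *\<^sub>R b)"
        using B span_finite[OF B(1)] by auto
      show "a u w = 0"
        unfolding c using linear_on_set_sum[OF lin1[OF wW] sW BW B(1), of c] 1 by simp
    qed
    then have "l w = 0" using linear_on_set_0[OF l] subspace_0[OF sW] by simp
    then show "(\<Sum>j\<in>B. l j * y j) = 0"
      unfolding w_def using linear_on_set_sum[OF l sW BW B(1), of y] by (simp add: mult.commute)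
  qed
  then obtain c where c: "\<forall>j\<in>B. (\<Sum>i\<in>B. c i * a i j) = l j" by blast
  define u where "u = (\<Sum>b\<in>B. c b *\<^sub>R b)"
  have uW: "u \<in> W" unfolding u_def by (rule comb)
  have 2: "a u j = l j" if "j \<in> B" for j
    unfolding u_def using that BW linear_on_set_sum[OF lin1 sW BW B(1), of j c] c by auto
  have "a u w = l w" if "w \<in> W" for w
  proof -
    obtain y where y: "w = (\<Sum>b\<in>B. y b *\<^sub>R b)"
      using \<open>w \<in> W\<close> B span_finite[OF B(1)] by auto
    show ?thesis
      unfolding y using linear_on_set_sum[OF lin2[OF uW] sW BW B(1), of y]
        linear_on_set_sum[OF l sW BW B(1), of y] 2 by simp
  qed
  with uW show ?thesis by blast
qed

text \<open>Existence rests on the kernel in the test argument, uniqueness on the one in the trial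
  argument. The coupled systems below are not symmetric, so the two are verified separately.\<close>

proposition form_solution_unique:
  assumes W: "finite_span W"
    and lin1: "\<And>w. w \<in> W \<Longrightarrow> linear_on_set W (\<lambda>u. a u w)"
    and lin2: "\<And>u. u \<in> W \<Longrightarrow> linear_on_set W (a u)"
    and l: "linear_on_set W l"
    and nondeg1: "\<And>u. u \<in> W \<Longrightarrow> (\<And>w. w \<in> W \<Longrightarrow> a u w = 0) \<Longrightarrow> u = 0"
    and nondeg2: "\<And>w. w \<in> W \<Longrightarrow> (\<And>u. u \<in> W \<Longrightarrow> a u w = 0) \<Longrightarrow> w = 0"
  shows "\<exists>!u. u \<in> W \<and> (\<forall>w\<in>W. a u w = l w)"
proof -
  have sW: "subspace W" by (rule finite_span_subspace[OF W])
  obtain u where u: "u \<in> W" "\<forall>w\<in>W. a u w = l w"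
    using form_solution_exists[OF W lin1 lin2 l nondeg2] by blast
  have "v = u" if v: "v \<in> W" "\<forall>w\<in>W. a v w = l w" for v
  proof -
    have "v - u = 0"
      using u v linear_on_set_diff[OF lin1 sW v(1) u(1)]
      by (intro nondeg1 subspace_diff[OF sW]) auto
    then show ?thesis by simp
  qed
  with u show ?thesis by blast
qed

corollary form_solution_unique_pos:
  assumes "finite_span W"
    and "\<And>w. w \<in> W \<Longrightarrow> linear_on_set W (\<lambda>u. a u w)"
    and "\<And>u. u \<in> W \<Longrightarrow> linear_on_set W (a u)"
    and "linear_on_set W l"
    and pos: "\<And>u. u \<in> W \<Longrightarrow> a u u = 0 \<Longrightarrow> u = 0"
  shows "\<exists>!u. u \<in> W \<and> (\<forall>w\<in>W. a u w = l w)"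
  using assms by (intro form_solution_unique) auto

section \<open>Square integrable functions\<close>

lemma set_integrable_iff_on:
  fixes f :: "'a::euclidean_space \<Rightarrow> 'b::euclidean_space"
  assumes "A \<in> sets lebesgue"
  shows "set_integrable lebesgue A f \<longleftrightarrow> integrable (lebesgue_on A) f"
  using assms by (simp add: set_integrable_def integrable_restrict_space)

lemma set_integral_eq_on:
  fixes f :: "'a::euclidean_space \<Rightarrow> 'b::euclidean_space"
  assumes "A \<in> sets lebesgue"
  shows "(LINT x:A|lebesgue. f x) = integral\<^sup>L (lebesgue_on A) f"
  using assms by (simp add: set_lebesgue_integral_def integral_restrict_space)

lemma AE_on_iff:
  assumes "A \<in> sets lebesgue"
  shows "(AE x\<in>A in lebesgue. P x) \<longleftrightarrow> (AE x in lebesgue_on A. P x)"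
  using assms by (simp add: AE_restrict_space_iff)

lemma l2in_eq: "A \<in> sets lebesgue \<Longrightarrow> l2in A f g = integral\<^sup>L (lebesgue_on A) (\<lambda>x. f x \<bullet> g x)"
  by (simp add: l2in_def set_integral_eq_on)

lemma L2_iff: "A \<in> sets lebesgue \<Longrightarrow>
  f \<in> L2 A \<longleftrightarrow> f \<in> borel_measurable (lebesgue_on A) \<and> integrable (lebesgue_on A) (\<lambda>x. (norm (f x))\<^sup>2)"
  by (simp add: L2_def set_integrable_iff_on power2_norm_eq_inner)

lemma L2_measurable: "f \<in> L2 A \<Longrightarrow> f \<in> borel_measurable (lebesgue_on A)"
  by (simp add: L2_def)

lemma L2_inner_integrable:
  assumes A: "A \<in> sets lebesgue" and "f \<in> L2 A" "g \<in> L2 A"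
  shows "integrable (lebesgue_on A) (\<lambda>x. f x \<bullet> g x)"
proof (rule Bochner_Integration.integrable_bound)
  show "integrable (lebesgue_on A) (\<lambda>x. (norm (f x))\<^sup>2 + (norm (g x))\<^sup>2)"
    using assms by (intro Bochner_Integration.integrable_add) (auto simp: L2_iff)
  show "(\<lambda>x. f x \<bullet> g x) \<in> borel_measurable (lebesgue_on A)"
    using assms by (intro borel_measurable_inner L2_measurable)
  have "norm (f x \<bullet> g x) \<le> norm ((norm (f x))\<^sup>2 + (norm (g x))\<^sup>2)" for x
  proof -
    have "\<bar>f x \<bullet> g x\<bar> \<le> norm (f x) * norm (g x)" by (rule Cauchy_Schwarz_ineq2)
    also have "\<dots> \<le> (norm (f x))\<^sup>2 + (norm (g x))\<^sup>2"
    proof -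
      have "0 \<le> (norm (f x) - norm (g x))\<^sup>2 + ((norm (f x))\<^sup>2 + (norm (g x))\<^sup>2)" by simp
      then show ?thesis by (simp add: power2_diff)
    qed
    finally show ?thesis by simp
  qed
  then show "AE x in lebesgue_on A. norm (f x \<bullet> g x) \<le> norm ((norm (f x))\<^sup>2 + (norm (g x))\<^sup>2)"
    by simp
qed

lemma L2_add:
  assumes A: "A \<in> sets lebesgue" and f: "f \<in> L2 A" and g: "g \<in> L2 A"
  shows "(\<lambda>x. f x + g x) \<in> L2 A"
proof -
  have "integrable (lebesgue_on A) (\<lambda>x. f x \<bullet> f x + 2 * (f x \<bullet> g x) + g x \<bullet> g x)"
    using assms by (intro Bochner_Integration.integrable_add integrable_mult_right L2_inner_integrable)
  then show ?thesis
    using f g A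
    by (auto simp: L2_def set_integrable_iff_on inner_add_left inner_add_right inner_commute algebra_simps)
qed

lemma L2_scaleR:
  assumes A: "A \<in> sets lebesgue" and f: "f \<in> L2 A"
  shows "(\<lambda>x. c *\<^sub>R f x) \<in> L2 A"
  using assms by (auto simp: L2_iff power_mult_distrib)

lemma L2_diff:
  assumes A: "A \<in> sets lebesgue" and f: "f \<in> L2 A" and g: "g \<in> L2 A"
  shows "(\<lambda>x. f x - g x) \<in> L2 A"
  using L2_add[OF A f L2_scaleR[OF A g, of "-1"]] by simp

lemma L2_0: "(\<lambda>x. 0) \<in> L2 A"
  by (simp add: L2_def set_integrable_def)

lemma L2_bounded_mult:
  fixes b :: "'a::euclidean_space \<Rightarrow> real"
  assumes A: "A \<in> sets lebesgue" and f: "f \<in> L2 A" and b: "b \<in> borel_measurable (lebesgue_on A)"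
    and bd: "AE x in lebesgue_on A. \<bar>b x\<bar> \<le> C"
  shows "(\<lambda>x. b x *\<^sub>R f x) \<in> L2 A"
proof -
  have "integrable (lebesgue_on A) (\<lambda>x. (norm (b x *\<^sub>R f x))\<^sup>2)"
  proof (rule Bochner_Integration.integrable_bound)
    show "integrable (lebesgue_on A) (\<lambda>x. C\<^sup>2 * (norm (f x))\<^sup>2)"
      using f A by (auto simp: L2_iff)
    show "(\<lambda>x. (norm (b x *\<^sub>R f x))\<^sup>2) \<in> borel_measurable (lebesgue_on A)"
      using L2_measurable[OF f] b by measurable
    show "AE x in lebesgue_on A. norm ((norm (b x *\<^sub>R f x))\<^sup>2) \<le> norm (C\<^sup>2 * (norm (f x))\<^sup>2)"
      using bd
    proof eventually_elim
      case (elim x)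
      then have "\<bar>b x\<bar>\<^sup>2 \<le> C\<^sup>2" by (intro power_mono) auto
      then show ?case by (simp add: power_mult_distrib mult_right_mono)
    qed
  qed
  then show ?thesis
    using L2_measurable[OF f] b by (auto simp: L2_iff[OF A])
qed

lemma L2_dominated:
  assumes A: "A \<in> sets lebesgue" and f: "f \<in> L2 A" and g: "g \<in> borel_measurable (lebesgue_on A)"
    and bd: "AE x in lebesgue_on A. norm (g x) \<le> C * norm (f x)"
  shows "g \<in> L2 A"
proof -
  have "integrable (lebesgue_on A) (\<lambda>x. (norm (g x))\<^sup>2)"
  proof (rule Bochner_Integration.integrable_bound)
    show "integrable (lebesgue_on A) (\<lambda>x. C\<^sup>2 * (norm (f x))\<^sup>2)"
      using f A by (auto simp: L2_iff)
    show "(\<lambda>x. (norm (g x))\<^sup>2) \<in> borel_measurable (lebesgue_on A)"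
      using g by measurable
    show "AE x in lebesgue_on A. norm ((norm (g x))\<^sup>2) \<le> norm (C\<^sup>2 * (norm (f x))\<^sup>2)"
      using bd
    proof eventually_elim
      case (elim x)
      then have "(norm (g x))\<^sup>2 \<le> (C * norm (f x))\<^sup>2" by (intro power_mono) auto
      then show ?case by (simp add: power_mult_distrib)
    qed
  qed
  then show ?thesis using g by (auto simp: L2_iff[OF A])
qed

lemma L2_cong_AE:
  assumes A: "A \<in> sets lebesgue" and f: "f \<in> L2 A" and g: "g \<in> borel_measurable (lebesgue_on A)"
    and "AE x in lebesgue_on A. g x = f x"
  shows "g \<in> L2 A"
  using assms(4) by (intro L2_dominated[OF A f g, of 1]) auto

lemma L2_integrable:
  assumes A: "A \<in> lmeasurable" and f: "f \<in> L2 A"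
  shows "integrable (lebesgue_on A) f"
proof (rule Bochner_Integration.integrable_bound)
  have A': "A \<in> sets lebesgue" using A by auto
  show "integrable (lebesgue_on A) (\<lambda>x. 1 + (norm (f x))\<^sup>2)"
    using f A' finite_measure.integrable_const[OF finite_measure_lebesgue_on[OF A]]
    by (intro Bochner_Integration.integrable_add) (auto simp: L2_iff)
  show "f \<in> borel_measurable (lebesgue_on A)" by (rule L2_measurable[OF f])
  have "norm (f x) \<le> norm (1 + (norm (f x))\<^sup>2)" for x
  proof -
    have "0 \<le> (norm (f x) - 1)\<^sup>2 + (1 + (norm (f x))\<^sup>2)" by simp
    then show ?thesis by (simp add: power2_diff)
  qed
  then show "AE x in lebesgue_on A. norm (f x) \<le> norm (1 + (norm (f x))\<^sup>2)" by simp
qed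

lemma l2in_commute: "l2in A f g = l2in A g f"
  by (simp add: l2in_def inner_commute)

lemma l2in_cong_AE:
  assumes A: "A \<in> sets lebesgue"
    and "integrable (lebesgue_on A) (\<lambda>x. f x \<bullet> g x)" "integrable (lebesgue_on A) (\<lambda>x. f' x \<bullet> g' x)"
    and "AE x in lebesgue_on A. f x \<bullet> g x = f' x \<bullet> g' x"
  shows "l2in A f g = l2in A f' g'"
  unfolding l2in_eq[OF A] using assms(2-) by (intro integral_cong_AE) auto

lemma l2in_add_left:
  assumes A: "A \<in> sets lebesgue"
    and "integrable (lebesgue_on A) (\<lambda>x. f x \<bullet> h x)" "integrable (lebesgue_on A) (\<lambda>x. g x \<bullet> h x)"
  shows "l2in A (\<lambda>x. f x + g x) h = l2in A f h + l2in A g h"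
  unfolding l2in_eq[OF A] using assms by (simp add: inner_add_left)

lemma l2in_diff_left:
  assumes A: "A \<in> sets lebesgue"
    and "integrable (lebesgue_on A) (\<lambda>x. f x \<bullet> h x)" "integrable (lebesgue_on A) (\<lambda>x. g x \<bullet> h x)"
  shows "l2in A (\<lambda>x. f x - g x) h = l2in A f h - l2in A g h"
  unfolding l2in_eq[OF A] using assms by (simp add: inner_diff_left)

lemma l2in_scale_left: "A \<in> sets lebesgue \<Longrightarrow> l2in A (\<lambda>x. c *\<^sub>R f x) h = c * l2in A f h"
  by (simp add: l2in_eq)

lemma l2in_add_right:
  assumes A: "A \<in> sets lebesgue"
    and "integrable (lebesgue_on A) (\<lambda>x. h x \<bullet> f x)" "integrable (lebesgue_on A) (\<lambda>x. h x \<bullet> g x)"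
  shows "l2in A h (\<lambda>x. f x + g x) = l2in A h f + l2in A h g"
  unfolding l2in_eq[OF A] using assms by (simp add: inner_add_right)

lemma l2in_scale_right: "A \<in> sets lebesgue \<Longrightarrow> l2in A h (\<lambda>x. c *\<^sub>R f x) = c * l2in A h f"
  by (simp add: l2in_eq)

lemma l2in_nonneg: "0 \<le> l2in A f f"
  unfolding l2in_def set_lebesgue_integral_def by (intro integral_nonneg_AE) (auto simp: indicator_def)

lemma l2norm_power2: "(l2norm A f)\<^sup>2 = l2in A f f"
  by (simp add: l2norm_def l2in_nonneg)

lemma l2in_eq_0_imp:
  assumes A: "A \<in> sets lebesgue" and f: "f \<in> L2 A" and "l2in A f f = 0"
  shows "AE x in lebesgue_on A. f x = 0"
proof -
  have "AE x in lebesgue_on A. f x \<bullet> f x = 0"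
    using assms(3) integral_nonneg_eq_0_iff_AE[OF L2_inner_integrable[OF A f f]]
    unfolding l2in_eq[OF A] by simp
  then show ?thesis by simp
qed

lemma linear_on_l2in_left:
  "A \<in> sets lebesgue \<Longrightarrow> g \<in> L2 A \<Longrightarrow> linear_on_set (L2 A) (\<lambda>f. l2in A f g)"
  by (intro linear_on_setI) (auto simp: fun_vec_defs l2in_add_left l2in_scale_left L2_inner_integrable)

lemma linear_on_l2in_right:
  "A \<in> sets lebesgue \<Longrightarrow> g \<in> L2 A \<Longrightarrow> linear_on_set (L2 A) (l2in A g)"
  using linear_on_l2in_left[of A g] by (simp add: l2in_commute[of A _ g])

lemma sum_fun_apply: "(\<Sum>b\<in>B. F b) x = (\<Sum>b\<in>B. F b x)"
  by (induction B rule: infinite_finite_induct) (auto simp: fun_vec_defs)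

lemma fin_dim_space_finite_span: "fin_dim_space A M \<Longrightarrow> finite_span M"
proof -
  assume "fin_dim_space A M"
  then obtain B where B: "finite B" "M = range (\<lambda>c x. \<Sum>b\<in>B. c b *\<^sub>R b x)"
    unfolding fin_dim_space_def by blast
  have "(\<lambda>x. \<Sum>b\<in>B. c b *\<^sub>R b x) = (\<Sum>b\<in>B. c b *\<^sub>R b)" for c
    by (rule ext) (simp add: sum_fun_apply scaleR_fun_def)
  then have "M = span B" using B(2) by (simp add: span_finite[OF B(1)])
  with B(1) show ?thesis unfolding finite_span_def by blast
qed

lemma fin_dim_space_L2: "fin_dim_space A M \<Longrightarrow> M \<subseteq> L2 A"
  by (simp add: fin_dim_space_def)

lemma fin_dim_space_eq_0:
  "A \<in> sets lebesgue \<Longrightarrow> fin_dim_space A M \<Longrightarrow> f \<in> M \<Longrightarrow> AE x in lebesgue_on A. f x = 0 \<Longrightarrow> f = 0"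
  by (auto simp: fin_dim_space_def AE_on_iff zero_fun_def)

lemma fin_dim_space_l2in_eq_0:
  "A \<in> sets lebesgue \<Longrightarrow> fin_dim_space A M \<Longrightarrow> f \<in> M \<Longrightarrow> l2in A f f = 0 \<Longrightarrow> f = 0"
  by (rule fin_dim_space_eq_0[OF _ _ _ l2in_eq_0_imp]) (auto dest: fin_dim_space_L2)

lemma zero_mean_subspace:
  assumes A: "A \<in> lmeasurable" and M: "subspace M" "M \<subseteq> L2 A"
  shows "subspace (zero_mean A M)"
proof -
  have A': "A \<in> sets lebesgue" using A by auto
  have "integrable (lebesgue_on A) f" if "f \<in> M" for f
    using that L2_integrable[OF A] M(2) by blast
  then show ?thesis
    unfolding subspace_def zero_mean_def set_integral_eq_on[OF A']
    using subspace_0[OF M(1)] subspace_add[OF M(1)] subspace_scale[OF M(1)]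
    by (auto simp: fun_vec_defs)
qed

lemma zero_mean_finite_span:
  assumes "A \<in> lmeasurable" "fin_dim_space A M"
  shows "finite_span (zero_mean A M)"
proof (rule finite_span_subset)
  show "finite_span M" by (rule fin_dim_space_finite_span[OF assms(2)])
  show "subspace (zero_mean A M)"
    by (rule zero_mean_subspace[OF assms(1) finite_span_subspace[OF \<open>finite_span M\<close>]
          fin_dim_space_L2[OF assms(2)]])
  show "zero_mean A M \<subseteq> M" by (auto simp: zero_mean_def)
qed

text \<open>Translations, product measures and compositions are handled with Borel functions on
  \<open>lborel\<close>, while members of \<open>L2\<close> are only Lebesgue measurable. The scalar
  modification result is applied to each coordinate, and finitely many null sets are merged.\<close>

lemma lebesgue_borel_version:
  fixes f :: "'a::euclidean_space \<Rightarrow> 'b::euclidean_space"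
  assumes "f \<in> borel_measurable lebesgue"
  shows "\<exists>f'\<in>borel_measurable borel. AE x in lebesgue. f x = f' x"
proof -
  have "\<forall>b. \<exists>g\<in>borel_measurable lborel. AE x in lborel. f x \<bullet> b = g x"
  proof
    fix b
    have "(\<lambda>x. f x \<bullet> b) \<in> borel_measurable lebesgue"
      using assms by (intro borel_measurable_inner borel_measurable_const)
    then show "\<exists>g\<in>borel_measurable lborel. AE x in lborel. f x \<bullet> b = g x"
      by (rule completion_ex_borel_measurable_real)
  qed
  then obtain g where g: "\<And>b. g b \<in> borel_measurable lborel" "\<And>b. AE x in lborel. f x \<bullet> b = g b x"
    by metis
  have "AE x in lborel. \<forall>b\<in>Basis. f x \<bullet> b = g b x"
    using g(2) by (intro AE_finite_allI) auto
  then have "AE x in lborel. f x = (\<Sum>b\<in>Basis. g b x *\<^sub>R b)"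
    by eventually_elim (metis (mono_tags, lifting) euclidean_representation sum.cong)
  then have "AE x in lebesgue. f x = (\<Sum>b\<in>Basis. g b x *\<^sub>R b)"
    by (rule AE_completion)
  moreover have "(\<lambda>x. \<Sum>b\<in>Basis. g b x *\<^sub>R b) \<in> borel_measurable borel"
    using g(1) by (intro borel_measurable_sum borel_measurable_scaleR) auto
  ultimately show ?thesis by (rule bexI)
qed

section \<open>Weak gradients\<close>

lemma C1_compact_continuous: "C1_compact \<psi> d\<psi> \<Longrightarrow> continuous_on UNIV \<psi>"
  unfolding C1_compact_def gderiv_def
  by (meson continuous_at_imp_continuous_on has_derivative_continuous)

lemma C1_compact_gradient_support:
  assumes "C1_compact \<psi> d\<psi>" "x \<notin> closure {x. \<psi> x \<noteq> 0}"
  shows "d\<psi> x = 0"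
proof -
  have "(\<psi> has_derivative (\<lambda>h. h \<bullet> d\<psi> x)) (at x)"
    using assms(1) by (simp add: C1_compact_def gderiv_def)
  moreover have "(\<psi> has_derivative (\<lambda>h. 0)) (at x)"
  proof (rule has_derivative_transform_within_open)
    show "((\<lambda>x. 0) has_derivative (\<lambda>h. 0)) (at x)" by simp
    show "open (- closure {x. \<psi> x \<noteq> 0})" by (intro open_Compl closed_closure)
    show "x \<in> - closure {x. \<psi> x \<noteq> 0}" using assms(2) by simp
    fix y assume "y \<in> - closure {x. \<psi> x \<noteq> 0}"
    then show "0 = \<psi> y" using closure_subset[of "{x. \<psi> x \<noteq> 0}"] by auto
  qed
  ultimately have "(\<lambda>h. h \<bullet> d\<psi> x) = (\<lambda>h. 0)" by (rule has_derivative_unique)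
  then have "d\<psi> x \<bullet> d\<psi> x = 0" by (rule fun_cong)
  then show ?thesis by simp
qed

lemma bounded_range_if_compact_support:
  fixes f :: "'a::topological_space \<Rightarrow> 'b::real_normed_vector"
  assumes "continuous_on UNIV f" "compact K" "\<And>x. x \<notin> K \<Longrightarrow> f x = 0"
  shows "\<exists>C. \<forall>x. norm (f x) \<le> C"
proof -
  have "compact (f ` K)"
    using assms(1,2) continuous_on_subset by (intro compact_continuous_image) auto
  then obtain C where C: "\<forall>y\<in>f ` K. norm y \<le> C"
    using compact_imp_bounded bounded_iff by metis
  have "norm (f x) \<le> max C 0" for x
    using C assms(3)[of x] by (cases "x \<in> K") auto
  then show ?thesis by (intro exI allI)
qed

lemma C1_compact_bounded:
  assumes "C1_compact \<psi> d\<psi>"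
  shows "\<exists>C. \<forall>x. \<bar>\<psi> x\<bar> \<le> C" "\<exists>C. \<forall>x. norm (d\<psi> x) \<le> C"
proof -
  have *: "\<psi> x = 0" if "x \<notin> closure {x. \<psi> x \<noteq> 0}" for x
    using that closure_subset[of "{x. \<psi> x \<noteq> 0}"] by auto
  have compact: "compact (closure {x. \<psi> x \<noteq> 0})"
    and cont: "continuous_on UNIV d\<psi>"
    using assms by (simp_all only: C1_compact_def)
  show "\<exists>C. \<forall>x. \<bar>\<psi> x\<bar> \<le> C"
    using bounded_range_if_compact_support[OF C1_compact_continuous[OF assms] compact * ]
    by simp
  show "\<exists>C. \<forall>x. norm (d\<psi> x) \<le> C"
    by (rule bounded_range_if_compact_support[OF cont compact C1_compact_gradient_support[OF assms]])
qed

lemma C1_compact_compose: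
  assumes "C1_compact \<psi> d\<psi>" and g: "\<And>t. DERIV g t :> g' t" "continuous_on UNIV g'" and "g 0 = 0"
  shows "C1_compact (\<lambda>x. g (\<psi> x)) (\<lambda>x. g' (\<psi> x) *\<^sub>R d\<psi> x)"
proof -
  have "closure {x. g (\<psi> x) \<noteq> 0} \<subseteq> closure {x. \<psi> x \<noteq> 0}"
    using assms(4) by (intro closure_mono) auto
  moreover have "compact (closure {x. \<psi> x \<noteq> 0})" using assms(1) by (simp add: C1_compact_def)
  ultimately have "compact (closure {x. g (\<psi> x) \<noteq> 0})"
    by (meson closed_closure compact_eq_bounded_closed bounded_subset)
  moreover have "GDERIV (\<lambda>x. g (\<psi> x)) x :> g' (\<psi> x) *\<^sub>R d\<psi> x" for x
    using assms(1) by (intro GDERIV_DERIV_compose g(1)) (simp add: C1_compact_def)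
  moreover have "continuous_on UNIV (\<lambda>x. g' (\<psi> x) *\<^sub>R d\<psi> x)"
    using assms(1) continuous_on_compose2[OF g(2) C1_compact_continuous[OF assms(1)]]
    by (intro continuous_on_scaleR) (auto simp: C1_compact_def)
  ultimately show ?thesis by (simp only: C1_compact_def simp_thms)
qed

lemma C1_compact_mult:
  assumes "C1_compact \<psi> d\<psi>" "C1_compact \<phi> d\<phi>"
  shows "C1_compact (\<lambda>x. \<psi> x * \<phi> x) (\<lambda>x. \<psi> x *\<^sub>R d\<phi> x + \<phi> x *\<^sub>R d\<psi> x)"
proof -
  have "closure {x. \<psi> x * \<phi> x \<noteq> 0} \<subseteq> closure {x. \<psi> x \<noteq> 0}"
    by (intro closure_mono) auto
  moreover have "compact (closure {x. \<psi> x \<noteq> 0})" using assms(1) by (simp add: C1_compact_def)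
  ultimately have "compact (closure {x. \<psi> x * \<phi> x \<noteq> 0})"
    by (meson closed_closure compact_eq_bounded_closed bounded_subset)
  then show ?thesis
    using assms C1_compact_continuous[OF assms(1)] C1_compact_continuous[OF assms(2)]
    by (auto simp: C1_compact_def intro!: GDERIV_mult continuous_intros)
qed

lemma C1_compact_add:
  assumes "C1_compact \<psi> d\<psi>" "C1_compact \<phi> d\<phi>"
  shows "C1_compact (\<lambda>x. \<psi> x + \<phi> x) (\<lambda>x. d\<psi> x + d\<phi> x)"
proof -
  have "closure {x. \<psi> x + \<phi> x \<noteq> 0} \<subseteq> closure {x. \<psi> x \<noteq> 0} \<union> closure {x. \<phi> x \<noteq> 0}"
    unfolding closure_Un[symmetric] by (intro closure_mono) auto
  moreover have "compact (closure {x. \<psi> x \<noteq> 0} \<union> closure {x. \<phi> x \<noteq> 0})"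
    using assms by (simp add: C1_compact_def compact_Un)
  ultimately have "compact (closure {x. \<psi> x + \<phi> x \<noteq> 0})"
    by (meson closed_closure compact_eq_bounded_closed bounded_subset)
  then show ?thesis
    using assms by (auto simp: C1_compact_def intro!: GDERIV_add continuous_intros)
qed

section \<open>Bump functions and the fundamental lemma of the calculus of variations\<close>

lemma DERIV_max0_sq: "DERIV (\<lambda>t::real. (max 0 t)\<^sup>2) t :> 2 * max 0 t"
proof -
  consider "t > 0" | "t < 0" | "t = 0" by linarith
  then show ?thesis
  proof cases
    case 1
    have "DERIV (\<lambda>t::real. t\<^sup>2) t :> 2 * max 0 t"
      using 1 by (auto intro!: derivative_eq_intros)
    then show ?thesis
      by (rule has_field_derivative_transform_within_open[of _ _ _ "{0<..}"]) (use 1 in auto)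
  next
    case 2
    have "DERIV (\<lambda>t::real. 0) t :> 2 * max 0 t"
      using 2 by auto
    then show ?thesis
      by (rule has_field_derivative_transform_within_open[of _ _ _ "{..<0}"]) (use 2 in auto)
  next
    case 3
    have "((\<lambda>h::real. (max 0 h)\<^sup>2 / h) \<longlongrightarrow> 0) (at 0)"
    proof (rule Lim_null_comparison)
      show "\<forall>\<^sub>F h::real in at 0. norm ((max 0 h)\<^sup>2 / h) \<le> \<bar>h\<bar>"
        by (intro always_eventually) (auto simp: max_def power2_eq_square)
      show "((\<lambda>h::real. \<bar>h\<bar>) \<longlongrightarrow> 0) (at 0)"
        by (auto intro!: tendsto_eq_intros)
    qed
    then show ?thesis using 3 by (simp add: DERIV_def)
  qed
qed

text \<open>The bump is the squared positive part of \<open>r\<^sup>2 - |x - c|\<^sup>2\<close>,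
  divided by its largest value \<open>(r\<^sup>2)\<^sup>2\<close>. Squaring the positive part makes
  it continuously differentiable across the sphere.\<close>

lemma bump_on_ball:
  fixes c :: "real ^ 'd::finite"
  assumes "0 < r"
  shows "\<exists>\<psi> d\<psi>. C1_compact \<psi> d\<psi> \<and> (\<forall>x. 0 \<le> \<psi> x \<and> \<psi> x \<le> 1) \<and> {x. \<psi> x \<noteq> 0} = ball c r"
proof -
  define g where "g t = (max 0 t)\<^sup>2 / (r\<^sup>2)\<^sup>2" for t :: real
  define g' where "g' t = 2 * max 0 t / (r\<^sup>2)\<^sup>2" for t :: real
  define h where "h x = r\<^sup>2 - (x - c) \<bullet> (x - c)" for x
  have dg: "DERIV g t :> g' t" for t
    unfolding g_def g'_def by (intro DERIV_cdivide DERIV_max0_sq)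
  have dh: "GDERIV h x :> - 2 *\<^sub>R (x - c)" for x
    unfolding h_def gderiv_def
    by (auto intro!: derivative_eq_intros simp: inner_commute algebra_simps)
  have hpos: "0 < h x \<longleftrightarrow> x \<in> ball c r" for x
  proof -
    have "0 < h x \<longleftrightarrow> (norm (x - c))\<^sup>2 < r\<^sup>2" by (simp add: h_def power2_norm_eq_inner)
    also have "\<dots> \<longleftrightarrow> norm (x - c) < r"
      using assms by (auto intro: power2_less_imp_less power_strict_mono)
    finally show ?thesis by (simp add: dist_norm norm_minus_commute)
  qed
  have supp: "{x. g (h x) \<noteq> 0} = ball c r"
    using assms hpos by (auto simp: g_def max_def split: if_splits) (smt (verit))+
  have "C1_compact (\<lambda>x. g (h x)) (\<lambda>x. g' (h x) *\<^sub>R (- 2 *\<^sub>R (x - c)))"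
    unfolding C1_compact_def supp
  proof (intro conjI allI)
    show "GDERIV (\<lambda>x. g (h x)) x :> g' (h x) *\<^sub>R (- 2 *\<^sub>R (x - c))" for x
      by (rule GDERIV_DERIV_compose[OF dh dg])
    show "continuous_on UNIV (\<lambda>x. g' (h x) *\<^sub>R (- 2 *\<^sub>R (x - c)))"
      unfolding g'_def h_def using assms by (intro continuous_intros) auto
    show "compact (closure (ball c r))" using assms by simp
  qed
  moreover have "0 \<le> g (h x) \<and> g (h x) \<le> 1" for x
  proof -
    have "max 0 (h x) \<le> r\<^sup>2" by (simp add: h_def)
    then have "(max 0 (h x))\<^sup>2 \<le> (r\<^sup>2)\<^sup>2" by (intro power_mono) auto
    then show ?thesis using assms by (simp add: g_def)
  qed
  ultimately show ?thesis using supp by blast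
qed

text \<open>The indicator of such a set is a limit of test functions built from its bump, and the
  class is stable under finite unions; so these sets exhaust every open subset of
  \<open>A\<close>.\<close>

definition bump_set :: "(real ^ 'd::finite) set \<Rightarrow> (real ^ 'd) set \<Rightarrow> bool"
  where "bump_set A U \<longleftrightarrow> closure U \<subseteq> A \<and>
    (\<exists>\<psi> d\<psi>. C1_compact \<psi> d\<psi> \<and> (\<forall>x. 0 \<le> \<psi> x \<and> \<psi> x \<le> 1) \<and> {x. \<psi> x \<noteq> 0} = U)"

lemma bump_set_Un:
  assumes "bump_set A U" "bump_set A V"
  shows "bump_set A (U \<union> V)"
proof -
  obtain \<psi> d\<psi> \<phi> d\<phi> where *: "C1_compact \<psi> d\<psi>" "\<And>x. 0 \<le> \<psi> x \<and> \<psi> x \<le> 1" "{x. \<psi> x \<noteq> 0} = U"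
    "C1_compact \<phi> d\<phi>" "\<And>x. 0 \<le> \<phi> x \<and> \<phi> x \<le> 1" "{x. \<phi> x \<noteq> 0} = V"
    using assms unfolding bump_set_def by blast
  \<comment> \<open>This is \<open>1 - (1 - \<psi> x) * (1 - \<phi> x)\<close> expanded: each
    summand has compact support, which \<open>1 - \<psi>\<close> has not. The product form shows
    that the values stay between 0 and 1.\<close>
  define S where "S x = \<psi> x + (\<phi> x + (-1) * (\<psi> x * \<phi> x))" for x
  define dS where "dS x = d\<psi> x + (d\<phi> x + (-1) *\<^sub>R (\<psi> x *\<^sub>R d\<phi> x + \<phi> x *\<^sub>R d\<psi> x))" for x
  have "C1_compact (\<lambda>x. (-1) * (\<psi> x * \<phi> x)) (\<lambda>x. (-1) *\<^sub>R (\<psi> x *\<^sub>R d\<phi> x + \<phi> x *\<^sub>R d\<psi> x))"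
    by (rule C1_compact_compose[OF C1_compact_mult[OF *(1,4)], of "\<lambda>t. (-1) * t" "\<lambda>_. -1"])
      (auto intro!: derivative_eq_intros)
  then have "C1_compact S dS"
    unfolding S_def dS_def by (intro C1_compact_add * )
  moreover have S: "S x = 1 - (1 - \<psi> x) * (1 - \<phi> x)" for x
    by (simp add: S_def algebra_simps)
  moreover have "0 \<le> S x \<and> S x \<le> 1" for x
    using *(2)[of x] *(5)[of x] mult_le_one[of "1 - \<psi> x" "1 - \<phi> x"] by (simp add: S)
  moreover have "{x. S x \<noteq> 0} = U \<union> V"
  proof -
    have "S x = 0 \<longleftrightarrow> \<psi> x = 0 \<and> \<phi> x = 0" for x
    proof
      assume "S x = 0"
      have "(1 - \<psi> x) * (1 - \<phi> x) \<le> 1 - \<psi> x" "(1 - \<psi> x) * (1 - \<phi> x) \<le> 1 - \<phi> x"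
        using *(2)[of x] *(5)[of x] by (simp_all add: mult_left_le mult_left_le_one_le)
      with \<open>S x = 0\<close> show "\<psi> x = 0 \<and> \<phi> x = 0"
        using *(2)[of x] *(5)[of x] by (simp add: S)
    qed (simp add: S)
    then show ?thesis using *(3,6) by auto
  qed
  ultimately show ?thesis
    using assms unfolding bump_set_def closure_Un by blast
qed

text \<open>The functions \<open>1 - (1 - \<psi>)\<^sup>k\<close> increase to the indicator function of the support of \<open>\<psi>\<close>.\<close>

lemma bump_set_integral_0:
  fixes F :: "real ^ 'd::finite \<Rightarrow> 'b::euclidean_space"
  assumes F: "integrable lebesgue F" and U: "bump_set A U"
    and test: "\<And>\<psi> d\<psi>. C1_compact \<psi> d\<psi> \<Longrightarrow> closure {x. \<psi> x \<noteq> 0} \<subseteq> A \<Longrightarrow>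
      integral\<^sup>L lebesgue (\<lambda>x. \<psi> x *\<^sub>R F x) = 0"
  shows "integral\<^sup>L lebesgue (\<lambda>x. indicator U x *\<^sub>R F x) = 0"
proof -
  obtain \<psi> d\<psi> where \<psi>: "C1_compact \<psi> d\<psi>" "\<And>x. 0 \<le> \<psi> x \<and> \<psi> x \<le> 1" "{x. \<psi> x \<noteq> 0} = U" "closure U \<subseteq> A"
    using U unfolding bump_set_def by blast
  have mF: "F \<in> borel_measurable lebesgue" using F by auto
  have m\<psi>: "\<psi> \<in> borel_measurable lebesgue"
    using borel_measurable_continuous_onI[OF C1_compact_continuous[OF \<psi>(1)]]
    by (intro measurable_completion) simp
  define S where "S k x = 1 - (1 - \<psi> x) ^ Suc k" for k x
  have C1: "C1_compact (S k) (\<lambda>x. (real (Suc k) * (1 - \<psi> x) ^ k) *\<^sub>R d\<psi> x)" for k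
    unfolding S_def
    by (rule C1_compact_compose[OF \<psi>(1), of "\<lambda>t. 1 - (1 - t) ^ Suc k" "\<lambda>t. real (Suc k) * (1 - t) ^ k"])
      (auto intro!: derivative_eq_intros continuous_intros simp del: power_Suc)
  have Sb: "0 \<le> S k x" "S k x \<le> 1" for k x
    using \<psi>(2)[of x] power_le_one[of "1 - \<psi> x" "Suc k"] zero_le_power[of "1 - \<psi> x" "Suc k"]
    unfolding S_def by linarith+
  have "{x. S k x \<noteq> 0} \<subseteq> U" for k
    using \<psi>(3) by (auto simp: S_def)
  then have "closure {x. S k x \<noteq> 0} \<subseteq> A" for k
    using closure_mono \<psi>(4) by blast
  then have zero: "integral\<^sup>L lebesgue (\<lambda>x. S k x *\<^sub>R F x) = 0" for k
    using test C1 by blast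
  have lim: "(\<lambda>k. S k x) \<longlonglongrightarrow> indicator U x" for x
  proof (cases "x \<in> U")
    case True
    then have "\<psi> x \<noteq> 0" using \<psi>(3) by blast
    then have "(\<lambda>k. (1 - \<psi> x) ^ Suc k) \<longlonglongrightarrow> 0"
      using \<psi>(2)[of x] by (intro LIMSEQ_Suc LIMSEQ_power_zero) auto
    then have "(\<lambda>k. S k x) \<longlonglongrightarrow> 1 - 0"
      unfolding S_def by (intro tendsto_diff tendsto_const)
    then show ?thesis using True by simp
  next
    case False
    then have "\<psi> x = 0" using \<psi>(3) by blast
    then show ?thesis using False by (simp add: S_def)
  qed
  have "(\<lambda>k. integral\<^sup>L lebesgue (\<lambda>x. S k x *\<^sub>R F x))
    \<longlonglongrightarrow> integral\<^sup>L lebesgue (\<lambda>x. indicator U x *\<^sub>R F x)"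
  proof (rule integral_dominated_convergence[where w="\<lambda>x. norm (F x)"])
    have "{x \<in> space lebesgue. \<psi> x \<noteq> 0} \<in> sets lebesgue"
      using m\<psi> by measurable
    then have "U \<in> sets lebesgue" using \<psi>(3) by simp
    then show "(\<lambda>x. indicat_real U x *\<^sub>R F x) \<in> borel_measurable lebesgue"
      using mF by (intro borel_measurable_scaleR borel_measurable_indicator)
    show "(\<lambda>x. S k x *\<^sub>R F x) \<in> borel_measurable lebesgue" for k
      unfolding S_def using mF m\<psi> by measurable
    show "integrable lebesgue (\<lambda>x. norm (F x))" using F by auto
    show "AE x in lebesgue. (\<lambda>k. S k x *\<^sub>R F x) \<longlonglongrightarrow> indicat_real U x *\<^sub>R F x"
      using lim by (intro AE_I2 tendsto_scaleR tendsto_const)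
    show "AE x in lebesgue. norm (S k x *\<^sub>R F x) \<le> norm (F x)" for k
      using Sb[of k] by (intro AE_I2) (simp add: mult_left_le_one_le)
  qed
  then show ?thesis using zero by (simp add: LIMSEQ_const_iff)
qed

text \<open>By the Lindelof property \<open>V\<close> is a countable union of balls whose closed
  balls lie in \<open>V\<close>; closedness puts the supports inside \<open>A\<close>. Finite
  partial unions are bump sets, and dominated convergence with bound \<open>norm (F x)\<close>
  passes to \<open>V\<close>.\<close>

lemma open_set_integral_0:
  fixes F :: "real ^ 'd::finite \<Rightarrow> 'b::euclidean_space"
  assumes F: "integrable lebesgue F" and V: "open V" "V \<subseteq> A"
    and test: "\<And>\<psi> d\<psi>. C1_compact \<psi> d\<psi> \<Longrightarrow> closure {x. \<psi> x \<noteq> 0} \<subseteq> A \<Longrightarrow>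
      integral\<^sup>L lebesgue (\<lambda>x. \<psi> x *\<^sub>R F x) = 0"
  shows "integral\<^sup>L lebesgue (\<lambda>x. indicator V x *\<^sub>R F x) = 0"
proof (cases "V = {}")
  case False
  define \<F> where "\<F> = {ball x r |x r. 0 < r \<and> cball x r \<subseteq> V}"
  have "\<Union>\<F> = V"
  proof
    show "\<Union>\<F> \<subseteq> V" using ball_subset_cball by (fastforce simp: \<F>_def)
    show "V \<subseteq> \<Union>\<F>"
    proof
      fix x assume "x \<in> V"
      then obtain r where "0 < r" "cball x r \<subseteq> V" using V(1) open_contains_cball by blast
      then show "x \<in> \<Union>\<F>" by (auto simp: \<F>_def intro!: exI[of _ "ball x r"])
    qed
  qed
  moreover obtain \<G> where \<G>: "\<G> \<subseteq> \<F>" "countable \<G>" "\<Union>\<G> = \<Union>\<F>"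
    using Lindelof[of \<F>] unfolding \<F>_def by blast
  ultimately have UG: "\<Union>\<G> = V" by simp
  then have "\<G> \<noteq> {}" using False by auto
  define B where "B = from_nat_into \<G>"
  have BG: "B i \<in> \<G>" for i
    unfolding B_def by (rule from_nat_into[OF \<open>\<G> \<noteq> {}\<close>])
  have rB: "range B = \<G>"
    unfolding B_def by (rule range_from_nat_into[OF \<open>\<G> \<noteq> {}\<close> \<G>(2)])
  have bumpB: "bump_set A (B i)" for i
  proof -
    obtain x r where "B i = ball x r" "0 < r" "cball x r \<subseteq> V"
      using BG[of i] \<G>(1) unfolding \<F>_def by blast
    then show ?thesis
      using bump_on_ball[of r x] V(2) unfolding bump_set_def by (auto simp: closure_ball)
  qed
  define W where "W n = (\<Union>i\<le>n. B i)" for n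
  have bumpW: "bump_set A (W n)" for n
  proof (induction n)
    case 0
    then show ?case using bumpB[of 0] by (simp add: W_def)
  next
    case (Suc n)
    have "W (Suc n) = W n \<union> B (Suc n)" by (auto simp: W_def atMost_Suc)
    then show ?case using Suc bumpB bump_set_Un by metis
  qed
  have openB: "open (B i)" for i
    using BG[of i] \<G>(1) unfolding \<F>_def by auto
  have "(\<lambda>n. integral\<^sup>L lebesgue (\<lambda>x. indicator (W n) x *\<^sub>R F x))
    \<longlonglongrightarrow> integral\<^sup>L lebesgue (\<lambda>x. indicator V x *\<^sub>R F x)"
  proof (rule integral_dominated_convergence[where w="\<lambda>x. norm (F x)"])
    show "(\<lambda>x. indicat_real V x *\<^sub>R F x) \<in> borel_measurable lebesgue"
      using F V(1) by (intro borel_measurable_scaleR borel_measurable_indicator) auto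
    have "open (W n)" for n unfolding W_def using openB by auto
    then show "(\<lambda>x. indicat_real (W n) x *\<^sub>R F x) \<in> borel_measurable lebesgue" for n
      using F by (intro borel_measurable_scaleR borel_measurable_indicator) auto
    show "integrable lebesgue (\<lambda>x. norm (F x))" using F by auto
    have "(\<lambda>n. indicat_real (W n) x) \<longlonglongrightarrow> indicat_real V x" for x
    proof (cases "x \<in> V")
      case True
      then obtain i where "x \<in> B i" using UG rB by blast
      then have "\<forall>n\<ge>i. x \<in> W n" by (auto simp: W_def)
      then have "\<forall>\<^sub>F n in sequentially. indicat_real (W n) x = 1"
        unfolding eventually_sequentially by (intro exI[of _ i]) auto
      then show ?thesis using True by (simp add: tendsto_eventually)
    next
      case False
      then have "x \<notin> W n" for n using UG BG by (auto simp: W_def)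
      then show ?thesis using False by simp
    qed
    then show "AE x in lebesgue. (\<lambda>n. indicat_real (W n) x *\<^sub>R F x) \<longlonglongrightarrow> indicat_real V x *\<^sub>R F x"
      by (intro AE_I2 tendsto_scaleR tendsto_const)
    show "AE x in lebesgue. norm (indicat_real (W n) x *\<^sub>R F x) \<le> norm (F x)" for n
      by (intro AE_I2) (simp add: indicator_def)
  qed
  then show ?thesis using bump_set_integral_0[OF F bumpW test] by (simp add: LIMSEQ_const_iff)
qed simp

text \<open>Extending \<open>f\<close> by zero gives \<open>F\<close>, whose integral over every
  open set vanishes. Open sets are stable under intersection and generate the Borel sets, so the
  integral over every Borel set vanishes, and a density with this property is zero almost
  everywhere.\<close>

theorem fundamental_lemma:
  fixes f :: "real ^ 'd::finite \<Rightarrow> 'b::euclidean_space"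
  assumes A: "open A" and f: "integrable (lebesgue_on A) f"
    and test: "\<And>\<psi> d\<psi>. C1_compact \<psi> d\<psi> \<Longrightarrow> closure {x. \<psi> x \<noteq> 0} \<subseteq> A \<Longrightarrow>
      integral\<^sup>L (lebesgue_on A) (\<lambda>x. \<psi> x *\<^sub>R f x) = 0"
  shows "AE x in lebesgue_on A. f x = 0"
proof -
  have A': "A \<in> sets lebesgue" using A by auto
  define F where "F x = indicator A x *\<^sub>R f x" for x
  have F: "integrable lebesgue F"
    unfolding F_def using f A' by (simp add: integrable_restrict_space)
  have testF: "integral\<^sup>L lebesgue (\<lambda>x. \<psi> x *\<^sub>R F x) = 0"
    if "C1_compact \<psi> d\<psi>" "closure {x. \<psi> x \<noteq> 0} \<subseteq> A" for \<psi> d\<psi>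
    using test[OF that] A' unfolding F_def by (simp add: integral_restrict_space mult.commute)
  have "F \<in> borel_measurable lebesgue" using F by auto
  \<comment> \<open>The generator argument runs in \<open>lborel\<close>, hence the passage to a
    Borel version of \<open>F\<close>.\<close>
  then obtain F' where F': "F' \<in> borel_measurable borel" "AE x in lebesgue. F x = F' x"
    using lebesgue_borel_version by metis
  have intF': "integrable lebesgue F'"
    using F _ F'(2)
  proof (rule integrable_cong_AE_imp)
    show "F' \<in> borel_measurable lebesgue"
      using F'(1) by (intro measurable_completion) simp
  qed
  then have intF'': "integrable lborel F'"
    using F' by (simp add: integrable_completion)
  have "AE x in lborel. F' x = 0"
  proof (rule sigma_finite_measure.density_zero[OF _ intF''])
    show "sigma_finite_measure lborel" by (rule sigma_finite_lborel)
    fix X :: "(real ^ 'd) set" assume "X \<in> sets lborel"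
    then have X: "X \<in> sigma_sets UNIV {S. open S}" by (simp add: sets_borel)
    have sub: "sigma_sets UNIV {S. open S} \<subseteq> sets (lborel :: (real ^ 'd) measure)"
      by (simp add: sets_borel)
    have eq: "(LINT x:X|lborel. F' x) = integral\<^sup>L lebesgue (\<lambda>x. indicator X x *\<^sub>R F x)"
      if "X \<in> sets lborel" for X :: "(real ^ 'd) set"
    proof -
      have "integral\<^sup>L lebesgue (\<lambda>x. indicator X x *\<^sub>R F x) = integral\<^sup>L lebesgue (\<lambda>x. indicat_real X x *\<^sub>R F' x)"
      proof (rule integral_cong_AE)
        show "(\<lambda>x. indicat_real X x *\<^sub>R F x) \<in> borel_measurable lebesgue"
          using that F by (intro borel_measurable_scaleR borel_measurable_indicator) auto
        show "(\<lambda>x. indicat_real X x *\<^sub>R F' x) \<in> borel_measurable lebesgue"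
          using that intF' by (intro borel_measurable_scaleR borel_measurable_indicator) auto
        show "AE x in lebesgue. indicat_real X x *\<^sub>R F x = indicat_real X x *\<^sub>R F' x"
          using F'(2) by eventually_elim simp
      qed
      also have "\<dots> = (LINT x:X|lborel. F' x)"
        unfolding set_lebesgue_integral_def using that F'
        by (intro integral_completion borel_measurable_scaleR borel_measurable_indicator) auto
      finally show ?thesis by simp
    qed
    have "Int_stable {S :: (real ^ 'd) set. open S}" by (auto simp: Int_stable_def)
    moreover have "{S :: (real ^ 'd) set. open S} \<subseteq> Pow UNIV" by auto
    ultimately show "(LINT x:X|lborel. F' x) = 0" using X
    proof (induction rule: sigma_sets_induct_disjoint)
      case (basic S)
      \<comment> \<open>\<open>S\<close> may stick out of \<open>A\<close>, but \<open>F\<close>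
        vanishes there, so \<open>S \<inter> A\<close> is the set to test.\<close>
      have "(\<lambda>x. indicator S x *\<^sub>R F x) = (\<lambda>x. indicator (S \<inter> A) x *\<^sub>R F x)"
        by (rule ext) (auto simp: F_def indicator_def)
      moreover have "integral\<^sup>L lebesgue (\<lambda>x. indicator (S \<inter> A) x *\<^sub>R F x) = 0"
        using basic A by (intro open_set_integral_0[OF F _ _ testF]) auto
      ultimately show ?case using basic by (subst eq) (simp_all only: sets_lborel borel_open mem_Collect_eq)
    next
      case empty
      then show ?case by (simp add: set_lebesgue_integral_def)
    next
      case (compl S)
      \<comment> \<open>The complement is computed as the whole space minus \<open>S\<close>; the
        whole space contributes what \<open>A\<close> contributes.\<close>
      have UNIV0: "(LINT x:UNIV|lborel. F' x) = 0"
      proof -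
        have "(LINT x:UNIV|lborel. F' x) = integral\<^sup>L lebesgue (\<lambda>x. indicator UNIV x *\<^sub>R F x)"
          by (rule eq) simp
        also have "(\<lambda>x. indicator UNIV x *\<^sub>R F x) = (\<lambda>x. indicator A x *\<^sub>R F x)"
          by (rule ext) (auto simp: F_def indicator_def)
        also have "integral\<^sup>L lebesgue (\<lambda>x. indicator A x *\<^sub>R F x) = 0"
          using A by (intro open_set_integral_0[OF F _ _ testF]) auto
        finally show ?thesis .
      qed
      have S: "S \<in> sets lborel" using compl sub by blast
      have "(LINT x:UNIV - S|lborel. F' x) = (LINT x:UNIV|lborel. F' x) - (LINT x:S|lborel. F' x)"
      proof -
        have "integrable lborel (\<lambda>x. indicat_real S x *\<^sub>R F' x)"
          using S intF'' by (rule integrable_mult_indicator)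
        then have "integral\<^sup>L lborel (\<lambda>x. F' x - indicat_real S x *\<^sub>R F' x)
          = integral\<^sup>L lborel F' - integral\<^sup>L lborel (\<lambda>x. indicat_real S x *\<^sub>R F' x)"
          using intF'' by simp
        moreover have "indicat_real (UNIV - S) x *\<^sub>R F' x = F' x - indicat_real S x *\<^sub>R F' x" for x
          by (simp add: indicator_def)
        ultimately show ?thesis by (simp add: set_lebesgue_integral_def)
      qed
      then show ?case using compl UNIV0 by simp
    next
      case (union D)
      have "(LINT x:(\<Union>i. D i)|lborel. F' x) = (\<Sum>i. (LINT x:(D i)|lborel. F' x))"
      proof (rule lebesgue_integral_countable_add)
        show D: "D i \<in> sets lborel" for i using union(2) sub by blast
        show "i \<noteq> j \<Longrightarrow> D i \<inter> D j = {}" for i j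
          using union(1) by (auto simp: disjoint_family_on_def)
        have "(\<Union>i. D i) \<in> sets lborel" using D by (intro sets.countable_UN) auto
        then show "set_integrable lborel (\<Union>i. D i) F'"
          unfolding set_integrable_def using intF'' by (rule integrable_mult_indicator)
      qed
      then show ?case using union(3) by simp
    qed
  qed
  then have "AE x in lebesgue. F' x = 0" by (rule AE_completion)
  then have "AE x in lebesgue. x \<in> A \<longrightarrow> f x = 0"
    using F'(2) by eventually_elim (auto simp: F_def)
  then show ?thesis using A' by (simp add: AE_restrict_space_iff)
qed

section \<open>Uniqueness and linearity of weak gradients\<close>

lemma C1_compact_GDERIV: "C1_compact \<psi> d\<psi> \<Longrightarrow> (\<psi> has_derivative (\<lambda>h. h \<bullet> d\<psi> x)) (at x)"
  and C1_compact_continuous_gradient: "C1_compact \<psi> d\<psi> \<Longrightarrow> continuous_on UNIV d\<psi>"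
  and C1_compact_support: "C1_compact \<psi> d\<psi> \<Longrightarrow> compact (closure {x. \<psi> x \<noteq> 0})"
  unfolding C1_compact_def gderiv_def by fast+

lemma integrable_scaleR_bounded:
  fixes f :: "'a::euclidean_space \<Rightarrow> 'b::euclidean_space"
  assumes f: "integrable (lebesgue_on A) f" and b: "continuous_on UNIV b" "\<And>x. \<bar>b x\<bar> \<le> C"
  shows "integrable (lebesgue_on A) (\<lambda>x. b x *\<^sub>R f x)"
proof (rule Bochner_Integration.integrable_bound)
  show "integrable (lebesgue_on A) (\<lambda>x. C * norm (f x))" using f by auto
  have "b \<in> borel_measurable lebesgue"
    using borel_measurable_continuous_onI[OF b(1)] by (intro measurable_completion) simp
  then have "b \<in> borel_measurable (lebesgue_on A)" by (rule measurable_restrict_space1)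
  then show "(\<lambda>x. b x *\<^sub>R f x) \<in> borel_measurable (lebesgue_on A)"
    using f by (intro borel_measurable_scaleR) auto
  have "0 \<le> C" using b(2)[of 0] by linarith
  then show "AE x in lebesgue_on A. norm (b x *\<^sub>R f x) \<le> norm (C * norm (f x))"
    using b(2) by (intro AE_I2) (simp add: abs_mult mult_right_mono)
qed

lemma integrable_scaleR_bounded_right:
  fixes g :: "'a::euclidean_space \<Rightarrow> 'b::euclidean_space"
  assumes f: "integrable (lebesgue_on A) f" and g: "continuous_on UNIV g" "\<And>x. norm (g x) \<le> C"
  shows "integrable (lebesgue_on A) (\<lambda>x. f x *\<^sub>R g x)"
proof (rule Bochner_Integration.integrable_bound)
  show "integrable (lebesgue_on A) (\<lambda>x. C * norm (f x))" using f by auto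
  have "g \<in> borel_measurable lebesgue"
    using borel_measurable_continuous_onI[OF g(1)] by (intro measurable_completion) simp
  then have "g \<in> borel_measurable (lebesgue_on A)" by (rule measurable_restrict_space1)
  then show "(\<lambda>x. f x *\<^sub>R g x) \<in> borel_measurable (lebesgue_on A)"
    using f by (intro borel_measurable_scaleR) auto
  have "0 \<le> C" using g(2)[of 0] norm_ge_zero order_trans by blast
  then have "norm (f x *\<^sub>R g x) \<le> norm (C * norm (f x))" for x
    using mult_left_mono[OF g(2)[of x], of "\<bar>f x\<bar>"] by (simp add: abs_mult mult.commute)
  then show "AE x in lebesgue_on A. norm (f x *\<^sub>R g x) \<le> norm (C * norm (f x))" by simp
qed

lemma is_weak_grad_iff:
  assumes "A \<in> sets lebesgue"
  shows "is_weak_grad A u g \<longleftrightarrow> g \<in> L2 A \<and>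
    (\<forall>\<psi> d\<psi>. C1_compact \<psi> d\<psi> \<and> closure {x. \<psi> x \<noteq> 0} \<subseteq> A \<longrightarrow>
       integral\<^sup>L (lebesgue_on A) (\<lambda>x. u x *\<^sub>R d\<psi> x) = - integral\<^sup>L (lebesgue_on A) (\<lambda>x. \<psi> x *\<^sub>R g x))"
  unfolding is_weak_grad_def by (simp add: set_integral_eq_on[OF assms])

lemma is_weak_gradD:
  assumes "A \<in> sets lebesgue" "is_weak_grad A u g" "C1_compact \<psi> d\<psi>" "closure {x. \<psi> x \<noteq> 0} \<subseteq> A"
  shows "integral\<^sup>L (lebesgue_on A) (\<lambda>x. u x *\<^sub>R d\<psi> x) = - integral\<^sup>L (lebesgue_on A) (\<lambda>x. \<psi> x *\<^sub>R g x)"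
  by (rule conjunct2[OF assms(2)[unfolded is_weak_grad_iff[OF assms(1)]], rule_format, OF conjI, OF assms(3,4)])

lemma weak_grad_test_integrable:
  fixes u :: "real ^ 'd::finite \<Rightarrow> real"
  assumes "A \<in> lmeasurable" "u \<in> L2 A" "g \<in> L2 A" "C1_compact \<psi> d\<psi>"
  shows "integrable (lebesgue_on A) (\<lambda>x. u x *\<^sub>R d\<psi> x)"
    and "integrable (lebesgue_on A) (\<lambda>x. \<psi> x *\<^sub>R (g x :: real ^ 'd))"
proof -
  obtain C D where "\<And>x. \<bar>\<psi> x\<bar> \<le> C" "\<And>x. norm (d\<psi> x) \<le> D"
    using C1_compact_bounded[OF assms(4)] by metis
  moreover have "continuous_on UNIV d\<psi>" using assms(4) by (simp only: C1_compact_def)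
  ultimately show "integrable (lebesgue_on A) (\<lambda>x. u x *\<^sub>R d\<psi> x)"
    "integrable (lebesgue_on A) (\<lambda>x. \<psi> x *\<^sub>R g x)"
    using L2_integrable[OF assms(1,2)] L2_integrable[OF assms(1,3)] C1_compact_continuous[OF assms(4)]
    by (auto intro: integrable_scaleR_bounded integrable_scaleR_bounded_right)
qed

text \<open>Both gradients have the same pairing with every test function, so the fundamental lemma
  annihilates their difference. This pins down the arbitrary choice in \<open>wgrad\<close> up to
  null sets.\<close>

lemma weak_grad_unique:
  assumes A: "open A" "A \<in> lmeasurable" and g: "is_weak_grad A u g" and h: "is_weak_grad A u h"
  shows "AE x in lebesgue_on A. g x = h x"
proof -
  have A': "A \<in> sets lebesgue" using A(2) by auto
  have L2: "g \<in> L2 A" "h \<in> L2 A" using g h by (auto simp: is_weak_grad_def)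
  have "AE x in lebesgue_on A. g x - h x = 0"
  proof (rule fundamental_lemma[OF A(1)])
    show "integrable (lebesgue_on A) (\<lambda>x. g x - h x)"
      using L2 by (intro Bochner_Integration.integrable_diff L2_integrable[OF A(2)])
    fix \<psi> d\<psi> assume \<psi>: "C1_compact \<psi> d\<psi>" "closure {x. \<psi> x \<noteq> 0} \<subseteq> A"
    have "integral\<^sup>L (lebesgue_on A) (\<lambda>x. \<psi> x *\<^sub>R (g x - h x))
      = integral\<^sup>L (lebesgue_on A) (\<lambda>x. \<psi> x *\<^sub>R g x) - integral\<^sup>L (lebesgue_on A) (\<lambda>x. \<psi> x *\<^sub>R h x)"
      using weak_grad_test_integrable(2)[OF A(2) L2_0 L2(1) \<psi>(1)]
        weak_grad_test_integrable(2)[OF A(2) L2_0 L2(2) \<psi>(1)]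
      by (simp add: scaleR_diff_right)
    also have "\<dots> = 0"
      using trans[OF sym[OF is_weak_gradD[OF A' g \<psi>]] is_weak_gradD[OF A' h \<psi>]]
      by (simp only: neg_equal_iff_equal diff_self)
    finally show "integral\<^sup>L (lebesgue_on A) (\<lambda>x. \<psi> x *\<^sub>R (g x - h x)) = 0" .
  qed
  then show ?thesis by eventually_elim simp
qed

lemma is_weak_grad_add:
  assumes A: "A \<in> lmeasurable" and u: "u \<in> L2 A" "is_weak_grad A u g" and v: "v \<in> L2 A" "is_weak_grad A v h"
  shows "is_weak_grad A (\<lambda>x. u x + v x) (\<lambda>x. g x + h x)"
proof -
  have A': "A \<in> sets lebesgue" using A by auto
  have L2: "g \<in> L2 A" "h \<in> L2 A" using u v by (auto simp: is_weak_grad_def)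
  show ?thesis
    unfolding is_weak_grad_iff[OF A']
  proof (intro conjI allI impI, goal_cases)
    case 1
    show ?case by (rule L2_add[OF A' L2])
  next
    case (2 \<psi> d\<psi>)
    then have \<psi>: "C1_compact \<psi> d\<psi>" "closure {x. \<psi> x \<noteq> 0} \<subseteq> A" by auto
    have "integral\<^sup>L (lebesgue_on A) (\<lambda>x. u x *\<^sub>R d\<psi> x) = - integral\<^sup>L (lebesgue_on A) (\<lambda>x. \<psi> x *\<^sub>R g x)"
      "integral\<^sup>L (lebesgue_on A) (\<lambda>x. v x *\<^sub>R d\<psi> x) = - integral\<^sup>L (lebesgue_on A) (\<lambda>x. \<psi> x *\<^sub>R h x)"
      by (rule is_weak_gradD[OF A' u(2) \<psi>], rule is_weak_gradD[OF A' v(2) \<psi>])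
    with weak_grad_test_integrable[OF A u(1) L2(1) \<psi>(1)] weak_grad_test_integrable[OF A v(1) L2(2) \<psi>(1)]
    show ?case by (simp add: scaleR_add_left scaleR_add_right)
  qed
qed

lemma is_weak_grad_scaleR:
  assumes A: "A \<in> lmeasurable" and u: "is_weak_grad A u g"
  shows "is_weak_grad A (\<lambda>x. c * u x) (\<lambda>x. c *\<^sub>R g x)"
proof -
  have A': "A \<in> sets lebesgue" using A by auto
  have L2: "g \<in> L2 A" using u by (auto simp: is_weak_grad_def)
  show ?thesis
    unfolding is_weak_grad_iff[OF A']
  proof (intro conjI allI impI, goal_cases)
    case 1
    show ?case by (rule L2_scaleR[OF A' L2])
  next
    case (2 \<psi> d\<psi>)
    then have "integral\<^sup>L (lebesgue_on A) (\<lambda>x. u x *\<^sub>R d\<psi> x) = - integral\<^sup>L (lebesgue_on A) (\<lambda>x. \<psi> x *\<^sub>R g x)"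
      by (intro is_weak_gradD[OF A' u]) (elim conjE, assumption)+
    then have "c *\<^sub>R integral\<^sup>L (lebesgue_on A) (\<lambda>x. u x *\<^sub>R d\<psi> x)
      = - (c *\<^sub>R integral\<^sup>L (lebesgue_on A) (\<lambda>x. \<psi> x *\<^sub>R g x))" by simp
    then show ?case
      by (simp add: scaleR_scaleR[symmetric] scaleR_left_commute[of _ c] del: scaleR_scaleR)
  qed
qed

lemma H1_L2: "u \<in> H1 A \<Longrightarrow> u \<in> L2 A"
  by (simp add: H1_def)

lemma wgrad_is_weak_grad: "u \<in> H1 A \<Longrightarrow> is_weak_grad A u (wgrad A u)"
  unfolding H1_def wgrad_def by (auto intro: someI_ex[of "is_weak_grad A u"])

lemma wgrad_L2: "u \<in> H1 A \<Longrightarrow> wgrad A u \<in> L2 A"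
  using wgrad_is_weak_grad by (auto simp: is_weak_grad_def)

lemma wgrad_eqI:
  assumes "open A" "A \<in> lmeasurable" "u \<in> L2 A" "is_weak_grad A u g"
  shows "AE x in lebesgue_on A. wgrad A u x = g x"
proof -
  have "u \<in> H1 A" using assms(3,4) by (auto simp: H1_def)
  then show ?thesis using weak_grad_unique[OF assms(1,2) wgrad_is_weak_grad assms(4)] by simp
qed

lemma H1_add:
  assumes "A \<in> lmeasurable" "u \<in> H1 A" "v \<in> H1 A"
  shows "(\<lambda>x. u x + v x) \<in> H1 A"
  using is_weak_grad_add[OF assms(1) H1_L2[OF assms(2)] wgrad_is_weak_grad[OF assms(2)]
      H1_L2[OF assms(3)] wgrad_is_weak_grad[OF assms(3)]]
    L2_add[OF _ H1_L2[OF assms(2)] H1_L2[OF assms(3)]] assms(1)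
  unfolding H1_def by auto

lemma H1_scaleR:
  assumes "A \<in> lmeasurable" "u \<in> H1 A"
  shows "(\<lambda>x. c * u x) \<in> H1 A"
  using is_weak_grad_scaleR[OF assms(1) wgrad_is_weak_grad[OF assms(2)], of c]
    L2_scaleR[OF _ H1_L2[OF assms(2)], of c] assms(1)
  unfolding H1_def by auto

lemma wgrad_add:
  assumes "open A" "A \<in> lmeasurable" "u \<in> H1 A" "v \<in> H1 A"
  shows "AE x in lebesgue_on A. wgrad A (\<lambda>x. u x + v x) x = wgrad A u x + wgrad A v x"
  using assms H1_add[OF assms(2-4)]
  by (intro wgrad_eqI is_weak_grad_add wgrad_is_weak_grad) (auto intro: H1_L2)

lemma wgrad_scaleR:
  assumes "open A" "A \<in> lmeasurable" "u \<in> H1 A"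
  shows "AE x in lebesgue_on A. wgrad A (\<lambda>x. c * u x) x = c *\<^sub>R wgrad A u x"
  using assms H1_scaleR[OF assms(2-3)]
  by (intro wgrad_eqI is_weak_grad_scaleR wgrad_is_weak_grad) (auto intro: H1_L2)

section \<open>Functions with vanishing weak gradient on a connected open set\<close>

lemma C1_compact_uniformly_continuous_gradient:
  fixes \<psi> :: "real ^ 'd::finite \<Rightarrow> real"
  assumes \<psi>: "C1_compact \<psi> d\<psi>" and "0 < e"
  shows "\<exists>\<delta>>0. \<forall>x y. dist x y < \<delta> \<longrightarrow> norm (d\<psi> x - d\<psi> y) \<le> e"
proof -
  have "bounded (closure {x. \<psi> x \<noteq> 0})"
    by (rule compact_imp_bounded[OF C1_compact_support[OF \<psi>]])
  then obtain R where R: "\<And>x. x \<in> closure {x. \<psi> x \<noteq> 0} \<Longrightarrow> norm x \<le> R"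
    unfolding bounded_iff by metis
  have zero: "d\<psi> x = 0" if "x \<notin> cball 0 R" for x
    using that R[of x] by (intro C1_compact_gradient_support[OF \<psi>]) auto
  have "continuous_on UNIV d\<psi>" using \<psi> by (simp only: C1_compact_def)
  then have "uniformly_continuous_on (cball 0 (R + 1)) d\<psi>"
    by (intro compact_uniformly_continuous) (auto intro: continuous_on_subset)
  then obtain d where d: "0 < d"
    "\<And>x y. x \<in> cball 0 (R + 1) \<Longrightarrow> y \<in> cball 0 (R + 1) \<Longrightarrow> dist y x < d \<Longrightarrow> dist (d\<psi> y) (d\<psi> x) < e"
    using \<open>0 < e\<close> unfolding uniformly_continuous_on_def by metis
  \<comment> \<open>Distance below 1 settles both cases: either both points lie in the ball of
    radius \<open>R + 1\<close>, where the gradient is uniformly continuous, or both lie off the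
    ball of radius \<open>R\<close>, where it vanishes.\<close>
  have "norm (d\<psi> x - d\<psi> y) \<le> e" if xy: "dist x y < min d 1" for x y
  proof (cases "x \<in> cball 0 R \<or> y \<in> cball 0 R")
    case True
    have "norm x \<le> norm y + dist x y" "norm y \<le> norm x + dist x y"
      by (metis dist_norm norm_triangle_sub) (metis dist_commute dist_norm norm_triangle_sub)
    then have "x \<in> cball 0 (R + 1)" "y \<in> cball 0 (R + 1)"
      using True xy by auto
    then have "dist (d\<psi> x) (d\<psi> y) < e" using d(2)[of y x] xy by simp
    then show ?thesis by (simp add: dist_norm)
  next
    case False
    then show ?thesis using zero[of x] zero[of y] \<open>0 < e\<close> by simp
  qed
  then show ?thesis using d(1) by (intro exI[of _ "min d 1"]) auto
qed

text \<open>The radius is the same for all base points; this uniformity lets the difference quotient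
  be taken under the integral in the shift argument below.\<close>

lemma C1_compact_uniform_remainder:
  fixes \<psi> :: "real ^ 'd::finite \<Rightarrow> real"
  assumes \<psi>: "C1_compact \<psi> d\<psi>" and "0 < e"
  shows "\<exists>\<delta>>0. \<forall>x y. dist x y < \<delta> \<longrightarrow> \<bar>\<psi> y - \<psi> x - (y - x) \<bullet> d\<psi> x\<bar> \<le> e * norm (y - x)"
proof -
  obtain \<delta> where \<delta>: "\<delta> > 0" "\<And>x y. dist x y < \<delta> \<Longrightarrow> norm (d\<psi> x - d\<psi> y) \<le> e"
    using C1_compact_uniformly_continuous_gradient[OF assms] by metis
  have "\<bar>\<psi> y - \<psi> x - (y - x) \<bullet> d\<psi> x\<bar> \<le> e * norm (y - x)" if "dist x y < \<delta>" for x y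
  proof -
    have "norm (\<psi> y - \<psi> x - (y - x) \<bullet> d\<psi> x) \<le> norm (y - x) * e"
    proof (rule differentiable_bound_linearization[where S="ball x \<delta>" and f'="\<lambda>z h. h \<bullet> d\<psi> z"])
      show "x + t *\<^sub>R (y - x) \<in> ball x \<delta>" if "t \<in> {0..1}" for t
      proof -
        have "norm (t *\<^sub>R (y - x)) \<le> 1 * norm (y - x)"
          using that by (simp add: mult_left_le_one_le)
        then show ?thesis using \<open>dist x y < \<delta>\<close> by (simp add: dist_norm norm_minus_commute)
      qed
      show "(\<psi> has_derivative (\<lambda>h. h \<bullet> d\<psi> z)) (at z within ball x \<delta>)" for z
        using \<psi> by (auto simp: C1_compact_def gderiv_def intro: has_derivative_at_withinI)
      show "onorm ((\<lambda>h. h \<bullet> d\<psi> z) - (\<lambda>h. h \<bullet> d\<psi> x)) \<le> e" if "z \<in> ball x \<delta>" for z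
        unfolding fun_diff_def
      proof (rule onorm_le)
        fix h
        have "norm (h \<bullet> d\<psi> z - h \<bullet> d\<psi> x) \<le> norm h * norm (d\<psi> z - d\<psi> x)"
          using Cauchy_Schwarz_ineq2[of h "d\<psi> z - d\<psi> x"] by (simp add: inner_diff_right)
        also have "\<dots> \<le> norm h * e"
          using \<delta>(2)[of z x] that by (intro mult_left_mono) (auto simp: dist_commute)
        finally show "norm (h \<bullet> d\<psi> z - h \<bullet> d\<psi> x) \<le> e * norm h" by (simp add: mult.commute)
      qed
      show "x \<in> ball x \<delta>" using \<delta>(1) by simp
    qed
    then show ?thesis by (simp add: mult.commute)
  qed
  then show ?thesis using \<delta>(1) by blast
qed

lemma integrable_lborel_mult_bounded:
  fixes U :: "real ^ 'd::finite \<Rightarrow> real" and g :: "real ^ 'd::finite \<Rightarrow> 'b::euclidean_space"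
  assumes "integrable lborel U" "continuous_on UNIV g" "\<And>x. norm (g x) \<le> C"
  shows "integrable lborel (\<lambda>x. U x *\<^sub>R g x)"
proof (rule Bochner_Integration.integrable_bound)
  show "integrable lborel (\<lambda>x. C * norm (U x))" using assms by auto
  show "(\<lambda>x. U x *\<^sub>R g x) \<in> borel_measurable lborel"
    using assms(1) borel_measurable_continuous_onI[OF assms(2)]
    by (intro borel_measurable_scaleR) auto
  have "0 \<le> C" using assms(3)[of 0] norm_ge_zero order_trans by blast
  then have "norm (U x *\<^sub>R g x) \<le> norm (C * norm (U x))" for x
    using mult_left_mono[OF assms(3)[of x], of "\<bar>U x\<bar>"] by (simp add: abs_mult mult.commute)
  then show "AE x in lborel. norm (U x *\<^sub>R g x) \<le> norm (C * norm (U x))" by simp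
qed

text \<open>With \<open>F t = \<integral> U x \<psi> (x - t h)\<close>, the hypothesis says that \<open>F\<close> has derivative zero.\<close>

lemma translation_invariant_if_zero_grad:
  fixes U :: "real ^ 'd::finite \<Rightarrow> real"
  assumes U: "integrable lborel U"
    and test: "\<And>\<psi> d\<psi>. C1_compact \<psi> d\<psi> \<Longrightarrow> closure {x. \<psi> x \<noteq> 0} \<subseteq> cball c (2 * r) \<Longrightarrow>
      integral\<^sup>L lborel (\<lambda>x. U x *\<^sub>R d\<psi> x) = 0"
    and \<psi>: "C1_compact \<psi> d\<psi>" "closure {x. \<psi> x \<noteq> 0} \<subseteq> cball c r" and h: "norm h \<le> r"
  shows "integral\<^sup>L lborel (\<lambda>x. U x * \<psi> (x - h)) = integral\<^sup>L lborel (\<lambda>x. U x * \<psi> x)"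
proof -
  define F where "F t = integral\<^sup>L lborel (\<lambda>x. U x * \<psi> (x - t *\<^sub>R h))" for t :: real
  have cont: "continuous_on UNIV \<psi>" "continuous_on UNIV d\<psi>"
    using C1_compact_continuous[OF \<psi>(1)] \<psi>(1) by (simp_all only: C1_compact_def)
  obtain C D where CD: "\<And>x. \<bar>\<psi> x\<bar> \<le> C" "\<And>x. norm (d\<psi> x) \<le> D"
    using C1_compact_bounded[OF \<psi>(1)] by metis
  have shift: "continuous_on UNIV (\<lambda>x. x - v)" for v :: "real ^ 'd" by (intro continuous_intros)
  have i1: "integrable lborel (\<lambda>x. U x * \<psi> (x - v))" for v
    using integrable_lborel_mult_bounded[OF U continuous_on_compose2[OF cont(1) shift], of v C] CD(1)
    by simp
  have i2: "integrable lborel (\<lambda>x. U x *\<^sub>R d\<psi> (x - v))" for v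
    using integrable_lborel_mult_bounded[OF U continuous_on_compose2[OF cont(2) shift], of v D] CD(2)
    by simp
  \<comment> \<open>A shift by at most \<open>r\<close> moves the support from the ball of radius
    \<open>r\<close> into the one of radius \<open>2 * r\<close>, where \<open>test\<close> applies;
    hence the two radii.\<close>
  have zero: "integral\<^sup>L lborel (\<lambda>x. U x *\<^sub>R d\<psi> (x - t *\<^sub>R h)) = 0" if t: "t \<in> {0..1}" for t
  proof (rule test)
    have "norm (t *\<^sub>R h) \<le> 1 * norm h" using t by (simp add: mult_left_le_one_le)
    then have th: "norm (t *\<^sub>R h) \<le> r" using h by simp
    have eq: "{x. \<psi> (x - t *\<^sub>R h) \<noteq> 0} = (+) (t *\<^sub>R h) ` {x. \<psi> x \<noteq> 0}"
      by (auto simp: image_iff intro!: exI[of _ "_ - t *\<^sub>R h"])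
    have cl: "closure {x. \<psi> (x - t *\<^sub>R h) \<noteq> 0} = (+) (t *\<^sub>R h) ` closure {x. \<psi> x \<noteq> 0}"
      unfolding eq by (rule closure_translation)
    also have "\<dots> \<subseteq> cball c (2 * r)"
    proof clarify
      fix x assume "x \<in> closure {x. \<psi> x \<noteq> 0}"
      then have "dist c x \<le> r" using \<psi>(2) by auto
      then have "norm (c - x) + norm (t *\<^sub>R h) \<le> 2 * r" using th by (simp add: dist_norm)
      then have "norm (c - x - t *\<^sub>R h) \<le> 2 * r" using norm_triangle_ineq4[of "c - x" "t *\<^sub>R h"] by linarith
      then show "t *\<^sub>R h + x \<in> cball c (2 * r)" by (simp add: dist_norm algebra_simps)
    qed
    finally show "closure {x. \<psi> (x - t *\<^sub>R h) \<noteq> 0} \<subseteq> cball c (2 * r)" .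
    have "GDERIV (\<lambda>x. \<psi> (x - t *\<^sub>R h)) x :> d\<psi> (x - t *\<^sub>R h)" for x
    proof -
      have "((\<lambda>x. x - t *\<^sub>R h) has_derivative (\<lambda>h. h)) (at x)"
        by (auto intro!: derivative_eq_intros)
      then show ?thesis
        unfolding gderiv_def
        by (rule has_derivative_compose[OF _ C1_compact_GDERIV[OF \<psi>(1)]])
    qed
    moreover have "compact (closure {x. \<psi> (x - t *\<^sub>R h) \<noteq> 0})"
      unfolding cl by (intro compact_translation C1_compact_support[OF \<psi>(1)])
    ultimately show "C1_compact (\<lambda>x. \<psi> (x - t *\<^sub>R h)) (\<lambda>x. d\<psi> (x - t *\<^sub>R h))"
      unfolding C1_compact_def using continuous_on_compose2[OF cont(2) shift] by simp
  qed
  define N where "N = integral\<^sup>L lborel (\<lambda>x. \<bar>U x\<bar>)"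
  have N: "0 \<le> N" unfolding N_def by simp
  have "(F has_derivative (\<lambda>_. 0)) (at t within {0..1})" if t: "t \<in> {0..1}" for t
    unfolding has_derivative_within_alt
  proof (intro conjI allI impI)
    show "bounded_linear (\<lambda>_::real. 0::real)" by simp
    fix e :: real assume "0 < e"
    \<comment> \<open>Chosen so that \<open>e' * (norm h * N)\<close> stays below \<open>e\<close>;
      the summands 1 keep the denominator positive when \<open>N\<close> or \<open>h\<close>
      vanishes.\<close>
    define e' where "e' = e / ((N + 1) * (norm h + 1))"
    have "0 < e'" unfolding e'_def using \<open>0 < e\<close> N by (simp add: add_nonneg_pos)
    then obtain \<delta> where \<delta>: "\<delta> > 0"
      "\<And>x y. dist x y < \<delta> \<Longrightarrow> \<bar>\<psi> y - \<psi> x - (y - x) \<bullet> d\<psi> x\<bar> \<le> e' * norm (y - x)"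
      using C1_compact_uniform_remainder[OF \<psi>(1)] by metis
    show "\<exists>d>0. \<forall>s\<in>{0..1}. norm (s - t) < d \<longrightarrow> norm (F s - F t - 0) \<le> e * norm (s - t)"
    proof (intro exI[of _ "\<delta> / (norm h + 1)"] conjI ballI impI)
      show "0 < \<delta> / (norm h + 1)" using \<delta>(1) by (simp add: add_nonneg_pos)
      fix s :: real assume s: "s \<in> {0..1}" "norm (s - t) < \<delta> / (norm h + 1)"
      have h1: "0 < norm h + 1" by (simp add: add_nonneg_pos)
      have sth: "norm (s - t) * norm h < \<delta>"
      proof -
        have "norm (s - t) * norm h \<le> norm (s - t) * (norm h + 1)" by (intro mult_left_mono) auto
        also have "\<dots> < \<delta>" using s(2) h1 by (simp add: pos_less_divide_eq)
        finally show ?thesis .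
      qed
      \<comment> \<open>The first-order remainder of the shift from \<open>t\<close> to
        \<open>s\<close>. Its linear part pairs with \<open>U\<close> to zero by
        \<open>zero\<close>, so \<open>F s - F t\<close> is the integral of
        \<open>U x * Q x\<close>, which is small.\<close>
      define Q where "Q x = \<psi> (x - s *\<^sub>R h) - \<psi> (x - t *\<^sub>R h) - (t - s) *\<^sub>R h \<bullet> d\<psi> (x - t *\<^sub>R h)" for x
      have Q: "\<bar>Q x\<bar> \<le> e' * (norm (s - t) * norm h)" for x
      proof -
        have "(x - s *\<^sub>R h) - (x - t *\<^sub>R h) = (t - s) *\<^sub>R h" by (simp add: algebra_simps)
        moreover have "dist (x - t *\<^sub>R h) (x - s *\<^sub>R h) < \<delta>"
        proof -
          have "(x - t *\<^sub>R h) - (x - s *\<^sub>R h) = (s - t) *\<^sub>R h" by (simp add: algebra_simps)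
          then show ?thesis using sth by (simp add: dist_norm)
        qed
        ultimately show ?thesis
          using \<delta>(2)[of "x - t *\<^sub>R h" "x - s *\<^sub>R h"] by (simp add: Q_def abs_minus_commute)
      qed
      have "integrable lborel (\<lambda>x. U x *\<^sub>R d\<psi> (x - t *\<^sub>R h) \<bullet> ((t - s) *\<^sub>R h))"
        using i2[of "t *\<^sub>R h"] by (rule integrable_inner_left)
      then have iQ: "integrable lborel (\<lambda>x. U x * Q x)"
        and "integral\<^sup>L lborel (\<lambda>x. U x * Q x) = F s - F t
          - integral\<^sup>L lborel (\<lambda>x. U x *\<^sub>R d\<psi> (x - t *\<^sub>R h) \<bullet> ((t - s) *\<^sub>R h))"
        using i1[of "s *\<^sub>R h"] i1[of "t *\<^sub>R h"]
        by (auto simp: Q_def F_def right_diff_distrib inner_commute)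
      moreover have "integral\<^sup>L lborel (\<lambda>x. U x *\<^sub>R d\<psi> (x - t *\<^sub>R h) \<bullet> ((t - s) *\<^sub>R h)) = 0"
        using zero[OF t] i2[of "t *\<^sub>R h"] by (subst integral_inner_left) auto
      ultimately have "F s - F t = integral\<^sup>L lborel (\<lambda>x. U x * Q x)" by simp
      also have "norm \<dots> \<le> integral\<^sup>L lborel (\<lambda>x. norm (U x * Q x))" by (rule integral_norm_bound)
      also have "\<dots> \<le> integral\<^sup>L lborel (\<lambda>x. e' * (norm (s - t) * norm h) * \<bar>U x\<bar>)"
      proof (rule integral_mono)
        show "integrable lborel (\<lambda>x. norm (U x * Q x))" using iQ by (rule integrable_norm)
        show "integrable lborel (\<lambda>x. e' * (norm (s - t) * norm h) * \<bar>U x\<bar>)" using U by auto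
        show "norm (U x * Q x) \<le> e' * (norm (s - t) * norm h) * \<bar>U x\<bar>" for x
          using mult_left_mono[OF Q[of x], of "\<bar>U x\<bar>"] by (simp add: abs_mult mult.commute)
      qed
      also have "\<dots> = (e' * (norm h * N)) * norm (s - t)"
        unfolding N_def by simp
      also have "\<dots> \<le> e * norm (s - t)"
      proof (intro mult_right_mono)
        have "norm h * N \<le> (N + 1) * (norm h + 1)" using N by (simp add: algebra_simps)
        then have "e' * (norm h * N) \<le> e' * ((N + 1) * (norm h + 1))"
          using \<open>0 < e'\<close> by (intro mult_left_mono) auto
        also have "\<dots> = e" using N h1 by (simp add: e'_def)
        finally show "e' * (norm h * N) \<le> e" .
      qed simp
      finally show "norm (F s - F t - 0) \<le> e * norm (s - t)" by simp
    qed
  qed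
  then have "\<exists>k. \<forall>t\<in>{0..1}. F t = k"
    by (intro has_derivative_zero_constant) auto
  then have "F 1 = F 0" by auto
  then show ?thesis by (simp add: F_def)
qed

lemma lborel_translate:
  fixes f :: "'a::euclidean_space \<Rightarrow> 'b::euclidean_space"
  assumes "f \<in> borel_measurable borel"
  shows "integral\<^sup>L lborel (\<lambda>x. f (x + v)) = integral\<^sup>L lborel f"
    and "integrable lborel (\<lambda>x. f (x + v)) \<longleftrightarrow> integrable lborel f"
proof -
  have d: "distr lborel borel (\<lambda>x. x + v) = lborel"
  proof -
    have "(\<lambda>x. x + v) = (+) v" by (rule ext) (rule add.commute)
    then show ?thesis by (simp only: lborel_distr_plus)
  qed
  have m: "(\<lambda>x. x + v) \<in> lborel \<rightarrow>\<^sub>M borel" by measurable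
  show "integral\<^sup>L lborel (\<lambda>x. f (x + v)) = integral\<^sup>L lborel f"
    using integral_distr[OF m assms] d by simp
  show "integrable lborel (\<lambda>x. f (x + v)) \<longleftrightarrow> integrable lborel f"
    using integrable_distr_eq[OF m assms] d by simp
qed

lemma AE_lborel_translate:
  fixes v :: "'a::euclidean_space"
  assumes "Measurable.pred borel P"
  shows "(AE x in lborel. P (x + v)) \<longleftrightarrow> (AE x in lborel. P x)"
proof -
  have d: "distr lborel borel (\<lambda>x. x + v) = lborel"
  proof -
    have "(\<lambda>x. x + v) = (+) v" by (rule ext) (rule add.commute)
    then show ?thesis by (simp only: lborel_distr_plus)
  qed
  have m: "(\<lambda>x. x + v) \<in> lborel \<rightarrow>\<^sub>M borel" by measurable
  have "{x \<in> space borel. P x} \<in> sets borel" using assms by measurable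
  then show ?thesis
    using AE_distr_iff[OF m, of P, unfolded d] by (simp only:)
qed

lemma negligible_if_AE:
  fixes S :: "'a::euclidean_space set"
  assumes "AE x in lebesgue. x \<notin> S"
  shows "negligible S"
proof -
  obtain N where "N \<in> null_sets lebesgue" "{x \<in> space lebesgue. \<not> x \<notin> S} \<subseteq> N"
    using assms unfolding eventually_ae_filter by (elim bexE)
  moreover have "S = {x \<in> space lebesgue. \<not> x \<notin> S}" by simp
  ultimately show ?thesis
    using negligible_iff_null_sets negligible_subset by metis
qed

lemma AE_open_witness:
  fixes V :: "'a::euclidean_space set"
  assumes "open V" "V \<noteq> {}" "AE x in lebesgue. x \<in> V \<longrightarrow> P x"
  shows "\<exists>x\<in>V. P x"
proof (rule ccontr)
  assume none: "\<not> (\<exists>x\<in>V. P x)"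
  have "AE x in lebesgue. x \<notin> V" using assms(3) by eventually_elim (use none in blast)
  then have "negligible V" by (rule negligible_if_AE)
  then show False using open_not_negligible[OF assms(1,2)] by simp
qed

text \<open>For each fixed small shift, \<open>U (x + h) = U x\<close> for almost every
  \<open>x\<close>: the pairing with test functions is invariant and the fundamental lemma applies.
  Fubini exchanges the quantifiers, so some single \<open>x\<close> near the centre has
  \<open>U (x + h) = U x\<close> for almost every small \<open>h\<close>; this says that
  \<open>U\<close> equals the number \<open>U x\<close> almost everywhere near
  \<open>x\<close>.\<close>

lemma locally_constant_if_zero_grad:
  fixes U :: "real ^ 'd::finite \<Rightarrow> real"
  assumes r: "0 < r" and U: "integrable lborel U"
    and test: "\<And>\<psi> d\<psi>. C1_compact \<psi> d\<psi> \<Longrightarrow> closure {x. \<psi> x \<noteq> 0} \<subseteq> cball c (2 * r) \<Longrightarrow>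
      integral\<^sup>L lborel (\<lambda>x. U x *\<^sub>R d\<psi> x) = 0"
  shows "\<exists>k. AE x in lebesgue. x \<in> ball c (r / 2) \<longrightarrow> U x = k"
proof -
  have [measurable]: "U \<in> borel_measurable borel" using U by auto
  define P where "P x h \<longleftrightarrow> (x \<in> ball c r \<and> h \<in> ball 0 r \<longrightarrow> U (x + h) = U x)" for x h
  have "AE x in lborel. P x h" for h
  proof (cases "h \<in> ball 0 r")
    case True
    then have h: "norm h \<le> r" by simp
    define f where "f x = U x - U (x + h)" for x
    have Uh: "integrable lborel (\<lambda>x. U (x + h))" using U by (subst lborel_translate) auto
    have f: "integrable lborel f" unfolding f_def using U Uh by simp
    have bS: "ball c r \<in> sets lebesgue" by simp
    have "AE x in lebesgue_on (ball c r). f x = 0"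
    proof (rule fundamental_lemma)
      have "integrable lebesgue (\<lambda>x. indicat_real (ball c r) x *\<^sub>R f x)"
        using f by (intro integrable_mult_indicator) (auto simp: integrable_completion)
      then show "integrable (lebesgue_on (ball c r)) f"
        by (simp add: integrable_restrict_space)
      fix \<psi> d\<psi> assume \<psi>: "C1_compact \<psi> d\<psi>" "closure {x. \<psi> x \<noteq> 0} \<subseteq> ball c r"
      have [measurable]: "\<psi> \<in> borel_measurable borel"
        by (rule borel_measurable_continuous_onI[OF C1_compact_continuous[OF \<psi>(1)]])
      obtain C where C: "\<And>x. norm (\<psi> x) \<le> C" using C1_compact_bounded(1)[OF \<psi>(1)] by auto
      have i1: "integrable lborel (\<lambda>x. U x * \<psi> x)"
        using integrable_lborel_mult_bounded[OF U C1_compact_continuous[OF \<psi>(1)] C] by simp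
      have i2: "integrable lborel (\<lambda>x. U (x + h) * \<psi> x)"
        using integrable_lborel_mult_bounded[OF Uh C1_compact_continuous[OF \<psi>(1)] C] by simp
      have "\<psi> x = 0" if "x \<notin> ball c r" for x
        using that \<psi>(2) closure_subset[of "{x. \<psi> x \<noteq> 0}"] by auto
      then have ind: "(\<lambda>x. indicat_real (ball c r) x *\<^sub>R (\<psi> x *\<^sub>R f x)) = (\<lambda>x. U x * \<psi> x - U (x + h) * \<psi> x)"
        by (intro ext) (simp add: f_def indicator_def algebra_simps)
      have "integral\<^sup>L (lebesgue_on (ball c r)) (\<lambda>x. \<psi> x *\<^sub>R f x)
        = integral\<^sup>L lebesgue (\<lambda>x. U x * \<psi> x - U (x + h) * \<psi> x)"
        unfolding ind[symmetric] using bS by (intro integral_restrict_space) simp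
      also have "\<dots> = integral\<^sup>L lborel (\<lambda>x. U x * \<psi> x - U (x + h) * \<psi> x)"
        by (intro integral_completion) measurable
      also have "\<dots> = integral\<^sup>L lborel (\<lambda>x. U x * \<psi> x) - integral\<^sup>L lborel (\<lambda>x. U (x + h) * \<psi> x)"
        using i1 i2 by simp
      also have "integral\<^sup>L lborel (\<lambda>x. U (x + h) * \<psi> x) = integral\<^sup>L lborel (\<lambda>x. U x * \<psi> (x - h))"
        using lborel_translate(1)[of "\<lambda>x. U x * \<psi> (x - h)" h] by simp
      also have "\<dots> = integral\<^sup>L lborel (\<lambda>x. U x * \<psi> x)"
        using \<psi>(2) ball_subset_cball by (intro translation_invariant_if_zero_grad[OF U test \<psi>(1) _ h]) (auto dest: subset_trans)
      finally show "integral\<^sup>L (lebesgue_on (ball c r)) (\<lambda>x. \<psi> x *\<^sub>R f x) = 0" by simp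
    qed simp
    then have "AE x in lebesgue. x \<in> ball c r \<longrightarrow> f x = 0"
      using bS by (simp add: AE_restrict_space_iff)
    then have "AE x in lborel. x \<in> ball c r \<longrightarrow> f x = 0" by (simp add: AE_completion_iff)
    then show ?thesis
      by eventually_elim (auto simp: P_def f_def)
  next
    case False
    then show ?thesis by (simp add: P_def)
  qed
  then have "AE h in lborel. AE x in lborel. P x h" by simp
  moreover have "pair_sigma_finite lborel (lborel :: (real ^ 'd) measure)"
    by (intro pair_sigma_finite.intro sigma_finite_lborel)
  \<comment> \<open>Fubini needs the set of good pairs to be product measurable; this is where a
    Borel \<open>U\<close> is used.\<close>
  moreover have "{p \<in> space (lborel \<Otimes>\<^sub>M lborel). P (fst p) (snd p)} \<in> sets (lborel \<Otimes>\<^sub>M lborel)"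
  proof -
    have "sets (lborel \<Otimes>\<^sub>M lborel) = sets (borel \<Otimes>\<^sub>M (borel :: (real ^ 'd) measure))"
      by (intro sets_pair_measure_cong) simp_all
    moreover have "{p \<in> space (borel \<Otimes>\<^sub>M borel). dist c (fst p) < r \<and> dist 0 (snd p) < r \<longrightarrow>
        U (fst p + snd p) = U (fst p)} \<in> sets (borel \<Otimes>\<^sub>M borel)"
      by measurable
    ultimately show ?thesis by (simp add: P_def space_pair_measure)
  qed
  ultimately have "AE x in lborel. AE h in lborel. P x h"
    using pair_sigma_finite.AE_commute[of lborel lborel P] by simp
  then have "AE x in lborel. x \<in> ball c (r / 2) \<longrightarrow> (AE h in lborel. P x h)"
    by eventually_elim (rule impI)
  then have "AE x in lebesgue. x \<in> ball c (r / 2) \<longrightarrow> (AE h in lborel. P x h)"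
    by (rule AE_completion)
  \<comment> \<open>For a point this close to \<open>c\<close>, \<open>ball c (r / 2)\<close> lies
    inside \<open>ball x r\<close>, so invariance under the small shifts from \<open>x\<close>
    covers the whole neighbourhood of \<open>c\<close>.\<close>
  then have "\<exists>x\<in>ball c (r / 2). AE h in lborel. P x h"
    using r by (intro AE_open_witness) auto
  then obtain x where x: "x \<in> ball c (r / 2)" "AE h in lborel. P x h"
    by (elim bexE)
  have "AE h in lborel. h + x \<in> ball x r \<longrightarrow> U (h + x) = U x"
  proof -
    have xc: "x \<in> ball c r" using x(1) r by simp
    show ?thesis
      using x(2)
    proof eventually_elim
      case (elim h)
      then show ?case using xc by (simp add: P_def dist_norm add.commute)
    qed
  qed
  then have "AE y in lborel. y \<in> ball x r \<longrightarrow> U y = U x"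
    using AE_lborel_translate[of "\<lambda>y. y \<in> ball x r \<longrightarrow> U y = U x" x] by simp
  then have "AE y in lebesgue. y \<in> ball x r \<longrightarrow> U y = U x"
    by (rule AE_completion)
  then have "AE y in lebesgue. y \<in> ball c (r / 2) \<longrightarrow> U y = U x"
  proof eventually_elim
    case (elim y)
    have "y \<in> ball x r" if "y \<in> ball c (r / 2)"
      using dist_triangle[of x y c] x(1) that by (simp add: dist_commute)
    with elim show ?case by simp
  qed
  then show ?thesis by (rule exI)
qed

text \<open>Near each point of \<open>A\<close> the function is a.e. a constant \<open>K a\<close>.
  If \<open>b\<close> lies in the ball of \<open>a\<close>, the two balls meet in a nonempty open
  set, which is not null, so the constants agree. Thus \<open>K\<close> is locally constant, and
  connectedness makes it constant.\<close>

theorem constant_if_zero_weak_grad: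
  fixes u :: "real ^ 'd::finite \<Rightarrow> real"
  assumes A: "open A" "connected A" "A \<in> lmeasurable" and u: "u \<in> L2 A" and g: "is_weak_grad A u g"
    and zero: "AE x in lebesgue_on A. g x = 0"
  shows "\<exists>k. AE x in lebesgue_on A. u x = k"
proof -
  have A': "A \<in> sets lebesgue" using A by auto
  define F where "F x = indicat_real A x *\<^sub>R u x" for x
  have F: "integrable lebesgue F"
    unfolding F_def using L2_integrable[OF A(3) u] A' by (simp add: integrable_restrict_space)
  then have "F \<in> borel_measurable lebesgue" by auto
  then obtain U where U: "U \<in> borel_measurable borel" "AE x in lebesgue. F x = U x"
    using lebesgue_borel_version by metis
  have mU: "U \<in> borel_measurable lebesgue" using U(1) by (intro measurable_completion) simp
  have "integrable lebesgue U" using F mU U(2) by (rule integrable_cong_AE_imp)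
  then have intU: "integrable lborel U" using U(1) by (simp add: integrable_completion)
  have test: "integral\<^sup>L lborel (\<lambda>x. U x *\<^sub>R d\<psi> x) = 0"
    if \<psi>: "C1_compact \<psi> d\<psi>" "closure {x. \<psi> x \<noteq> 0} \<subseteq> A" for \<psi> d\<psi>
  proof -
    have md: "d\<psi> \<in> borel_measurable borel"
      by (rule borel_measurable_continuous_onI[OF C1_compact_continuous_gradient[OF \<psi>(1)]])
    have mUd: "(\<lambda>x. U x *\<^sub>R d\<psi> x) \<in> borel_measurable borel" using U(1) md by simp
    have mg: "g \<in> L2 A" using g by (simp add: is_weak_grad_def)
    have "integral\<^sup>L lborel (\<lambda>x. U x *\<^sub>R d\<psi> x) = integral\<^sup>L lebesgue (\<lambda>x. U x *\<^sub>R d\<psi> x)"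
      using mUd by (intro integral_completion[symmetric]) simp
    also have "\<dots> = integral\<^sup>L lebesgue (\<lambda>x. F x *\<^sub>R d\<psi> x)"
    proof (rule integral_cong_AE)
      show "(\<lambda>x. U x *\<^sub>R d\<psi> x) \<in> borel_measurable lebesgue"
        using mUd by (intro measurable_completion) simp
      have "d\<psi> \<in> borel_measurable lebesgue" using md by (intro measurable_completion) simp
      then show "(\<lambda>x. F x *\<^sub>R d\<psi> x) \<in> borel_measurable lebesgue" using F by simp
      show "AE x in lebesgue. U x *\<^sub>R d\<psi> x = F x *\<^sub>R d\<psi> x" using U(2) by eventually_elim simp
    qed
    also have "\<dots> = integral\<^sup>L (lebesgue_on A) (\<lambda>x. u x *\<^sub>R d\<psi> x)"
      using A' unfolding F_def by (simp add: integral_restrict_space)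
    also have "\<dots> = - integral\<^sup>L (lebesgue_on A) (\<lambda>x. \<psi> x *\<^sub>R g x)"
      by (rule is_weak_gradD[OF A' g \<psi>])
    also have "integral\<^sup>L (lebesgue_on A) (\<lambda>x. \<psi> x *\<^sub>R g x) = integral\<^sup>L (lebesgue_on A) (\<lambda>x. 0)"
    proof (rule integral_cong_AE)
      show "(\<lambda>x. \<psi> x *\<^sub>R g x) \<in> borel_measurable (lebesgue_on A)"
        using weak_grad_test_integrable(2)[OF A(3) L2_0 mg \<psi>(1)] by simp
      show "AE x in lebesgue_on A. \<psi> x *\<^sub>R g x = 0" using zero by eventually_elim simp
    qed simp
    finally show ?thesis by simp
  qed
  define Q where "Q a r k \<longleftrightarrow> 0 < r \<and> ball a r \<subseteq> A \<and> (AE x in lebesgue. x \<in> ball a r \<longrightarrow> u x = k)" for a r k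
  have Q: "\<exists>r k. Q a r k" if a: "a \<in> A" for a
  proof -
    obtain r where r: "0 < r" "cball a r \<subseteq> A" using A(1) a open_contains_cball by blast
    have "\<exists>k. AE x in lebesgue. x \<in> ball a (r / 2 / 2) \<longrightarrow> U x = k"
    proof (rule locally_constant_if_zero_grad[OF _ intU])
      show "0 < r / 2" using r(1) by simp
      fix \<psi> d\<psi> assume "C1_compact \<psi> d\<psi>" "closure {x. \<psi> x \<noteq> 0} \<subseteq> cball a (2 * (r / 2))"
      then show "integral\<^sup>L lborel (\<lambda>x. U x *\<^sub>R d\<psi> x) = 0"
        using r(2) by (intro test) auto
    qed
    then obtain k where k: "AE x in lebesgue. x \<in> ball a (r / 2 / 2) \<longrightarrow> U x = k" ..
    have sub: "ball a (r / 2 / 2) \<subseteq> A" using r by (auto simp: subset_iff)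
    have "AE x in lebesgue. x \<in> ball a (r / 2 / 2) \<longrightarrow> u x = k"
      using k U(2) by eventually_elim (use sub in \<open>auto simp: F_def\<close>)
    then have "Q a (r / 2 / 2) k" unfolding Q_def using r(1) sub by simp
    then show ?thesis by blast
  qed
  obtain R K where "\<And>a. a \<in> A \<Longrightarrow> Q a (R a) (K a)"
    using Q by metis
  then have RK: "\<And>a. a \<in> A \<Longrightarrow> 0 < R a" "\<And>a. a \<in> A \<Longrightarrow> ball a (R a) \<subseteq> A"
    "\<And>a. a \<in> A \<Longrightarrow> AE x in lebesgue. x \<in> ball a (R a) \<longrightarrow> u x = K a"
    unfolding Q_def by fast+
  have "K constant_on A"
  proof (rule locally_constant_imp_constant[OF A(2)])
    fix a assume a: "a \<in> A"
    show "\<exists>T. openin (top_of_set A) T \<and> a \<in> T \<and> (\<forall>x\<in>T. K x = K a)"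
    proof (intro exI conjI ballI)
      show "openin (top_of_set A) (ball a (R a))"
        using RK(2)[OF a] by (intro open_subset) auto
      show "a \<in> ball a (R a)" using RK(1)[OF a] by simp
      fix b assume b: "b \<in> ball a (R a)"
      then have bA: "b \<in> A" using RK(2)[OF a] by blast
      have "AE x in lebesgue. x \<in> ball a (R a) \<inter> ball b (R b) \<longrightarrow> K b = K a"
        using RK(3)[OF a] RK(3)[OF bA] by eventually_elim auto
      moreover have "b \<in> ball a (R a) \<inter> ball b (R b)" using b RK(1)[OF bA] by simp
      ultimately show "K b = K a"
        using AE_open_witness[of "ball a (R a) \<inter> ball b (R b)" "\<lambda>_. K b = K a"] by blast
    qed
  qed
  then obtain k where k: "\<And>a. a \<in> A \<Longrightarrow> K a = k" by (auto simp: constant_on_def)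
  \<comment> \<open>Uncountably many balls are involved, so their null sets cannot simply be united;
    instead, a set negligible near each of its points is negligible.\<close>
  have "negligible {x \<in> A. u x \<noteq> k}"
    unfolding locally_negligible_alt[of "{x \<in> A. u x \<noteq> k}"]
  proof
    fix a assume a: "a \<in> {x \<in> A. u x \<noteq> k}"
    then have aA: "a \<in> A" by simp
    show "\<exists>T. openin (top_of_set {x \<in> A. u x \<noteq> k}) T \<and> a \<in> T \<and> negligible T"
    proof (intro exI conjI)
      show "openin (top_of_set {x \<in> A. u x \<noteq> k}) ({x \<in> A. u x \<noteq> k} \<inter> ball a (R a))"
        by (intro openin_open_Int) simp
      show "a \<in> {x \<in> A. u x \<noteq> k} \<inter> ball a (R a)" using a RK(1)[OF aA] by simp
      have "AE x in lebesgue. x \<notin> {x \<in> A. u x \<noteq> k} \<inter> ball a (R a)"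
        using RK(3)[OF aA] by eventually_elim (use k aA in auto)
      then show "negligible ({x \<in> A. u x \<noteq> k} \<inter> ball a (R a))"
        by (rule negligible_if_AE)
    qed
  qed
  then have "{x \<in> A. u x \<noteq> k} \<in> null_sets lebesgue" by (simp add: negligible_iff_null_sets)
  then have "AE x in lebesgue. x \<notin> {x \<in> A. u x \<noteq> k}" by (rule AE_not_in)
  then have "AE x in lebesgue. x \<in> A \<longrightarrow> u x = k" by eventually_elim auto
  then show ?thesis using A' by (intro exI[of _ k]) (simp add: AE_restrict_space_iff)
qed

text \<open>The constant value times the positive measure of \<open>A\<close> is the vanishing
  integral, so the value is 0. \<open>fin_dim_space\<close> upgrades this to equality with the zero
  function.\<close>

corollary zero_mean_zero_wgrad_eq_0:
  assumes A: "open A" "connected A" "A \<in> lmeasurable" "A \<noteq> {}"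
    and M: "fin_dim_space A M" "M \<subseteq> H1 A" and u: "u \<in> zero_mean A M"
    and zero: "l2in A (wgrad A u) (wgrad A u) = 0"
  shows "u = 0"
proof -
  have A': "A \<in> sets lebesgue" using A by auto
  have uM: "u \<in> M" and mean: "integral\<^sup>L (lebesgue_on A) u = 0"
    using u by (auto simp: zero_mean_def set_integral_eq_on[OF A'])
  then have uH: "u \<in> H1 A" using M(2) by auto
  obtain k where k: "AE x in lebesgue_on A. u x = k"
    using constant_if_zero_weak_grad[OF A(1-3) H1_L2[OF uH] wgrad_is_weak_grad[OF uH]
        l2in_eq_0_imp[OF A' wgrad_L2[OF uH] zero]] by auto
  have "integral\<^sup>L (lebesgue_on A) u = integral\<^sup>L (lebesgue_on A) (\<lambda>x. k)"
    using k L2_measurable[OF H1_L2[OF uH]] by (intro integral_cong_AE) auto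
  also have "\<dots> = measure lebesgue A * k"
    using A' by (simp add: measure_restrict_space space_restrict_space)
  finally have "measure lebesgue A * k = 0" using mean by simp
  moreover have "measure lebesgue A \<noteq> 0"
    using open_not_negligible[OF A(1,4)] A(3) negligible_iff_measure by auto
  ultimately have "k = 0" by simp
  then show ?thesis using fin_dim_space_eq_0[OF A' M(1) uM] k by simp
qed

section \<open>Bi-Lipschitz changes of variables\<close>

text \<open>Any point of \<open>E\<close> in the cube is within \<open>DIM('a) * s\<close> of
  \<open>z\<close> by the sum norm, so its image lies within \<open>t = L * DIM('a) * s\<close> of
  \<open>f z\<close>, in a cube of side \<open>2 * t\<close>. Comparing volumes gives the factor; no
  sharp constant is sought.\<close>

lemma cube_Lipschitz_image:
  fixes f :: "'a::euclidean_space \<Rightarrow> 'a"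
  assumes side: "\<And>i. i \<in> Basis \<Longrightarrow> v \<bullet> i - u \<bullet> i = s" and s: "0 \<le> s" and L: "0 < L"
    and z: "z \<in> E" "z \<in> cbox u v"
    and lips: "\<And>x y. x \<in> E \<Longrightarrow> y \<in> E \<Longrightarrow> dist (f x) (f y) \<le> L * dist x y"
  shows "\<exists>W\<in>lmeasurable. f ` (E \<inter> cbox u v) \<subseteq> W \<and>
    measure lebesgue W \<le> (2 * L * DIM('a)) ^ DIM('a) * measure lebesgue (cbox u v)"
proof (intro bexI conjI)
  define t where "t = L * DIM('a) * s"
  have t: "0 \<le> t" using L s by (simp add: t_def)
  show "cbox (f z - t *\<^sub>R One) (f z + t *\<^sub>R One) \<in> lmeasurable" by simp
  show "f ` (E \<inter> cbox u v) \<subseteq> cbox (f z - t *\<^sub>R One) (f z + t *\<^sub>R One)"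
  proof clarify
    fix y assume y: "y \<in> E" "y \<in> cbox u v"
    have "norm (y - z) \<le> (\<Sum>i\<in>Basis. \<bar>(y - z) \<bullet> i\<bar>)" by (rule norm_le_l1)
    also have "\<dots> \<le> (\<Sum>i\<in>(Basis :: 'a set). s)"
    proof (rule sum_mono)
      fix i :: 'a assume i: "i \<in> Basis"
      show "\<bar>(y - z) \<bullet> i\<bar> \<le> s"
        using y(2) z(2) side[OF i] i unfolding mem_box inner_diff_left
        by (metis abs_diff_le_iff abs_le_iff diff_mono minus_diff_eq)
    qed
    finally have "L * norm (y - z) \<le> t" using L by (simp add: t_def mult.assoc)
    then have d: "norm (f y - f z) \<le> t" using lips[OF y(1) z(1)] by (simp add: dist_norm)
    have "\<bar>f y \<bullet> i - f z \<bullet> i\<bar> \<le> t" if "i \<in> Basis" for i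
      using order_trans[OF Basis_le_norm[OF that] d] by (simp add: inner_diff_left)
    then show "f y \<in> cbox (f z - t *\<^sub>R One) (f z + t *\<^sub>R One)"
      by (auto simp: mem_box inner_diff_left inner_add_left abs_le_iff algebra_simps)
  qed
  have ne: "cbox u v \<noteq> {}" using z(2) by auto
  have "measure lebesgue (cbox (f z - t *\<^sub>R One) (f z + t *\<^sub>R One)) = (\<Prod>i\<in>(Basis :: 'a set). 2 * t)"
  proof -
    have "measure lebesgue (cbox (f z - t *\<^sub>R One) (f z + t *\<^sub>R One))
      = measure lborel (cbox (f z - t *\<^sub>R One) (f z + t *\<^sub>R One))" by simp
    also have "\<dots> = (\<Prod>i\<in>(Basis :: 'a set). 2 * t)"
      using t by (subst content_cbox) (auto simp: inner_diff_left inner_add_left intro!: prod.cong)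
    finally show ?thesis .
  qed
  also have "\<dots> = (2 * L * DIM('a)) ^ DIM('a) * s ^ DIM('a)"
    by (simp add: t_def power_mult_distrib)
  also have "s ^ DIM('a) = (\<Prod>i\<in>(Basis :: 'a set). v \<bullet> i - u \<bullet> i)"
    using side by simp
  also have "\<dots> = measure lebesgue (cbox u v)"
  proof -
    have "measure lebesgue (cbox u v) = measure lborel (cbox u v)" by simp
    also have "\<dots> = (\<Prod>i\<in>(Basis :: 'a set). v \<bullet> i - u \<bullet> i)"
      by (rule content_cbox'[OF ne])
    finally show ?thesis by simp
  qed
  finally show "measure lebesgue (cbox (f z - t *\<^sub>R One) (f z + t *\<^sub>R One))
    \<le> (2 * L * DIM('a)) ^ DIM('a) * measure lebesgue (cbox u v)" by simp
qed

text \<open>Cover \<open>E\<close> by non-overlapping dyadic cubes inside an open superset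
  \<open>T\<close> of almost the same measure, each cube meeting \<open>E\<close>; apply the cube
  estimate to each and add. Boundedness places \<open>E\<close> in a fixed box, as the covering
  lemma requires.\<close>

lemma Lipschitz_image_measure_le:
  fixes f :: "'a::euclidean_space \<Rightarrow> 'a"
  assumes E: "E \<in> lmeasurable" "bounded E" and L: "0 < L"
    and lips: "\<And>x y. x \<in> E \<Longrightarrow> y \<in> E \<Longrightarrow> dist (f x) (f y) \<le> L * dist x y"
    and fE: "f ` E \<in> sets lebesgue"
  shows "measure lebesgue (f ` E) \<le> (2 * L * DIM('a)) ^ DIM('a) * measure lebesgue E"
    and "f ` E \<in> lmeasurable"
proof -
  define C where "C = (2 * L * DIM('a)) ^ DIM('a)"
  have C: "0 < C" using L by (simp add: C_def)
  obtain c where c: "0 < c" "\<And>x. x \<in> E \<Longrightarrow> norm x \<le> c"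
    using E(2) unfolding bounded_pos by auto
  have Ec: "E \<subseteq> cbox ((- c) *\<^sub>R One) (c *\<^sub>R One)"
  proof
    fix x assume "x \<in> E"
    then have "\<bar>x \<bullet> i\<bar> \<le> c" if "i \<in> Basis" for i
      using order_trans[OF Basis_le_norm[OF that] c(2)] by blast
    then show "x \<in> cbox ((- c) *\<^sub>R One) (c *\<^sub>R One)" by (simp add: mem_box abs_le_iff minus_le_iff)
  qed
  have boxne: "box ((- c) *\<^sub>R One) (c *\<^sub>R One :: 'a) \<noteq> {}"
    using c(1) by (simp add: box_ne_empty)
  have main: "f ` E \<in> lmeasurable \<and> measure lebesgue (f ` E) \<le> C * (measure lebesgue E + e)"
    if e: "0 < e" for e
  proof -
    obtain T where T: "open T" "E \<subseteq> T" "T - E \<in> lmeasurable" "emeasure lebesgue (T - E) < ennreal e"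
      using sets_lebesgue_outer_open[of E e] E(1) e by auto
    have TE: "T = E \<union> (T - E)" using T(2) by auto
    then have Tm: "T \<in> lmeasurable" using E(1) T(3) fmeasurable.Un by metis
    have "measure lebesgue (T - E) \<le> e"
      using T(3,4) e by (simp add: emeasure_eq_measure2 ennreal_less_iff)
    moreover have "measure lebesgue T \<le> measure lebesgue E + measure lebesgue (T - E)"
      using measure_Un_le[of E lebesgue "T - E"] E(1) T(3) TE by auto
    ultimately have mT: "measure lebesgue T \<le> measure lebesgue E + e" by simp
    \<comment> \<open>This gauge forces every cube tagged by a point of \<open>E\<close> to lie in
      \<open>T\<close>.\<close>
    define \<gamma> where "\<gamma> x = (if x \<in> T then T else UNIV)" for x
    have g: "gauge \<gamma>" using T(1) by (auto simp: gauge_def \<gamma>_def)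
    obtain \<D> where \<D>: "countable \<D>" "\<Union>\<D> \<subseteq> cbox ((- c) *\<^sub>R One) (c *\<^sub>R One)"
      "\<And>K. K \<in> \<D> \<Longrightarrow> interior K \<noteq> {} \<and> (\<exists>a b. K = cbox a b)"
      "pairwise (\<lambda>A B. interior A \<inter> interior B = {}) \<D>"
      "\<And>K. K \<in> \<D> \<Longrightarrow> \<exists>x\<in>E \<inter> K. K \<subseteq> \<gamma> x"
      "\<And>u v. cbox u v \<in> \<D> \<Longrightarrow> \<exists>n. \<forall>i\<in>Basis. v \<bullet> i - u \<bullet> i = ((c *\<^sub>R One) \<bullet> i - ((- c) *\<^sub>R One) \<bullet> i) / 2 ^ n"
      "E \<subseteq> \<Union>\<D>"
      by (rule covering_lemma[OF Ec boxne g]) (rule that, assumption+)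
    have KT: "K \<subseteq> T" if K: "K \<in> \<D>" for K
    proof -
      obtain x where "x \<in> E" "K \<subseteq> \<gamma> x" using \<D>(5)[OF K] by blast
      then show ?thesis using T(2) by (simp add: \<gamma>_def subsetD)
    qed
    have Kmeas: "K \<in> lmeasurable" if "K \<in> \<D>" for K
      using \<D>(3)[OF that] by auto
    have "\<exists>W\<in>lmeasurable. f ` (E \<inter> K) \<subseteq> W \<and> measure lebesgue W \<le> C * measure lebesgue K" if K: "K \<in> \<D>" for K
    proof -
      obtain u v where uv: "K = cbox u v" using \<D>(3)[OF K] by auto
      obtain m where m: "\<forall>i\<in>Basis. v \<bullet> i - u \<bullet> i = ((c *\<^sub>R One) \<bullet> i - ((- c) *\<^sub>R One) \<bullet> i) / 2 ^ m"
        using \<D>(6) K uv by blast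
      obtain z where "z \<in> E" "z \<in> cbox u v" using \<D>(5)[OF K] uv by blast
      then show ?thesis
        unfolding uv C_def using m c(1)
        by (intro cube_Lipschitz_image[where s="2 * c / 2 ^ m"]) (auto intro: L lips)
    qed
    then obtain W where W: "\<And>K. K \<in> \<D> \<Longrightarrow> W K \<in> lmeasurable" "\<And>K. K \<in> \<D> \<Longrightarrow> f ` (E \<inter> K) \<subseteq> W K"
      "\<And>K. K \<in> \<D> \<Longrightarrow> measure lebesgue (W K) \<le> C * measure lebesgue K"
      by metis
    \<comment> \<open>The interiors of the cubes are disjoint, so their measures add up to at most
      that of \<open>T\<close>. The bound is the same for all finite families and therefore carries
      over to the countable union.\<close>
    have fin: "measure lebesgue (\<Union>K\<in>F. W K) \<le> C * (measure lebesgue E + e)"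
      if F: "F \<subseteq> \<D>" "finite F" for F
    proof -
      have "measure lebesgue (\<Union>K\<in>F. W K) \<le> (\<Sum>K\<in>F. measure lebesgue (W K))"
        using F W(1) by (intro measure_UNION_le) auto
      also have "\<dots> \<le> (\<Sum>K\<in>F. C * measure lebesgue K)"
        using F W(3) by (intro sum_mono) auto
      also have "\<dots> = C * (\<Sum>K\<in>F. measure lebesgue K)" by (simp add: sum_distrib_left)
      also have "(\<Sum>K\<in>F. measure lebesgue K) = measure lebesgue (\<Union>F)"
      proof -
        have "F division_of \<Union>F"
          unfolding division_of_def
        proof (intro conjI ballI impI)
          show "K \<noteq> {}" if "K \<in> F" for K using \<D>(3)[of K] that F(1) by auto
          show "\<exists>a b. K = cbox a b" if "K \<in> F" for K using \<D>(3)[of K] that F(1) by auto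
          show "interior K1 \<inter> interior K2 = {}" if "K1 \<in> F" "K2 \<in> F" "K1 \<noteq> K2" for K1 K2
            using \<D>(4) that F(1) unfolding pairwise_def by blast
        qed (use F(2) in auto)
        then show ?thesis by (rule content_division)
      qed
      also have "measure lebesgue (\<Union>F) \<le> measure lebesgue T"
        using F KT Kmeas Tm by (intro measure_mono_fmeasurable) (auto intro!: sets.finite_Union)
      also note mT
      finally show ?thesis using C by simp
    qed
    have UN: "(\<Union>K\<in>\<D>. W K) \<in> lmeasurable" "measure lebesgue (\<Union>K\<in>\<D>. W K) \<le> C * (measure lebesgue E + e)"
      using fmeasurable_UN_bound[OF \<D>(1) W(1) fin] measure_UN_bound[OF \<D>(1) W(1) fin] by auto
    have sub: "f ` E \<subseteq> (\<Union>K\<in>\<D>. W K)"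
      using \<D>(7) W(2) by blast
    have "f ` E \<in> lmeasurable" using fmeasurableI2[OF UN(1) sub fE] .
    moreover have "measure lebesgue (f ` E) \<le> measure lebesgue (\<Union>K\<in>\<D>. W K)"
      by (rule measure_mono_fmeasurable[OF sub fE UN(1)])
    ultimately show ?thesis using UN(2) by simp
  qed
  show "f ` E \<in> lmeasurable" using main[of 1] by simp
  have "measure lebesgue (f ` E) \<le> C * measure lebesgue E"
  proof (rule field_le_epsilon)
    fix e :: real assume "0 < e"
    then show "measure lebesgue (f ` E) \<le> C * measure lebesgue E + e"
      using main[of "e / C"] C by (simp add: distrib_left)
  qed
  then show "measure lebesgue (f ` E) \<le> (2 * L * DIM('a)) ^ DIM('a) * measure lebesgue E"
    by (simp add: C_def)
qed

lemma nn_integral_le_if_emeasure_le: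
  assumes sets: "sets M = sets N" and g: "g \<in> borel_measurable N"
    and le: "\<And>X. X \<in> sets N \<Longrightarrow> emeasure M X \<le> ennreal C * emeasure N X"
  shows "(\<integral>\<^sup>+x. g x \<partial>M) \<le> ennreal C * (\<integral>\<^sup>+x. g x \<partial>N)"
proof -
  have "M \<le> scale_measure (ennreal C) N"
    using sets le by (subst le_measure) simp_all
  then have "(\<integral>\<^sup>+x. g x \<partial>M) \<le> (\<integral>\<^sup>+x. g x \<partial>scale_measure (ennreal C) N)"
    by (intro nn_integral_mono_measure) (simp_all add: sets)
  also have "\<dots> = ennreal C * (\<integral>\<^sup>+x. g x \<partial>N)"
    using g by (simp add: nn_integral_scale_measure)
  finally show ?thesis .
qed

text \<open>A preimage under \<open>Y\<close> is an image under its Lipschitz inverse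
  \<open>Z\<close>, so the image measure of Lebesgue measure on \<open>A\<close> is at most
  \<open>C\<close> times Lebesgue measure on \<open>B\<close>. This bounds the integral of the
  square, and it makes preimages of null sets null, which yields measurability of
  \<open>g (Y x)\<close> for a merely Lebesgue measurable \<open>g\<close>.\<close>

proposition L2_compose_bi_Lipschitz:
  fixes Y :: "'a::euclidean_space \<Rightarrow> 'a" and g :: "'a \<Rightarrow> 'b::euclidean_space"
  assumes A: "open A" "bounded A" and B: "open B" "bounded B" and L: "0 < L"
    and Y: "Y ` A \<subseteq> B"
    and lips: "\<And>x y. x \<in> A \<Longrightarrow> y \<in> A \<Longrightarrow> dist (Y x) (Y y) \<le> L * dist x y"
      "\<And>x y. x \<in> A \<Longrightarrow> y \<in> A \<Longrightarrow> dist x y \<le> L * dist (Y x) (Y y)"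
    and g: "g \<in> L2 B"
  shows "(\<lambda>x. g (Y x)) \<in> L2 A"
proof -
  have A': "A \<in> lmeasurable" "A \<in> sets lebesgue" and B': "B \<in> lmeasurable" "B \<in> sets lebesgue"
    using A B by (auto simp: lmeasurable_open)
  define C where "C = (2 * L * DIM('a)) ^ DIM('a)"
  have contY: "continuous_on A Y"
  proof (rule continuous_onI)
    fix x e assume x: "x \<in> A" and e: "0 < (e::real)"
    show "\<exists>d>0. \<forall>x'\<in>A. dist x' x < d \<longrightarrow> dist (Y x') (Y x) \<le> e"
      using lips(1)[OF _ x] L e
      by (intro exI[of _ "e / L"]) (auto simp: pos_less_divide_eq mult.commute intro: order_trans less_imp_le)
  qed
  have injY: "inj_on Y A"
    using lips(2) by (intro inj_onI) force
  define Z where "Z = inv_into A Y"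
  have ZY: "Z (Y x) = x" if "x \<in> A" for x using that injY by (simp add: Z_def)
  have Zlips: "dist (Z x) (Z y) \<le> L * dist x y" if "x \<in> Y ` A" "y \<in> Y ` A" for x y
    using that lips(2) by (auto simp: ZY)
  have mY: "Y \<in> lebesgue_on A \<rightarrow>\<^sub>M borel"
    using continuous_imp_measurable_on_sets_lebesgue[OF contY A'(2)] by simp
  have bound: "emeasure (lebesgue_on A) (Y -` X \<inter> A) \<le> ennreal C * emeasure lborel (X \<inter> B)"
    if X: "X \<in> sets borel" for X
  proof -
    have pre: "Y -` X \<inter> A \<in> sets (lebesgue_on A)"
      using measurable_sets[OF mY X] by simp
    define E where "E = X \<inter> Y ` A"
    \<comment> \<open>An open set is a countable union of compact sets, and their continuous images
      are compact.\<close>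
    have YAm: "Y ` A \<in> sets lebesgue"
    proof -
      obtain F where F: "\<And>n :: nat. compact (F n)" "(\<Union>n. F n) = A"
        using open_Union_compact_subsets[OF A(1)] by metis
      have "Y ` A = (\<Union>n. Y ` F n)" using F(2) by blast
      moreover have "compact (Y ` F n)" for n
        using F contY by (intro compact_continuous_image) (auto intro: continuous_on_subset)
      then have "Y ` F n \<in> sets lebesgue" for n by (simp add: lmeasurable_compact fmeasurableD)
      ultimately show ?thesis by simp
    qed
    moreover have "X \<in> sets lebesgue" using X by simp
    ultimately have Em: "E \<in> sets lebesgue" unfolding E_def by (intro sets.Int)
    have EB: "E \<subseteq> X \<inter> B" using Y by (auto simp: E_def)
    have E1: "E \<in> lmeasurable"
      using fmeasurableI2[OF B'(1) _ Em] EB by auto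
    have E2: "bounded E" using B(2) EB bounded_subset by blast
    have ZE: "Z ` E = Y -` X \<inter> A" by (force simp: E_def ZY image_iff)
    have "Z ` E \<in> sets lebesgue"
      unfolding ZE using pre A'(2) by (simp add: sets_restrict_space_iff)
    moreover have "dist (Z x) (Z y) \<le> L * dist x y" if "x \<in> E" "y \<in> E" for x y
      using that by (intro Zlips) (simp_all add: E_def)
    ultimately have "measure lebesgue (Z ` E) \<le> C * measure lebesgue E" "Z ` E \<in> lmeasurable"
      unfolding C_def by (intro Lipschitz_image_measure_le[OF E1 E2 L]; simp)+
    moreover have "0 \<le> C" using L by (simp add: C_def)
    ultimately have "emeasure lebesgue (Z ` E) \<le> ennreal C * emeasure lebesgue E"
      using E1 by (simp add: emeasure_eq_measure2 ennreal_mult[symmetric] ennreal_leI)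
    also have "emeasure lebesgue E \<le> emeasure lebesgue (X \<inter> B)"
      using EB X B' by (intro emeasure_mono) auto
    also have "\<dots> = emeasure lborel (X \<inter> B)" using X B(1) by simp
    finally show ?thesis
      using A'(2) pre unfolding ZE by (simp add: emeasure_restrict_space mult_left_mono)
  qed
  have pre_null: "AE x in lebesgue_on A. P (Y x)" if P: "AE y in lebesgue. y \<in> B \<longrightarrow> P y" for P
  proof -
    have "AE y in lborel. y \<in> B \<longrightarrow> P y" using P by (simp add: AE_completion_iff)
    then obtain X where X: "X \<in> null_sets lborel" "{y \<in> space lborel. \<not> (y \<in> B \<longrightarrow> P y)} \<subseteq> X"
      unfolding eventually_ae_filter by (elim bexE)
    have Xb: "X \<in> sets borel" using X(1) by auto
    have "emeasure lborel (X \<inter> B) = 0"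
      using X(1) B(1) by (intro null_setsD1 null_set_Int2) simp_all
    then have "emeasure (lebesgue_on A) (Y -` X \<inter> A) = 0"
      using bound[OF Xb] by simp
    moreover have "Y -` X \<inter> A \<in> sets (lebesgue_on A)"
      using measurable_sets[OF mY Xb] by simp
    ultimately have "AE x in lebesgue_on A. x \<notin> Y -` X \<inter> A"
      by (intro AE_not_in null_setsI)
    then show ?thesis
    proof (rule AE_mp, intro AE_I2 impI)
      fix x assume "x \<in> space (lebesgue_on A)" "x \<notin> Y -` X \<inter> A"
      then show "P (Y x)" using X(2) Y by auto
    qed
  qed
  define G where "G y = indicat_real B y *\<^sub>R g y" for y
  have "G \<in> borel_measurable lebesgue"
    unfolding G_def using L2_measurable[OF g] B'(2) by (simp add: borel_measurable_restrict_space_iff)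
  \<comment> \<open>The integral estimate is carried out for a Borel version, for which the image
    measure formula is available, and returned to \<open>g\<close> through the null-set transfer
    \<open>pre_null\<close>.\<close>
  then obtain g' where g': "g' \<in> borel_measurable borel" "AE y in lebesgue. G y = g' y"
    using lebesgue_borel_version by metis
  have ae: "AE y in lebesgue. y \<in> B \<longrightarrow> g y = g' y"
    using g'(2) by eventually_elim (auto simp: G_def)
  then have aeY: "AE x in lebesgue_on A. g (Y x) = g' (Y x)" by (rule pre_null)
  have mg'Y: "(\<lambda>x. g' (Y x)) \<in> borel_measurable (lebesgue_on A)"
    using measurable_compose[OF mY g'(1)] .
  have mgY: "(\<lambda>x. g (Y x)) \<in> borel_measurable (lebesgue_on A)"
  proof -
    have "AE x in lebesgue. x \<in> A \<longrightarrow> g (Y x) = g' (Y x)"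
      using aeY A'(2) by (simp add: AE_restrict_space_iff)
    then have "AE x in lebesgue. indicat_real A x *\<^sub>R g' (Y x) = indicat_real A x *\<^sub>R g (Y x)"
      by eventually_elim (auto simp: indicator_def)
    moreover have "(\<lambda>x. indicat_real A x *\<^sub>R g' (Y x)) \<in> borel_measurable lebesgue"
      using mg'Y A'(2) by (simp add: borel_measurable_restrict_space_iff)
    ultimately have "(\<lambda>x. indicat_real A x *\<^sub>R g (Y x)) \<in> borel_measurable lebesgue"
      by (rule borel_measurable_AE[rotated])
    then show ?thesis using A'(2) by (simp add: borel_measurable_restrict_space_iff)
  qed
  have "integrable (lebesgue_on A) (\<lambda>x. (norm (g' (Y x)))\<^sup>2)"
  proof (rule integrableI_bounded)
    show "(\<lambda>x. (norm (g' (Y x)))\<^sup>2) \<in> borel_measurable (lebesgue_on A)" using mg'Y by measurable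
    define M where "M = distr (lebesgue_on A) borel Y"
    have "(\<integral>\<^sup>+x. ennreal (norm ((norm (g' (Y x)))\<^sup>2)) \<partial>lebesgue_on A) = (\<integral>\<^sup>+y. ennreal ((norm (g' y))\<^sup>2) \<partial>M)"
      unfolding M_def using mY g'(1) by (subst nn_integral_distr) auto
    also have "\<dots> \<le> ennreal C * (\<integral>\<^sup>+y. ennreal ((norm (g' y))\<^sup>2) \<partial>density lborel (indicator B))"
    proof (rule nn_integral_le_if_emeasure_le)
      show "sets M = sets (density lborel (indicator B))" by (simp add: M_def)
      show "(\<lambda>y. ennreal ((norm (g' y))\<^sup>2)) \<in> borel_measurable (density lborel (indicator B))"
        using g'(1) by simp
      fix X assume "X \<in> sets (density lborel (indicator B))"
      then have X: "X \<in> sets borel" by simp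
      have "emeasure (density lborel (indicator B)) X = emeasure lborel (X \<inter> B)"
        using X B(1) by (subst emeasure_density) (auto simp: indicator_inter_arith[symmetric] Int_commute)
      then show "emeasure M X \<le> ennreal C * emeasure (density lborel (indicator B)) X"
        using bound[OF X] X mY by (simp add: M_def emeasure_distr)
    qed
    also have "(\<integral>\<^sup>+y. ennreal ((norm (g' y))\<^sup>2) \<partial>density lborel (indicator B))
      = (\<integral>\<^sup>+y. indicator B y * ennreal ((norm (g' y))\<^sup>2) \<partial>lborel)"
      using g'(1) B(1) by (subst nn_integral_density) auto
    also have "\<dots> = (\<integral>\<^sup>+y. indicator B y * ennreal ((norm (g' y))\<^sup>2) \<partial>lebesgue)"
      by (rule nn_integral_completion[symmetric])
    also have "\<dots> = (\<integral>\<^sup>+y. indicator B y * ennreal ((norm (g y))\<^sup>2) \<partial>lebesgue)"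
      using ae by (intro nn_integral_cong_AE, eventually_elim) (auto simp: indicator_def)
    also have "\<dots> = (\<integral>\<^sup>+y. ennreal ((norm (g y))\<^sup>2) \<partial>lebesgue_on B)"
      using B'(2) by (subst nn_integral_restrict_space) (auto simp: mult.commute)
    finally have "(\<integral>\<^sup>+x. ennreal (norm ((norm (g' (Y x)))\<^sup>2)) \<partial>lebesgue_on A)
      \<le> ennreal C * (\<integral>\<^sup>+y. ennreal ((norm (g y))\<^sup>2) \<partial>lebesgue_on B)" .
    moreover have "(\<integral>\<^sup>+y. ennreal ((norm (g y))\<^sup>2) \<partial>lebesgue_on B) < top"
      using g by (simp add: L2_iff[OF B'(2)] integrable_iff_bounded)
    then have "ennreal C * (\<integral>\<^sup>+y. ennreal ((norm (g y))\<^sup>2) \<partial>lebesgue_on B) < top"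
      by (simp add: ennreal_mult_less_top)
    ultimately show "(\<integral>\<^sup>+x. ennreal (norm ((norm (g' (Y x)))\<^sup>2)) \<partial>lebesgue_on A) < \<infinity>"
      by (simp add: order_le_less_trans)
  qed
  then have "(\<lambda>x. g' (Y x)) \<in> L2 A" using mg'Y by (simp add: L2_iff[OF A'(2)])
  then show ?thesis using mgY aeY by (rule L2_cong_AE[OF A'(2)])
qed

section \<open>Measurability and bounds for the Jacobians of the reference maps\<close>

lemma borel_measurable_lebesgue_on_AE:
  fixes f g :: "'a::euclidean_space \<Rightarrow> 'b::euclidean_space"
  assumes A: "A \<in> sets lebesgue" and f: "f \<in> borel_measurable (lebesgue_on A)"
    and ae: "AE x in lebesgue_on A. f x = g x"
  shows "g \<in> borel_measurable (lebesgue_on A)"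
proof -
  have "AE x in lebesgue. x \<in> A \<longrightarrow> f x = g x"
    using ae A by (simp add: AE_restrict_space_iff)
  then have "AE x in lebesgue. indicat_real A x *\<^sub>R f x = indicat_real A x *\<^sub>R g x"
    by eventually_elim (auto simp: indicator_def)
  moreover have "(\<lambda>x. indicat_real A x *\<^sub>R f x) \<in> borel_measurable lebesgue"
    using f A by (simp add: borel_measurable_restrict_space_iff)
  ultimately have "(\<lambda>x. indicat_real A x *\<^sub>R g x) \<in> borel_measurable lebesgue"
    by (rule borel_measurable_AE[rotated])
  then show ?thesis using A by (simp add: borel_measurable_restrict_space_iff)
qed

lemma borel_measurable_if_continuous_on_AE_open:
  fixes f :: "'a::euclidean_space \<Rightarrow> 'b::euclidean_space"
  assumes A: "A \<in> sets lebesgue" and U: "open U" "continuous_on U f"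
    and ae: "AE x in lebesgue_on A. x \<in> U"
  shows "f \<in> borel_measurable (lebesgue_on A)"
proof (rule borel_measurable_lebesgue_on_AE[OF A])
  have "(\<lambda>x. indicat_real U x *\<^sub>R f x) \<in> borel_measurable borel"
    using U by (intro borel_measurable_continuous_on_indicator) auto
  then have "(\<lambda>x. indicat_real U x *\<^sub>R f x) \<in> borel_measurable lebesgue"
    by (intro measurable_completion) simp
  then show "(\<lambda>x. indicat_real U x *\<^sub>R f x) \<in> borel_measurable (lebesgue_on A)"
    by (rule measurable_restrict_space1)
  show "AE x in lebesgue_on A. indicat_real U x *\<^sub>R f x = f x"
    using ae by eventually_elim simp
qed

lemma borel_measurable_matrix_entry:
  fixes F :: "'a \<Rightarrow> real ^ 'n::finite ^ 'm::finite"
  assumes "F \<in> borel_measurable M"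
  shows "(\<lambda>x. F x $ i $ j) \<in> borel_measurable M"
proof -
  have "continuous_on UNIV (\<lambda>A :: real ^ 'n ^ 'm. A $ i $ j)" by (intro continuous_intros)
  from measurable_compose[OF assms borel_measurable_continuous_onI[OF this]] show ?thesis .
qed

lemma borel_measurable_vec_nth:
  fixes v :: "'a \<Rightarrow> real ^ 'n::finite"
  assumes "v \<in> borel_measurable M"
  shows "(\<lambda>x. v x $ i) \<in> borel_measurable M"
proof -
  have "continuous_on UNIV (\<lambda>v :: real ^ 'n. v $ i)" by (intro continuous_intros)
  from measurable_compose[OF assms borel_measurable_continuous_onI[OF this]] show ?thesis .
qed

lemma borel_measurable_vecI:
  fixes v :: "'a \<Rightarrow> real ^ 'n::finite"
  assumes "\<And>i. (\<lambda>x. v x $ i) \<in> borel_measurable M"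
  shows "v \<in> borel_measurable M"
  unfolding borel_measurable_euclidean_space[of v]
proof
  fix b :: "real ^ 'n" assume "b \<in> Basis"
  then obtain i where "b = axis i 1" by (auto simp: Basis_vec_def)
  then show "(\<lambda>x. v x \<bullet> b) \<in> borel_measurable M" using assms[of i] by (simp add: inner_axis)
qed

lemma borel_measurable_det:
  fixes F :: "'a \<Rightarrow> real ^ 'n::finite ^ 'n"
  assumes "\<And>i j. (\<lambda>x. F x $ i $ j) \<in> borel_measurable M"
  shows "(\<lambda>x. det (F x)) \<in> borel_measurable M"
  unfolding det_def
  using assms by (intro borel_measurable_sum borel_measurable_times borel_measurable_prod borel_measurable_const)

text \<open>Each entry is a component of the image of a unit vector, hence at most \<open>L\<close>
  in absolute value; the Leibniz formula has one product of entries per permutation.\<close>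

lemma abs_det_le:
  fixes F :: "real ^ 'n::finite ^ 'n" and L :: real
  assumes "\<And>v. norm (F *v v) \<le> L * norm v"
  shows "\<bar>det F\<bar> \<le> card {p. p permutes (UNIV :: 'n set)} * L ^ CARD('n)"
proof -
  have entry: "\<bar>F $ i $ j\<bar> \<le> L" for i j
  proof -
    have "F $ i $ j = (F *v axis j 1) $ i"
      by (simp add: matrix_vector_mult_basis column_def)
    also have "\<bar>\<dots>\<bar> \<le> norm (F *v axis j 1)" by (rule component_le_norm_cart)
    also have "\<dots> \<le> L" using assms[of "axis j 1"] by simp
    finally show ?thesis .
  qed
  have "\<bar>det F\<bar> \<le> (\<Sum>p\<in>{p. p permutes (UNIV :: 'n set)}. \<bar>of_int (sign p) * (\<Prod>i\<in>UNIV. F $ i $ p i)\<bar>)"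
    unfolding det_def by (rule sum_abs)
  also have "\<dots> \<le> (\<Sum>p\<in>{p. p permutes (UNIV :: 'n set)}. L ^ CARD('n))"
  proof (rule sum_mono)
    fix p :: "'n \<Rightarrow> 'n"
    have "\<bar>of_int (sign p) * (\<Prod>i\<in>UNIV. F $ i $ p i)\<bar> = (\<Prod>i\<in>UNIV. \<bar>F $ i $ p i\<bar>)"
      by (simp add: abs_mult sign_def abs_prod)
    also have "\<dots> \<le> (\<Prod>i\<in>(UNIV :: 'n set). L)"
      using entry by (intro prod_mono) auto
    finally show "\<bar>of_int (sign p) * (\<Prod>i\<in>UNIV. F $ i $ p i)\<bar> \<le> L ^ CARD('n)" by simp
  qed
  finally show ?thesis by simp
qed

text \<open>Difference quotients along \<open>x + t *\<^sub>R v\<close> obey both Lipschitz bounds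
  as soon as the point is in \<open>S\<close>, and they converge to the derivative in direction
  \<open>v\<close>; non-strict inequalities survive the limit.\<close>

lemma jacobian_bi_Lipschitz:
  fixes X :: "real ^ 'd::finite \<Rightarrow> real ^ 'd"
  assumes S: "open S" "x \<in> S" and X: "X differentiable (at x)"
    and lips: "\<And>y. y \<in> S \<Longrightarrow> dist (X y) (X x) \<le> L * dist y x"
      "\<And>y. y \<in> S \<Longrightarrow> dist y x \<le> L * dist (X y) (X x)"
  shows "norm (jacobian X (at x) *v v) \<le> L * norm v"
    and "norm v \<le> L * norm (jacobian X (at x) *v v)"
proof -
  define D where "D = (\<lambda>v. jacobian X (at x) *v v)"
  have "(X has_derivative D) (at (x + 0 *\<^sub>R v))"
    using X unfolding D_def by (simp add: jacobian_works)
  moreover have "((\<lambda>t. x + t *\<^sub>R v) has_derivative (\<lambda>t. t *\<^sub>R v)) (at (0::real))"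
    by (auto intro!: derivative_eq_intros)
  ultimately have "((\<lambda>t. X (x + t *\<^sub>R v)) has_derivative (\<lambda>t. D (t *\<^sub>R v))) (at (0::real))"
    by (rule has_derivative_compose[rotated])
  moreover have "(\<lambda>t. D (t *\<^sub>R v)) = (\<lambda>t. t *\<^sub>R D v)"
    by (simp add: D_def matrix_vector_mult_scaleR)
  ultimately have "((\<lambda>t. X (x + t *\<^sub>R v)) has_derivative (\<lambda>t. t *\<^sub>R D v)) (at 0)"
    by simp
  then have quot: "((\<lambda>t. norm (X (x + t *\<^sub>R v) - X x - t *\<^sub>R D v) / norm t) \<longlongrightarrow> 0) (at 0)"
    by (simp add: has_derivative_at)
  have "((\<lambda>t. norm ((X (x + t *\<^sub>R v) - X x) /\<^sub>R t - D v)) \<longlongrightarrow> 0) (at 0)"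
  proof (rule Lim_transform_eventually[OF quot])
    have "\<forall>\<^sub>F t in at (0::real). t \<noteq> 0" by (simp add: eventually_at_filter)
    then show "\<forall>\<^sub>F t in at 0. norm (X (x + t *\<^sub>R v) - X x - t *\<^sub>R D v) / norm t
      = norm ((X (x + t *\<^sub>R v) - X x) /\<^sub>R t - D v)"
    proof eventually_elim
      case (elim t)
      then have "(X (x + t *\<^sub>R v) - X x) /\<^sub>R t - D v = (X (x + t *\<^sub>R v) - X x - t *\<^sub>R D v) /\<^sub>R t"
        by (simp add: scaleR_diff_right)
      then show ?case by (simp add: divide_inverse mult.commute)
    qed
  qed
  then have "((\<lambda>t. (X (x + t *\<^sub>R v) - X x) /\<^sub>R t) \<longlongrightarrow> D v) (at 0)"
    by (rule LIM_zero_cancel[OF tendsto_norm_zero_cancel])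
  then have lim: "((\<lambda>t. norm ((X (x + t *\<^sub>R v) - X x) /\<^sub>R t)) \<longlongrightarrow> norm (D v)) (at 0)"
    by (rule tendsto_norm)
  have "((\<lambda>t. x + t *\<^sub>R v) \<longlongrightarrow> x + 0 *\<^sub>R v) (at (0::real))" by (intro tendsto_intros)
  then have "\<forall>\<^sub>F t in at (0::real). x + t *\<^sub>R v \<in> S"
    using S by (auto dest: topological_tendstoD)
  moreover have "\<forall>\<^sub>F t in at (0::real). t \<noteq> 0" by (simp add: eventually_at_filter)
  ultimately have ev: "\<forall>\<^sub>F t in at (0::real). x + t *\<^sub>R v \<in> S \<and> t \<noteq> 0" by eventually_elim simp
  have "\<forall>\<^sub>F t in at (0::real). norm ((X (x + t *\<^sub>R v) - X x) /\<^sub>R t) \<le> L * norm v"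
    using ev
  proof eventually_elim
    case (elim t)
    then have "norm (X (x + t *\<^sub>R v) - X x) \<le> L * norm v * \<bar>t\<bar>"
      using lips(1)[of "x + t *\<^sub>R v"] by (simp add: dist_norm mult_ac)
    then show ?case using elim by (simp add: divide_inverse[symmetric] pos_divide_le_eq mult.commute[of "inverse \<bar>t\<bar>"])
  qed
  then show "norm (jacobian X (at x) *v v) \<le> L * norm v"
    using tendsto_upperbound[OF lim] by (simp add: D_def)
  have "\<forall>\<^sub>F t in at (0::real). norm v \<le> L * norm ((X (x + t *\<^sub>R v) - X x) /\<^sub>R t)"
    using ev
  proof eventually_elim
    case (elim t)
    then have "norm v * \<bar>t\<bar> \<le> L * norm (X (x + t *\<^sub>R v) - X x)"
      using lips(2)[of "x + t *\<^sub>R v"] by (simp add: dist_norm mult_ac)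
    then have "norm v \<le> L * norm (X (x + t *\<^sub>R v) - X x) / \<bar>t\<bar>" using elim by (simp add: pos_le_divide_eq)
    then show ?case by (simp add: divide_inverse mult_ac)
  qed
  then show "norm v \<le> L * norm (jacobian X (at x) *v v)"
    using tendsto_lowerbound[OF tendsto_mult_left[OF lim]] by (simp add: D_def)
qed

lemma matrix_inv_mult:
  fixes F :: "real ^ 'n::finite ^ 'n"
  assumes "det F \<noteq> 0"
  shows "F ** matrix_inv F = mat 1" and "matrix_inv F ** F = mat 1"
proof -
  have "\<exists>G. F ** G = mat 1 \<and> G ** F = mat 1"
    using assms by (simp add: invertible_det_nz[symmetric] invertible_def)
  then have "F ** matrix_inv F = mat 1 \<and> matrix_inv F ** F = mat 1"
    unfolding matrix_inv_def by (rule someI_ex)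
  then show "F ** matrix_inv F = mat 1" and "matrix_inv F ** F = mat 1" by auto
qed

lemma matrix_inv_mult_norm_le:
  fixes F :: "real ^ 'n::finite ^ 'n" and L :: real
  assumes "det F \<noteq> 0" and "\<And>v. norm v \<le> L * norm (F *v v)"
  shows "norm (matrix_inv F *v w) \<le> L * norm w"
proof -
  have "F *v (matrix_inv F *v w) = w"
    using matrix_inv_mult(1)[OF assms(1)] by (simp add: matrix_vector_mul_assoc)
  then show ?thesis using assms(2)[of "matrix_inv F *v w"] by simp
qed

text \<open>This is \<open>abs_det_le\<close> for the inverse matrix, whose norm bound is again
  \<open>L\<close> by \<open>assms(2)\<close>. The product form expresses a lower bound on the
  determinant without division.\<close>

lemma det_ge:
  fixes F :: "real ^ 'n::finite ^ 'n" and L :: real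
  assumes "0 < det F" and "\<And>v. norm v \<le> L * norm (F *v v)"
  shows "1 \<le> det F * (card {p. p permutes (UNIV :: 'n set)} * L ^ CARD('n))"
proof -
  have nz: "det F \<noteq> 0" using assms(1) by simp
  have "det F * det (matrix_inv F) = 1"
    using matrix_inv_mult(1)[OF nz] by (simp add: det_mul[symmetric])
  moreover have "det (matrix_inv F) \<le> card {p. p permutes (UNIV :: 'n set)} * L ^ CARD('n)"
    using abs_det_le[OF matrix_inv_mult_norm_le[OF nz assms(2)]] by linarith
  ultimately show ?thesis
    using mult_left_mono[of "det (matrix_inv F)" _ "det F"] assms(1) by fastforce
qed

text \<open>Serves measurability: \<open>matrix_inv\<close> is defined by choice, whereas Cramer's
  determinants are polynomials in the entries of \<open>F\<close> and \<open>w\<close>.\<close>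

lemma matrix_inv_mult_eq_cramer:
  fixes F :: "real ^ 'n::finite ^ 'n"
  assumes "det F \<noteq> 0"
  shows "det F *\<^sub>R (matrix_inv F *v w) = (\<chi> k. det (\<chi> i j. if j = k then w $ i else F $ i $ j))"
proof -
  have "F *v (matrix_inv F *v w) = w"
    using matrix_inv_mult(1)[OF assms] by (simp add: matrix_vector_mul_assoc)
  then have "matrix_inv F *v w = (\<chi> k. det (\<chi> i j. if j = k then w $ i else F $ i $ j) / det F)"
    using cramer[OF assms] by blast
  then show ?thesis using assms by (simp add: vec_eq_iff)
qed

lemma polyhedral_domainD:
  assumes "polyhedral_domain A"
  shows "open A" "connected A" "bounded A" "A \<noteq> {}" "A \<in> lmeasurable" "A \<in> sets lebesgue"
    "interior (closure A) = A"
  using assms unfolding polyhedral_domain_def by (auto simp: lmeasurable_open)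

text \<open>The reference maps are assumed differentiable only inside cells. A cell is convex, so
  its frontier is null, and there are finitely many cells.\<close>

lemma mesh_of_AE_interior:
  assumes "mesh_of A \<T>" "A \<in> sets lebesgue"
  shows "AE x in lebesgue_on A. x \<in> (\<Union>T\<in>\<T>. interior T)"
proof -
  have fin: "finite \<T>" and simp: "\<And>T. T \<in> \<T> \<Longrightarrow> int CARD('a) simplex T" and cov: "\<Union>\<T> = closure A"
    using assms(1) by (auto simp: mesh_of_def triangulation_def)
  have poly: "polytope T" if "T \<in> \<T>" for T
    using simplex_imp_polytope[OF simp[OF that]] .
  have "negligible (\<Union>T\<in>\<T>. frontier T)"
    using fin poly by (intro negligible_Union) (auto intro: negligible_convex_frontier polytope_imp_convex)
  then have "(\<Union>T\<in>\<T>. frontier T) \<in> null_sets lebesgue" by (simp add: negligible_iff_null_sets)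
  then have "AE x in lebesgue. x \<notin> (\<Union>T\<in>\<T>. frontier T)" by (rule AE_not_in)
  then have "AE x in lebesgue. x \<in> A \<longrightarrow> x \<in> (\<Union>T\<in>\<T>. interior T)"
  proof eventually_elim
    case (elim x)
    show ?case
    proof
      assume "x \<in> A"
      then obtain T where T: "T \<in> \<T>" "x \<in> T" using cov closure_subset by blast
      then have "x \<notin> frontier T" using elim by blast
      then have "x \<in> interior T" using T(2) closure_subset[of T] by (auto simp: frontier_def)
      with T(1) show "x \<in> (\<Union>T\<in>\<T>. interior T)" by blast
    qed
  qed
  then show ?thesis using assms(2) by (simp add: AE_restrict_space_iff)
qed

text \<open>A cell lies in the closure of \<open>A\<close>; its interior stays in \<open>A\<close>
  because the domain has no slits, that is, \<open>interior (closure A) = A\<close>.\<close>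

lemma mesh_of_interior_subset:
  assumes "mesh_of A \<T>" "polyhedral_domain A" "T \<in> \<T>"
  shows "interior T \<subseteq> A"
proof -
  have "interior T \<subseteq> interior (closure A)"
    using assms(1,3) by (intro interior_mono) (auto simp: mesh_of_def)
  then show ?thesis using polyhedral_domainD(7)[OF assms(2)] by simp
qed

section \<open>Square integrability of the transferred fields\<close>

lemma ale_admissibleD:
  assumes "ale_admissible d m Ls"
  shows "polyhedral_domain (RefDom d m)" "mesh_of (RefDom d m) (RefMesh d m)"
    "fin_dim_space (RefDom d m) (RefSh d m)" "RefSh d m \<subseteq> H1 (RefDom d m)"
    "\<And>l. l \<in> Ls \<Longrightarrow> Xmap d m l ` RefDom d m = Omega d"
    "\<And>l T. l \<in> Ls \<Longrightarrow> T \<in> RefMesh d m \<Longrightarrow> continuous_on (interior T) (Fmat d m l)"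
    "\<And>l T x. l \<in> Ls \<Longrightarrow> T \<in> RefMesh d m \<Longrightarrow> x \<in> interior T \<Longrightarrow> Xmap d m l differentiable at x"
    "\<And>l T x. l \<in> Ls \<Longrightarrow> T \<in> RefMesh d m \<Longrightarrow> x \<in> interior T \<Longrightarrow> 0 < Jdet d m l x"
  using assms unfolding ale_admissible_def by simp_all

lemma ale_Lipschitz:
  assumes "ale_admissible d m Ls"
  obtains L where "0 < L"
    "\<And>l x y. l \<in> Ls \<Longrightarrow> x \<in> RefDom d m \<Longrightarrow> y \<in> RefDom d m \<Longrightarrow>
      dist (Xmap d m l x) (Xmap d m l y) \<le> L * dist x y"
    "\<And>l x y. l \<in> Ls \<Longrightarrow> x \<in> RefDom d m \<Longrightarrow> y \<in> RefDom d m \<Longrightarrow>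
      dist x y \<le> L * dist (Xmap d m l x) (Xmap d m l y)"
proof -
  obtain L where "0 < L" "\<forall>l\<in>Ls. \<forall>x\<in>closure (RefDom d m). \<forall>y\<in>closure (RefDom d m).
       dist (Xmap d m l x) (Xmap d m l y) \<le> L * dist x y \<and>
       dist x y \<le> L * dist (Xmap d m l x) (Xmap d m l y)"
    using assms unfolding ale_admissible_def by (elim conjE exE)
  then show ?thesis
    using closure_subset[of "RefDom d m"] by (intro that[of L]) (blast+)
qed

lemma ale_compose_L2:
  fixes d :: "('d::finite) scheme" and g :: "real ^ 'd \<Rightarrow> 'b::euclidean_space"
  assumes ale: "ale_admissible d m Ls" and l: "l \<in> Ls" and Om: "polyhedral_domain (Omega d)"
    and g: "g \<in> L2 (Omega d)"
  shows "(\<lambda>x. g (Xmap d m l x)) \<in> L2 (RefDom d m)"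
proof -
  obtain L where L: "0 < L"
    "\<And>l x y. l \<in> Ls \<Longrightarrow> x \<in> RefDom d m \<Longrightarrow> y \<in> RefDom d m \<Longrightarrow>
      dist (Xmap d m l x) (Xmap d m l y) \<le> L * dist x y"
    "\<And>l x y. l \<in> Ls \<Longrightarrow> x \<in> RefDom d m \<Longrightarrow> y \<in> RefDom d m \<Longrightarrow>
      dist x y \<le> L * dist (Xmap d m l x) (Xmap d m l y)"
    using ale_Lipschitz[OF ale] by metis
  note R = polyhedral_domainD[OF ale_admissibleD(1)[OF ale]]
  show ?thesis
  proof (rule L2_compose_bi_Lipschitz[OF R(1,3) polyhedral_domainD(1,3)[OF Om] L(1) _ _ _ g])
    show "Xmap d m l ` RefDom d m \<subseteq> Omega d" using ale_admissibleD(5)[OF ale l] by simp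
  qed (use L(2,3) l in auto)
qed

lemma ale_inverse_L2:
  fixes d :: "('d::finite) scheme" and h :: "real ^ 'd \<Rightarrow> 'b::euclidean_space"
  assumes ale: "ale_admissible d m Ls" and l: "l \<in> Ls" and Om: "polyhedral_domain (Omega d)"
    and h: "h \<in> L2 (RefDom d m)"
  shows "h \<circ> Xinv d m l \<in> L2 (Omega d)"
proof -
  obtain L where L: "0 < L"
    "\<And>l x y. l \<in> Ls \<Longrightarrow> x \<in> RefDom d m \<Longrightarrow> y \<in> RefDom d m \<Longrightarrow>
      dist (Xmap d m l x) (Xmap d m l y) \<le> L * dist x y"
    "\<And>l x y. l \<in> Ls \<Longrightarrow> x \<in> RefDom d m \<Longrightarrow> y \<in> RefDom d m \<Longrightarrow>
      dist x y \<le> L * dist (Xmap d m l x) (Xmap d m l y)"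
    using ale_Lipschitz[OF ale] by metis
  note R = polyhedral_domainD[OF ale_admissibleD(1)[OF ale]]
  have im: "Xmap d m l ` RefDom d m = Omega d" by (rule ale_admissibleD(5)[OF ale l])
  have inv: "Xinv d m l x \<in> RefDom d m" "Xmap d m l (Xinv d m l x) = x" if "x \<in> Omega d" for x
    using that unfolding im[symmetric] Xinv_def by (auto intro: inv_into_into f_inv_into_f)
  show ?thesis
    unfolding comp_def
  proof (rule L2_compose_bi_Lipschitz[OF polyhedral_domainD(1,3)[OF Om] R(1,3) L(1) _ _ _ h])
    show "Xinv d m l ` Omega d \<subseteq> RefDom d m" using inv(1) by auto
    fix x y assume "x \<in> Omega d" "y \<in> Omega d"
    then show "dist (Xinv d m l x) (Xinv d m l y) \<le> L * dist x y"
      "dist x y \<le> L * dist (Xinv d m l x) (Xinv d m l y)"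
      using L(2,3)[OF l inv(1) inv(1), of x y] inv(2) by auto
  qed
qed

lemma ale_Fmat_measurable:
  fixes d :: "('d::finite) scheme"
  assumes ale: "ale_admissible d m Ls" and l: "l \<in> Ls"
  shows "Fmat d m l \<in> borel_measurable (lebesgue_on (RefDom d m))"
proof (rule borel_measurable_if_continuous_on_AE_open)
  note R = polyhedral_domainD[OF ale_admissibleD(1)[OF ale]]
  show "RefDom d m \<in> sets lebesgue" by (rule R(6))
  show "open (\<Union>T\<in>RefMesh d m. interior T)" by auto
  show "continuous_on (\<Union>T\<in>RefMesh d m. interior T) (Fmat d m l)"
    using ale_admissibleD(6)[OF ale l] by (intro continuous_on_open_UN) auto
  show "AE x in lebesgue_on (RefDom d m). x \<in> (\<Union>T\<in>RefMesh d m. interior T)"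
    by (rule mesh_of_AE_interior[OF ale_admissibleD(2)[OF ale] R(6)])
qed

lemma ale_Jdet_measurable:
  fixes d :: "('d::finite) scheme"
  assumes "ale_admissible d m Ls" "l \<in> Ls"
  shows "Jdet d m l \<in> borel_measurable (lebesgue_on (RefDom d m))"
  using borel_measurable_det[OF borel_measurable_matrix_entry[OF ale_Fmat_measurable[OF assms]]]
  by (simp add: Jdet_def[abs_def])

text \<open>\<open>K\<close> bounds the Jacobian determinant and, through
  \<open>1 \<le> J * K\<close>, its reciprocal; \<open>L\<close> bounds the inverse matrix. One pair
  serves all levels in \<open>Ls\<close>, so quotients of determinants at two levels are
  bounded.\<close>

lemma ale_Fmat_bounds:
  fixes d :: "('d::finite) scheme"
  assumes ale: "ale_admissible d m Ls"
  obtains K L where "0 < K" "0 < L"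
    "\<And>l. l \<in> Ls \<Longrightarrow> AE x in lebesgue_on (RefDom d m). 0 < Jdet d m l x \<and> Jdet d m l x \<le> K \<and>
      1 \<le> Jdet d m l x * K \<and> (\<forall>v. norm v \<le> L * norm (Fmat d m l x *v v))"
proof -
  obtain L where L: "0 < L"
    "\<And>l x y. l \<in> Ls \<Longrightarrow> x \<in> RefDom d m \<Longrightarrow> y \<in> RefDom d m \<Longrightarrow>
      dist (Xmap d m l x) (Xmap d m l y) \<le> L * dist x y"
    "\<And>l x y. l \<in> Ls \<Longrightarrow> x \<in> RefDom d m \<Longrightarrow> y \<in> RefDom d m \<Longrightarrow>
      dist x y \<le> L * dist (Xmap d m l x) (Xmap d m l y)"
    using ale_Lipschitz[OF ale] by metis
  note R = polyhedral_domainD[OF ale_admissibleD(1)[OF ale]]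
  define K where "K = real (card {p. p permutes (UNIV :: 'd set)}) * L ^ CARD('d)"
  have "card {p. p permutes (UNIV :: 'd set)} = fact CARD('d)"
    by (rule card_permutations) simp_all
  then have K: "0 < K" using L(1) by (simp add: K_def)
  have pt: "0 < Jdet d m l x \<and> Jdet d m l x \<le> K \<and> 1 \<le> Jdet d m l x * K \<and>
      (\<forall>v. norm v \<le> L * norm (Fmat d m l x *v v))"
    if l: "l \<in> Ls" and T: "T \<in> RefMesh d m" and x: "x \<in> interior T" for l T x
  proof -
    have TR: "interior T \<subseteq> RefDom d m"
      by (rule mesh_of_interior_subset[OF ale_admissibleD(2)[OF ale] ale_admissibleD(1)[OF ale] T])
    have "norm (Fmat d m l x *v v) \<le> L * norm v" "norm v \<le> L * norm (Fmat d m l x *v v)" for v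
      unfolding Fmat_def using TR x
      by (intro jacobian_bi_Lipschitz[OF open_interior x ale_admissibleD(7)[OF ale l T x] L(2,3)[OF l]]; blast)+
    moreover have J: "0 < det (Fmat d m l x)"
      using ale_admissibleD(8)[OF ale l T x] by (simp add: Jdet_def)
    ultimately show ?thesis
      using abs_det_le[of "Fmat d m l x" L] det_ge[OF J, of L] unfolding Jdet_def K_def by auto
  qed
  show ?thesis
  proof (rule that[OF K L(1)])
    fix l assume l: "l \<in> Ls"
    have "AE x in lebesgue_on (RefDom d m). x \<in> (\<Union>T\<in>RefMesh d m. interior T)"
      by (rule mesh_of_AE_interior[OF ale_admissibleD(2)[OF ale] R(6)])
    then show "AE x in lebesgue_on (RefDom d m). 0 < Jdet d m l x \<and> Jdet d m l x \<le> K \<and>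
      1 \<le> Jdet d m l x * K \<and> (\<forall>v. norm v \<le> L * norm (Fmat d m l x *v v))"
    proof eventually_elim
      case (elim x)
      then obtain T where "T \<in> RefMesh d m" "x \<in> interior T" by blast
      then show ?case using pt[OF l] by blast
    qed
  qed
qed

lemma ale_transfer_L2:
  fixes d :: "('d::finite) scheme"
  assumes ale: "ale_admissible d m Ls" and l: "m \<in> Ls" "m + 1 \<in> Ls" and Om: "polyhedral_domain (Omega d)"
    and g: "g \<in> L2 (Omega d)"
  shows "ale_transfer d m g \<in> L2 (Omega d)"
proof -
  obtain K L where KL: "0 < K" "0 < L"
    "\<And>l. l \<in> Ls \<Longrightarrow> AE x in lebesgue_on (RefDom d m). 0 < Jdet d m l x \<and> Jdet d m l x \<le> K \<and>
      1 \<le> Jdet d m l x * K \<and> (\<forall>v. norm v \<le> L * norm (Fmat d m l x *v v))"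
    by (rule ale_Fmat_bounds[OF ale]) (rule that, assumption+)
  show ?thesis
    unfolding ale_transfer_def
  proof (rule ale_inverse_L2[OF ale l(2) Om], rule L2_bounded_mult)
    note R = polyhedral_domainD[OF ale_admissibleD(1)[OF ale]]
    show "RefDom d m \<in> sets lebesgue" by (rule R(6))
    show "(\<lambda>x. g (Xmap d m m x)) \<in> L2 (RefDom d m)" by (rule ale_compose_L2[OF ale l(1) Om g])
    show "(\<lambda>x. sqrt (Jdet d m m x) / sqrt (Jdet d m (m + 1) x)) \<in> borel_measurable (lebesgue_on (RefDom d m))"
      using ale_Jdet_measurable[OF ale l(1)] ale_Jdet_measurable[OF ale l(2)] by measurable
    show "AE x in lebesgue_on (RefDom d m). \<bar>sqrt (Jdet d m m x) / sqrt (Jdet d m (m + 1) x)\<bar> \<le> K"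
      using KL(3)[OF l(1)] KL(3)[OF l(2)]
    proof eventually_elim
      case (elim x)
      \<comment> \<open>The reciprocal determinant at the new level is at most \<open>K\<close>, so
        the quotient is at most \<open>K * K\<close>, and the square root brings this back to
        \<open>K\<close>.\<close>
      have "Jdet d m m x \<le> K * 1" using elim by simp
      also have "\<dots> \<le> K * (Jdet d m (m + 1) x * K)" using elim KL(1) by (intro mult_left_mono) auto
      finally have "Jdet d m m x / Jdet d m (m + 1) x \<le> K\<^sup>2"
        using elim by (simp add: pos_divide_le_eq power2_eq_square mult_ac)
      then have "sqrt (Jdet d m m x / Jdet d m (m + 1) x) \<le> K"
        using KL(1) by (simp add: real_le_lsqrt)
      then show ?case using elim by (simp add: real_sqrt_divide)
    qed
  qed
qed

lemma uhat_L2: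
  fixes d :: "('d::finite) scheme"
  assumes ale: "ale_admissible d m Ls" and l: "l \<in> Ls" and Om: "polyhedral_domain (Omega d)"
    and u: "ust d l \<in> L2 (Omega d)"
  shows "uhat d m l \<in> L2 (RefDom d m)"
proof -
  obtain K L where KL: "0 < K" "0 < L"
    "\<And>l. l \<in> Ls \<Longrightarrow> AE x in lebesgue_on (RefDom d m). 0 < Jdet d m l x \<and> Jdet d m l x \<le> K \<and>
      1 \<le> Jdet d m l x * K \<and> (\<forall>v. norm v \<le> L * norm (Fmat d m l x *v v))"
    by (rule ale_Fmat_bounds[OF ale]) (rule that, assumption+)
  note R = polyhedral_domainD[OF ale_admissibleD(1)[OF ale]]
  have uX: "(\<lambda>x. ust d l (Xmap d m l x)) \<in> L2 (RefDom d m)" by (rule ale_compose_L2[OF ale l Om u])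
  show ?thesis
  proof (rule L2_dominated[OF R(6) uX])
    \<comment> \<open>Cramer's formula for \<open>uhat\<close>: its entries are determinants of
      measurable entries, and it equals \<open>uhat\<close> wherever the determinant is nonzero,
      that is, almost everywhere.\<close>
    define w where "w x = (\<chi> k. det (\<chi> i j. if j = k then ust d l (Xmap d m l x) $ i else Fmat d m l x $ i $ j))" for x
    show "uhat d m l \<in> borel_measurable (lebesgue_on (RefDom d m))"
    proof (rule borel_measurable_lebesgue_on_AE[OF R(6)])
      show "w \<in> borel_measurable (lebesgue_on (RefDom d m))"
      proof (rule borel_measurable_vecI)
        fix k
        have "(\<lambda>x. det (\<chi> i j. if j = k then ust d l (Xmap d m l x) $ i else Fmat d m l x $ i $ j))
          \<in> borel_measurable (lebesgue_on (RefDom d m))"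
        proof (rule borel_measurable_det)
          fix i j
          show "(\<lambda>x. (\<chi> i j. if j = k then ust d l (Xmap d m l x) $ i else Fmat d m l x $ i $ j) $ i $ j)
            \<in> borel_measurable (lebesgue_on (RefDom d m))"
            using borel_measurable_vec_nth[OF L2_measurable[OF uX]]
              borel_measurable_matrix_entry[OF ale_Fmat_measurable[OF ale l]]
            by (cases "j = k") simp_all
        qed
        then show "(\<lambda>x. w x $ k) \<in> borel_measurable (lebesgue_on (RefDom d m))"
          by (simp add: w_def)
      qed
      show "AE x in lebesgue_on (RefDom d m). w x = uhat d m l x"
        using KL(3)[OF l]
      proof eventually_elim
        case (elim x)
        then have "det (Fmat d m l x) \<noteq> 0" by (simp add: Jdet_def)
        then show ?case by (simp add: uhat_def Jdet_def w_def matrix_inv_mult_eq_cramer)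
      qed
    qed
    show "AE x in lebesgue_on (RefDom d m). norm (uhat d m l x) \<le> (K * L) * norm (ust d l (Xmap d m l x))"
      using KL(3)[OF l]
    proof eventually_elim
      case (elim x)
      then have nz: "det (Fmat d m l x) \<noteq> 0" by (simp add: Jdet_def)
      have "norm (matrix_inv (Fmat d m l x) *v ust d l (Xmap d m l x)) \<le> L * norm (ust d l (Xmap d m l x))"
        using elim by (intro matrix_inv_mult_norm_le[OF nz]) blast
      then have "Jdet d m l x * norm (matrix_inv (Fmat d m l x) *v ust d l (Xmap d m l x))
        \<le> K * (L * norm (ust d l (Xmap d m l x)))"
        using elim KL(1) by (intro mult_mono) auto
      then show ?case using elim by (simp add: uhat_def mult.assoc)
    qed
  qed
qed

text \<open>The \<open>L2\<close> product is definite on \<open>W\<close> because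
  \<open>fin_dim_space\<close> excludes nonzero functions that vanish a.e.; thus the definite
  description in \<open>l2proj\<close> denotes.\<close>

lemma l2proj_in:
  assumes A: "A \<in> sets lebesgue" and W: "fin_dim_space A W" and g: "g \<in> L2 A"
  shows "l2proj A W g \<in> W"
proof -
  have sub: "W \<subseteq> L2 A" by (rule fin_dim_space_L2[OF W])
  have "\<exists>!w. w \<in> W \<and> (\<forall>z\<in>W. l2in A w z = l2in A g z)"
    using sub g
    by (intro form_solution_unique_pos fin_dim_space_finite_span[OF W])
      (auto intro: linear_on_set_mono[OF linear_on_l2in_left[OF A]] linear_on_set_mono[OF linear_on_l2in_right[OF A]]
        fin_dim_space_l2in_eq_0[OF A W])
  from theI'[OF this] show ?thesis unfolding l2proj_def by (rule conjunct1)
qed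

lemma remesh_transfer_L2:
  assumes A: "Omega d \<in> sets lebesgue" and W: "fin_dim_space (Omega d) (Hist d m)" and g: "g \<in> L2 (Omega d)"
  shows "remesh_transfer d m g \<in> L2 (Omega d)"
proof -
  have "l2proj (Omega d) (Hist d m) g \<in> L2 (Omega d)"
    using l2proj_in[OF A W g] fin_dim_space_L2[OF W] by blast
  then have "(\<lambda>x. c *\<^sub>R l2proj (Omega d) (Hist d m) g x) \<in> L2 (Omega d)" for c
    by (rule L2_scaleR[OF A])
  then show ?thesis
    by (simp add: remesh_transfer_def Let_def L2_0)
qed

section \<open>Operators that are linear almost everywhere\<close>

text \<open>Differential operators are linear only off null sets that depend on the arguments, since
  \<open>wgrad\<close> selects a representative anew for each function.\<close>

definition ae_linear_on ::
  "'a::euclidean_space set \<Rightarrow> 'x::real_vector set \<Rightarrow> ('x \<Rightarrow> 'a \<Rightarrow> 'b::real_vector) \<Rightarrow> bool"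
  where "ae_linear_on A W T \<longleftrightarrow>
    (\<forall>u\<in>W. \<forall>v\<in>W. AE x in lebesgue_on A. T (u + v) x = T u x + T v x) \<and>
    (\<forall>c. \<forall>u\<in>W. AE x in lebesgue_on A. T (c *\<^sub>R u) x = c *\<^sub>R T u x)"

lemma ae_linear_on_mono: "ae_linear_on A W T \<Longrightarrow> V \<subseteq> W \<Longrightarrow> ae_linear_on A V T"
  unfolding ae_linear_on_def by (simp add: subset_iff)

lemma ae_linear_on_add:
  "ae_linear_on A W T \<Longrightarrow> u \<in> W \<Longrightarrow> v \<in> W \<Longrightarrow> AE x in lebesgue_on A. T (u + v) x = T u x + T v x"
  and ae_linear_on_scale:
  "ae_linear_on A W T \<Longrightarrow> u \<in> W \<Longrightarrow> AE x in lebesgue_on A. T (c *\<^sub>R u) x = c *\<^sub>R T u x"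
  unfolding ae_linear_on_def by simp_all

lemma ae_linear_on_id: "ae_linear_on A W (\<lambda>u. u)"
  by (simp add: ae_linear_on_def fun_vec_defs)

lemma ae_linear_on_compose:
  assumes T: "ae_linear_on A W T" and L: "\<And>x. linear (L x)"
  shows "ae_linear_on A W (\<lambda>u x. L x (T u x))"
  unfolding ae_linear_on_def
proof (intro conjI ballI allI)
  fix u v assume "u \<in> W" "v \<in> W"
  from ae_linear_on_add[OF T this]
  show "AE x in lebesgue_on A. L x (T (u + v) x) = L x (T u x) + L x (T v x)"
    by eventually_elim (simp add: linear_add[OF L])
next
  fix c u assume "u \<in> W"
  from ae_linear_on_scale[OF T this, of c]
  show "AE x in lebesgue_on A. L x (T (c *\<^sub>R u) x) = c *\<^sub>R L x (T u x)"
    by eventually_elim (simp add: linear_cmul[OF L])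
qed

lemma ae_linear_on_mult: "ae_linear_on A W T \<Longrightarrow> ae_linear_on A W (\<lambda>u x. (b x :: real) *\<^sub>R T u x)"
  by (rule ae_linear_on_compose) (auto intro!: linearI simp: scaleR_add_right)

text \<open>Integration erases the null sets. Integrability is assumed for the pairing itself rather
  than deduced from \<open>L2\<close>, because \<open>g\<close> may be a product of several fields,
  such as mobility times gradient.\<close>

lemma linear_on_l2in_op_right:
  assumes A: "A \<in> sets lebesgue" and T: "ae_linear_on A W T" and W: "subspace W"
    and int: "\<And>u. u \<in> W \<Longrightarrow> integrable (lebesgue_on A) (\<lambda>x. g x \<bullet> T u x)"
  shows "linear_on_set W (\<lambda>u. l2in A g (T u))"
proof (rule linear_on_setI)
  fix u v assume uv: "u \<in> W" "v \<in> W"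
  have "l2in A g (T (u + v)) = l2in A g (\<lambda>x. T u x + T v x)"
  proof (rule l2in_cong_AE[OF A])
    show "integrable (lebesgue_on A) (\<lambda>x. g x \<bullet> T (u + v) x)"
      by (rule int[OF subspace_add[OF W uv]])
    show "integrable (lebesgue_on A) (\<lambda>x. g x \<bullet> (T u x + T v x))"
      using int[OF uv(1)] int[OF uv(2)] by (simp add: inner_add_right)
    show "AE x in lebesgue_on A. g x \<bullet> T (u + v) x = g x \<bullet> (T u x + T v x)"
      using ae_linear_on_add[OF T uv] by eventually_elim simp
  qed
  also have "\<dots> = l2in A g (T u) + l2in A g (T v)"
    by (rule l2in_add_right[OF A int[OF uv(1)] int[OF uv(2)]])
  finally show "l2in A g (T (u + v)) = l2in A g (T u) + l2in A g (T v)" .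
next
  fix c u assume u: "u \<in> W"
  have "l2in A g (T (c *\<^sub>R u)) = l2in A g (\<lambda>x. c *\<^sub>R T u x)"
  proof (rule l2in_cong_AE[OF A])
    show "integrable (lebesgue_on A) (\<lambda>x. g x \<bullet> T (c *\<^sub>R u) x)"
      by (rule int[OF subspace_scale[OF W u]])
    show "integrable (lebesgue_on A) (\<lambda>x. g x \<bullet> (c *\<^sub>R T u x))"
      using int[OF u] by simp
    show "AE x in lebesgue_on A. g x \<bullet> T (c *\<^sub>R u) x = g x \<bullet> (c *\<^sub>R T u x)"
      using ae_linear_on_scale[OF T u, of c] by eventually_elim simp
  qed
  also have "\<dots> = c * l2in A g (T u)" by (rule l2in_scale_right[OF A])
  finally show "l2in A g (T (c *\<^sub>R u)) = c * l2in A g (T u)" .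
qed

lemma linear_on_l2in_op_left:
  assumes A: "A \<in> sets lebesgue" and T: "ae_linear_on A W T" and W: "subspace W"
    and int: "\<And>u. u \<in> W \<Longrightarrow> integrable (lebesgue_on A) (\<lambda>x. T u x \<bullet> g x)"
  shows "linear_on_set W (\<lambda>u. l2in A (T u) g)"
  using linear_on_l2in_op_right[OF A T W, of g] int by (simp add: l2in_commute[of A _ g] inner_commute)

lemma L2_vec_nth:
  fixes f :: "'a::euclidean_space \<Rightarrow> 'b::euclidean_space ^ 'n::finite"
  assumes A: "A \<in> sets lebesgue" and f: "f \<in> L2 A"
  shows "(\<lambda>x. f x $ i) \<in> L2 A"
proof (rule L2_dominated[OF A f])
  have "continuous_on UNIV (\<lambda>v :: 'b ^ 'n. v $ i)" by (intro continuous_intros)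
  from measurable_compose[OF L2_measurable[OF f] borel_measurable_continuous_onI[OF this]]
  show "(\<lambda>x. f x $ i) \<in> borel_measurable (lebesgue_on A)" .
  show "AE x in lebesgue_on A. norm (f x $ i) \<le> 1 * norm (f x)"
    by (intro AE_I2) (simp add: Finite_Cartesian_Product.norm_nth_le)
qed

lemma L2_vecI:
  fixes f :: "'a::euclidean_space \<Rightarrow> 'b::euclidean_space ^ 'n::finite"
  assumes A: "A \<in> sets lebesgue" and f: "\<And>i. (\<lambda>x. f x $ i) \<in> L2 A"
  shows "f \<in> L2 A"
proof -
  have "f \<in> borel_measurable (lebesgue_on A)"
    unfolding borel_measurable_euclidean_space[of f]
  proof
    fix e :: "'b ^ 'n" assume "e \<in> Basis"
    then obtain i b where "e = axis i b" by (auto simp: Basis_vec_def)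
    then show "(\<lambda>x. f x \<bullet> e) \<in> borel_measurable (lebesgue_on A)"
      using L2_measurable[OF f[of i]] by (simp add: inner_axis)
  qed
  moreover have "integrable (lebesgue_on A) (\<lambda>x. \<Sum>i\<in>UNIV. f x $ i \<bullet> f x $ i)"
    using f by (intro Bochner_Integration.integrable_sum L2_inner_integrable[OF A])
  ultimately show ?thesis
    by (simp add: L2_def set_integrable_iff_on[OF A] inner_vec_def)
qed

lemma H1vD: "v \<in> H1v A \<Longrightarrow> (\<lambda>x. v x $ i) \<in> H1 A"
  by (simp add: H1v_def)

lemma wjac_L2:
  assumes "A \<in> sets lebesgue" "v \<in> H1v A"
  shows "wjac A v \<in> L2 A"
proof (rule L2_vecI[OF assms(1)])
  fix i
  show "(\<lambda>x. wjac A v x $ i) \<in> L2 A"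
    using wgrad_L2[OF H1vD[OF assms(2)], of i] by (simp add: wjac_def)
qed

lemma symgrad_L2:
  assumes A: "A \<in> sets lebesgue" and v: "v \<in> H1v A"
  shows "symgrad A v \<in> L2 A"
proof -
  note J = wjac_L2[OF assms]
  have "(\<lambda>x. transpose (wjac A v x)) \<in> L2 A"
  proof (intro L2_vecI[OF A])
    fix i j
    show "(\<lambda>x. transpose (wjac A v x) $ i $ j) \<in> L2 A"
      using L2_vec_nth[OF A L2_vec_nth[OF A J], where i=i] by (simp add: transpose_def)
  qed
  from L2_scaleR[OF A L2_add[OF A J this], of "1/2"] show ?thesis
    by (simp add: symgrad_def[abs_def])
qed

lemma wdiv_L2:
  assumes A: "A \<in> sets lebesgue" and v: "v \<in> H1v A"
  shows "wdiv A v \<in> L2 A"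
proof -
  have "(\<lambda>x. \<Sum>i\<in>I. wjac A v x $ i $ i) \<in> L2 A" if "finite I" for I
    using that
  proof (induction I rule: finite_induct)
    case (insert i I)
    then show ?case
      using L2_add[OF A L2_vec_nth[OF A L2_vec_nth[OF A wjac_L2[OF assms]]] insert(3)] by simp
  qed (simp add: L2_0)
  from this[of UNIV] show ?thesis by (simp add: wdiv_def[abs_def] trace_def)
qed

lemma ae_linear_on_wgrad:
  assumes "open A" "A \<in> lmeasurable"
  shows "ae_linear_on A (H1 A) (wgrad A)"
  unfolding ae_linear_on_def fun_vec_defs
  using wgrad_add[OF assms] wgrad_scaleR[OF assms] by simp

lemma H1_subspace: "A \<in> lmeasurable \<Longrightarrow> subspace (H1 A)"
proof -
  assume A: "A \<in> lmeasurable"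
  have "is_weak_grad A (\<lambda>x. 0) (\<lambda>x. 0)"
    using A by (subst is_weak_grad_iff) (auto simp: L2_0)
  then have "(\<lambda>x. 0) \<in> H1 A" by (auto simp: H1_def L2_0)
  then show ?thesis
    unfolding subspace_def fun_vec_defs using H1_add[OF A] H1_scaleR[OF A] by simp
qed

lemma ae_linear_on_wjac:
  fixes A :: "(real ^ 'd::finite) set"
  assumes A: "open A" "A \<in> lmeasurable"
  shows "ae_linear_on A (H1v A) (wjac A)"
  unfolding ae_linear_on_def
proof (intro conjI ballI allI)
  fix u v :: "real ^ 'd \<Rightarrow> real ^ 'd" assume "u \<in> H1v A" "v \<in> H1v A"
  then have "AE x in lebesgue_on A. wgrad A (\<lambda>y. u y $ i + v y $ i) x
      = wgrad A (\<lambda>y. u y $ i) x + wgrad A (\<lambda>y. v y $ i) x" for i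
    by (intro wgrad_add[OF A] H1vD)
  then have "AE x in lebesgue_on A. \<forall>i\<in>UNIV. wgrad A (\<lambda>y. u y $ i + v y $ i) x
      = wgrad A (\<lambda>y. u y $ i) x + wgrad A (\<lambda>y. v y $ i) x"
    by (intro AE_finite_allI) auto
  then show "AE x in lebesgue_on A. wjac A (u + v) x = wjac A u x + wjac A v x"
    by eventually_elim (simp add: wjac_def vec_eq_iff fun_vec_defs)
next
  fix c and u :: "real ^ 'd \<Rightarrow> real ^ 'd" assume "u \<in> H1v A"
  then have "AE x in lebesgue_on A. wgrad A (\<lambda>y. c * u y $ i) x = c *\<^sub>R wgrad A (\<lambda>y. u y $ i) x" for i
    by (intro wgrad_scaleR[OF A] H1vD)
  then have "AE x in lebesgue_on A. \<forall>i\<in>UNIV. wgrad A (\<lambda>y. c * u y $ i) x = c *\<^sub>R wgrad A (\<lambda>y. u y $ i) x"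
    by (intro AE_finite_allI) auto
  then show "AE x in lebesgue_on A. wjac A (c *\<^sub>R u) x = c *\<^sub>R wjac A u x"
    by eventually_elim (simp add: wjac_def vec_eq_iff fun_vec_defs)
qed

lemma ae_linear_on_symgrad:
  fixes A :: "(real ^ 'd::finite) set"
  assumes A: "open A" "A \<in> lmeasurable"
  shows "ae_linear_on A (H1v A) (symgrad A)"
proof -
  have "linear (\<lambda>M :: real ^ 'd ^ 'd. (1/2) *\<^sub>R (M + transpose M))"
    by (rule linearI) (simp_all add: transpose_def vec_eq_iff algebra_simps)
  from ae_linear_on_compose[OF ae_linear_on_wjac[OF A] this] show ?thesis
    by (simp add: symgrad_def[abs_def])
qed

lemma ae_linear_on_wdiv:
  fixes A :: "(real ^ 'd::finite) set"
  assumes A: "open A" "A \<in> lmeasurable"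
  shows "ae_linear_on A (H1v A) (wdiv A)"
proof -
  have "linear (trace :: real ^ 'd ^ 'd \<Rightarrow> real)"
    by (rule linearI) (simp_all add: trace_def sum.distrib sum_distrib_left)
  from ae_linear_on_compose[OF ae_linear_on_wjac[OF A] this] show ?thesis
    by (simp add: wdiv_def[abs_def])
qed

lemma ae_linear_on_advect:
  fixes d :: "('d::finite) scheme"
  assumes A: "open (Omega d)" "Omega d \<in> lmeasurable"
  shows "ae_linear_on (Omega d) (H1v (Omega d)) (advect d k n uc phi mu)"
proof -
  have "linear (\<lambda>M :: real ^ 'd ^ 'd. M *v w)" for w
    by (rule linearI) (simp_all add: matrix_vector_mult_add_rdistrib scaleR_matrix_vector_assoc)
  from ae_linear_on_compose[OF ae_linear_on_wjac[OF A] this] show ?thesis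
    by (simp add: advect_def[abs_def])
qed

section \<open>The coupled linear systems\<close>

definition bilinear_on_set :: "'a::real_vector set \<Rightarrow> 'b::real_vector set \<Rightarrow> ('a \<Rightarrow> 'b \<Rightarrow> real) \<Rightarrow> bool"
  where "bilinear_on_set V W b \<longleftrightarrow>
    (\<forall>w\<in>W. linear_on_set V (\<lambda>v. b v w)) \<and> (\<forall>v\<in>V. linear_on_set W (b v))"

lemma bilinear_on_setI:
  assumes "\<And>w. w \<in> W \<Longrightarrow> linear_on_set V (\<lambda>v. b v w)" "\<And>v. v \<in> V \<Longrightarrow> linear_on_set W (b v)"
  shows "bilinear_on_set V W b"
  using assms by (simp add: bilinear_on_set_def)

lemma bilinear_on_setD:
  assumes "bilinear_on_set V W b"
  shows "w \<in> W \<Longrightarrow> linear_on_set V (\<lambda>v. b v w)" "v \<in> V \<Longrightarrow> linear_on_set W (b v)"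
  using assms by (simp_all add: bilinear_on_set_def)

lemma linear_on_set_Times:
  assumes "linear_on_set V f" "linear_on_set W g"
  shows "linear_on_set (V \<times> W) (\<lambda>z. f (fst z) + g (snd z))"
  using assms by (auto simp: linear_on_set_def algebra_simps)

lemma linear_on_set_UNIV_mult: "linear_on_set (UNIV :: real set) (\<lambda>t. c * t)"
  by (simp add: linear_on_set_def algebra_simps)

text \<open>The system becomes one form on the product space, with the divergence equation added
  with the sign that makes the pressure terms cancel on the diagonal. Both homogeneous problems then
  give \<open>a u u = 0\<close>, so the velocity vanishes, and \<open>inf_sup\<close> removes the
  pressure.\<close>

proposition saddle_point_unique:
  assumes V: "finite_span V" and P: "finite_span P"
    and a: "bilinear_on_set V V a" and b: "bilinear_on_set P V b" and l: "linear_on_set V l"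
    and pos: "\<And>v. v \<in> V \<Longrightarrow> a v v = 0 \<Longrightarrow> v = 0"
    and inf_sup: "\<And>p. p \<in> P \<Longrightarrow> (\<And>v. v \<in> V \<Longrightarrow> b p v = 0) \<Longrightarrow> p = 0"
  shows "\<exists>!(u, p). u \<in> V \<and> p \<in> P \<and> (\<forall>v\<in>V. a u v - b p v = l v) \<and> (\<forall>\<alpha>\<in>P. b \<alpha> u = 0)"
proof -
  note sV = finite_span_subspace[OF V] and sP = finite_span_subspace[OF P]
  define B where "B z y = a (fst z) (fst y) - b (snd z) (fst y) + b (snd y) (fst z)" for z y
  define L where "L y = l (fst y)" for y :: "'a \<times> 'b"
  have B0: "B z (v, 0) = a (fst z) v - b (snd z) v" "B z (0, \<alpha>) = b \<alpha> (fst z)"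
    if "z \<in> V \<times> P" "v \<in> V" "\<alpha> \<in> P" for z v \<alpha>
    using that linear_on_set_0[OF bilinear_on_setD(1)[OF b, of "fst z"]]
      linear_on_set_0[OF bilinear_on_setD(2)[OF a, of "fst z"]]
      linear_on_set_0[OF bilinear_on_setD(2)[OF b, of "snd z"]] subspace_0[OF sV] subspace_0[OF sP]
    by (auto simp: B_def)
  have B0': "B (v, 0) y = a v (fst y) + b (snd y) v" if "y \<in> V \<times> P" "v \<in> V" for y v
    using that linear_on_set_0[OF bilinear_on_setD(1)[OF b, of "fst y"]] subspace_0[OF sP]
    by (auto simp: B_def)
  have "\<exists>!z. z \<in> V \<times> P \<and> (\<forall>y\<in>V \<times> P. B z y = L y)"
  proof (rule form_solution_unique)
    show "finite_span (V \<times> P)" by (rule finite_span_Times[OF V P])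
    show "linear_on_set (V \<times> P) (\<lambda>z. B z y)" if "y \<in> V \<times> P" for y
    proof -
      \<comment> \<open>\<open>B\<close> regrouped by the components of its first argument, the
        shape in which linearity on a product is available.\<close>
      have "linear_on_set (V \<times> P) (\<lambda>z. (a (fst z) (fst y) + b (snd y) (fst z)) + (- 1) * b (snd z) (fst y))"
        using that by (intro linear_on_set_Times[of V "\<lambda>u. a u (fst y) + b (snd y) u"] linear_on_set_plus
            linear_on_set_cmult bilinear_on_setD[OF a] bilinear_on_setD[OF b]) auto
      then show ?thesis by (simp add: B_def algebra_simps)
    qed
    show "linear_on_set (V \<times> P) (B z)" if "z \<in> V \<times> P" for z
    proof -
      have "linear_on_set (V \<times> P) (\<lambda>y. (a (fst z) (fst y) - b (snd z) (fst y)) + b (snd y) (fst z))"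
        using that by (intro linear_on_set_Times[of V "\<lambda>v. a (fst z) v - b (snd z) v"] linear_on_set_minus
            bilinear_on_setD[OF a] bilinear_on_setD[OF b]) auto
      then show ?thesis unfolding B_def .
    qed
    show "linear_on_set (V \<times> P) L"
      using linear_on_set_Times[OF l linear_on_set_zero] by (simp add: L_def[abs_def])
    fix z assume z: "z \<in> V \<times> P"
    {
      assume "\<And>y. y \<in> V \<times> P \<Longrightarrow> B z y = 0"
      then have 1: "a (fst z) v - b (snd z) v = 0" "b \<alpha> (fst z) = 0" if "v \<in> V" "\<alpha> \<in> P" for v \<alpha>
        using B0[OF z that] that subspace_0[OF sV] subspace_0[OF sP] by auto
      then have "a (fst z) (fst z) = 0" using z by (auto simp: mem_Times_iff)
      then have u0: "fst z = 0" using z pos by auto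
      have "b (snd z) v = 0" if "v \<in> V" for v
        using 1(1)[OF that subspace_0[OF sP]] that u0 linear_on_set_0[OF bilinear_on_setD(1)[OF a that] subspace_0[OF sV]] by simp
      then have "snd z = 0" using z inf_sup by auto
      with u0 show "z = 0" by (simp add: prod_eq_iff)
    next
      assume zero: "\<And>y. y \<in> V \<times> P \<Longrightarrow> B y z = 0"
      have "a (fst z) (fst z) = 0" using zero[OF z] by (simp add: B_def)
      then have v0: "fst z = 0" using z pos by auto
      have "b (snd z) v = 0" if "v \<in> V" for v
        using zero[of "(v, 0)"] B0'[OF z that] that subspace_0[OF sP] v0
          linear_on_set_0[OF bilinear_on_setD(2)[OF a that] subspace_0[OF sV]] by simp
      then have "snd z = 0" using z inf_sup by auto
      with v0 show "z = 0" by (simp add: prod_eq_iff)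
    }
  qed
  moreover have "z \<in> V \<times> P \<and> (\<forall>y\<in>V \<times> P. B z y = L y) \<longleftrightarrow>
    (case z of (u, p) \<Rightarrow> u \<in> V \<and> p \<in> P \<and> (\<forall>v\<in>V. a u v - b p v = l v) \<and> (\<forall>\<alpha>\<in>P. b \<alpha> u = 0))" for z
  proof (cases z)
    case (Pair u p)
    have "(\<forall>y\<in>V \<times> P. B (u, p) y = L y) \<longleftrightarrow> (\<forall>v\<in>V. a u v - b p v = l v) \<and> (\<forall>\<alpha>\<in>P. b \<alpha> u = 0)"
      if z: "(u, p) \<in> V \<times> P"
    proof
      assume *: "\<forall>y\<in>V \<times> P. B (u, p) y = L y"
      show "(\<forall>v\<in>V. a u v - b p v = l v) \<and> (\<forall>\<alpha>\<in>P. b \<alpha> u = 0)"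
      proof (intro conjI ballI)
        fix v assume v: "v \<in> V"
        then show "a u v - b p v = l v"
          using *[rule_format, of "(v, 0)"] B0(1)[OF z v subspace_0[OF sP]] subspace_0[OF sP] by (simp add: L_def)
      next
        fix \<alpha> assume \<alpha>: "\<alpha> \<in> P"
        then show "b \<alpha> u = 0"
          using *[rule_format, of "(0, \<alpha>)"] B0(2)[OF z subspace_0[OF sV] \<alpha>] subspace_0[OF sV]
            linear_on_set_0[OF l] by (simp add: L_def)
      qed
    qed (auto simp: B_def L_def)
    then show ?thesis unfolding Pair by auto
  qed
  ultimately show ?thesis by simp
qed

text \<open>The transposed homogeneous system is handled by the same energy identity as the original one:
  the test functions are the unknowns themselves, and the scalar equation turns the coupling term
  into \<open>2 r\<^sup>2\<close>.\<close>

proposition phase_sav_system_unique: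
  fixes U c pe rH :: real
  assumes S: "finite_span S"
    and B: "bilinear_on_set S S B" and M: "bilinear_on_set S S M" and K: "bilinear_on_set S S K"
    and G: "linear_on_set S G" and R: "linear_on_set S R" and phiH: "phiH \<in> S"
    and pos: "0 < U" "0 < c" "0 < pe"
    and B_sym: "\<And>u v. B u v = B v u" and B_pos: "\<And>u. u \<in> S \<Longrightarrow> B u u = 0 \<Longrightarrow> u = 0"
    and M_pos: "\<And>u. u \<in> S \<Longrightarrow> 0 \<le> M u u"
    and K_nonneg: "\<And>u. u \<in> S \<Longrightarrow> 0 \<le> K u u" and K_pos: "\<And>u. u \<in> S \<Longrightarrow> K u u = 0 \<Longrightarrow> u = 0"
  shows "\<exists>!(phi, mu, r). phi \<in> S \<and> mu \<in> S \<and>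
    (\<forall>\<omega>\<in>S. c * B (phi - phiH) \<omega> - R \<omega> + pe * M mu \<omega> = 0) \<and>
    (\<forall>\<theta>\<in>S. B mu \<theta> = K phi \<theta> + r / U * G \<theta>) \<and>
    c * (r - rH) = 1 / (2 * U) * (c * G (phi - phiH))"
proof -
  note sS = finite_span_subspace[OF S]
  note S0 = subspace_0[OF sS]
  define W where "W = S \<times> (S \<times> (UNIV :: real set))"
  \<comment> \<open>The phase, potential and scalar equations, each tested with its own component of
    \<open>y\<close>, so that they can be recovered one at a time by zeroing the other two. The
    known terms are collected in \<open>L\<close>.\<close>
  define F where "F z y = (c * B (fst z) (fst y) + pe * M (fst (snd z)) (fst y))
    + ((B (fst (snd z)) (fst (snd y)) - K (fst z) (fst (snd y)) - snd (snd z) / U * G (fst (snd y)))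
    + (c * snd (snd z) - c / (2 * U) * G (fst z)) * snd (snd y))" for z y
  define L where "L y = (c * B phiH (fst y) + R (fst y))
    + (0 + (c * rH - c / (2 * U) * G phiH) * snd (snd y))" for y :: "'a \<times> 'a \<times> real"
  note lin = bilinear_on_setD[OF B] bilinear_on_setD[OF M] bilinear_on_setD[OF K]
  note lin0 = lin[THEN linear_on_set_0, OF _ S0] linear_on_set_0[OF G S0] linear_on_set_0[OF R S0]
  have W: "z \<in> W \<longleftrightarrow> fst z \<in> S \<and> fst (snd z) \<in> S" for z
    by (cases z) (auto simp: W_def)
  have "\<exists>!z. z \<in> W \<and> (\<forall>y\<in>W. F z y = L y)"
  proof (rule form_solution_unique)
    show "finite_span W"
      unfolding W_def by (intro finite_span_Times S finite_span_UNIV_real)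
    show "linear_on_set W (F z)" if "z \<in> W" for z
      unfolding F_def W_def using that unfolding W
      by (intro linear_on_set_Times[of S "\<lambda>w. c * B (fst z) w + pe * M (fst (snd z)) w"]
          linear_on_set_Times[of S "\<lambda>w. B (fst (snd z)) w - K (fst z) w - snd (snd z) / U * G w"]
          linear_on_set_plus linear_on_set_minus linear_on_set_cmult lin G linear_on_set_UNIV_mult) auto
    show "linear_on_set W L"
      unfolding L_def W_def using phiH
      by (intro linear_on_set_Times[of S "\<lambda>w. c * B phiH w + R w"] linear_on_set_Times[of S "\<lambda>w. 0"]
          linear_on_set_plus linear_on_set_cmult lin R linear_on_set_zero linear_on_set_UNIV_mult)
    show "linear_on_set W (\<lambda>z. F z y)" if "y \<in> W" for y
    proof -
      have "linear_on_set W (\<lambda>z. (c * B (fst z) (fst y) - K (fst z) (fst (snd y)) - (c / (2 * U) * snd (snd y)) * G (fst z))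
        + ((pe * M (fst (snd z)) (fst y) + B (fst (snd z)) (fst (snd y)))
        + (c * snd (snd y) - G (fst (snd y)) / U) * snd (snd z)))"
        unfolding W_def using that unfolding W
        by (intro linear_on_set_Times[of S "\<lambda>u. c * B u (fst y) - K u (fst (snd y)) - (c / (2 * U) * snd (snd y)) * G u"]
            linear_on_set_Times[of S "\<lambda>u. pe * M u (fst y) + B u (fst (snd y))"]
            linear_on_set_plus linear_on_set_minus linear_on_set_cmult lin G linear_on_set_UNIV_mult) auto
      then show ?thesis by (simp add: F_def algebra_simps)
    qed
    fix z assume z: "z \<in> W"
    obtain phi mu r where z_eq: "z = (phi, mu, r)" by (cases z) auto
    have in_S: "phi \<in> S" "mu \<in> S" using z by (auto simp: z_eq W)
    {
      assume "\<And>y. y \<in> W \<Longrightarrow> F z y = 0"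
      then have zero: "F (phi, mu, r) (\<omega>, \<theta>, t) = 0" if "\<omega> \<in> S" "\<theta> \<in> S" for \<omega> \<theta> t
        using that by (simp add: z_eq W)
      have 1: "c * B phi \<omega> + pe * M mu \<omega> = 0" if "\<omega> \<in> S" for \<omega>
        using zero[OF that S0, of 0] in_S that by (simp add: F_def lin0)
      have 2: "B mu \<theta> - K phi \<theta> - r / U * G \<theta> = 0" if "\<theta> \<in> S" for \<theta>
        using zero[OF S0 that, of 0] in_S that by (simp add: F_def lin0)
      have 3: "c * r = c / (2 * U) * G phi"
        using zero[OF S0 S0, of 1] in_S by (simp add: F_def lin0)
      \<comment> \<open>The scalar equation eliminates the nonlocal term. The potential equation
        tested with \<open>phi\<close> makes \<open>B mu phi\<close> nonnegative, the phase equation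
        tested with \<open>mu\<close> makes it nonpositive, so every summand vanishes.\<close>
      then have "G phi = 2 * U * r" using pos by (simp add: field_simps)
      then have "B mu phi = K phi phi + 2 * r\<^sup>2"
        using 2[OF in_S(1)] pos by (simp add: power2_eq_square)
      moreover have "c * B mu phi \<le> 0"
        using 1[OF in_S(2)] mult_nonneg_nonneg[OF less_imp_le[OF pos(3)] M_pos[OF in_S(2)]] B_sym by (metis add_le_cancel_right add_0 add.commute)
      then have "B mu phi \<le> 0" using pos(2) by (simp add: mult_le_0_iff)
      ultimately have "K phi phi = 0" "r\<^sup>2 = 0"
        using K_nonneg[OF in_S(1)] zero_le_power2[of r] by linarith+
      then have "r = 0" by simp
      have phi0: "phi = 0" using K_pos[OF in_S(1) \<open>K phi phi = 0\<close>] .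
      then have "B mu mu = 0" using 2[OF in_S(2)] \<open>r = 0\<close> in_S by (simp add: lin0)
      then have "mu = 0" using B_pos in_S by blast
      with phi0 \<open>r = 0\<close> show "z = 0" by (simp add: z_eq zero_prod_def)
    next
      assume "\<And>y. y \<in> W \<Longrightarrow> F y z = 0"
      then have zero: "F (\<omega>, \<theta>, t) (phi, mu, r) = 0" if "\<omega> \<in> S" "\<theta> \<in> S" for \<omega> \<theta> t
        using that by (simp add: z_eq W)
      have 1: "c * B \<omega> phi - K \<omega> mu - c / (2 * U) * G \<omega> * r = 0" if "\<omega> \<in> S" for \<omega>
        using zero[OF that S0, of 0] in_S that by (simp add: F_def lin0)
      have 2: "pe * M \<theta> phi + B \<theta> mu = 0" if "\<theta> \<in> S" for \<theta>
        using zero[OF S0 that, of 0] in_S that by (simp add: F_def lin0)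
      have 3: "c * r = G mu / U"
        using zero[OF S0 S0, of 1] in_S by (simp add: F_def lin0)
      \<comment> \<open>In the transposed system \<open>phi\<close> and \<open>mu\<close> exchange
        roles: the trial functions are \<open>\<omega> = mu\<close> and
        \<open>\<theta> = phi\<close>. The scalar contribution comes out as
        \<open>c\<^sup>2 * r\<^sup>2 / 2\<close>, again nonnegative.\<close>
      then have "G mu = c * U * r" using pos by (simp add: field_simps)
      then have "c * B mu phi = K mu mu + c\<^sup>2 * r\<^sup>2 / 2"
        using 1[OF in_S(2)] pos by (simp add: power2_eq_square)
      moreover have "B mu phi \<le> 0"
        using 2[OF in_S(1)] mult_nonneg_nonneg[OF less_imp_le[OF pos(3)] M_pos[OF in_S(1)]] B_sym[of mu phi] by linarith
      then have "c * B mu phi \<le> 0" using pos(2) by (simp add: mult_le_0_iff)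
      moreover have "0 \<le> c\<^sup>2 * r\<^sup>2 / 2" by simp
      ultimately have "K mu mu = 0" "c\<^sup>2 * r\<^sup>2 / 2 = 0"
        using K_nonneg[OF in_S(2)] by linarith+
      then have mu0: "mu = 0" and r0: "r = 0" using K_pos in_S pos(2) by auto
      then have "c * B phi phi = 0" using 1[OF in_S(1)] in_S by (simp add: lin0)
      then have "phi = 0" using B_pos in_S pos(2) by simp
      with mu0 r0 show "z = 0" by (simp add: z_eq zero_prod_def)
    }
  qed
  moreover have "z \<in> W \<and> (\<forall>y\<in>W. F z y = L y) \<longleftrightarrow> (case z of (phi, mu, r) \<Rightarrow> phi \<in> S \<and> mu \<in> S \<and>
    (\<forall>\<omega>\<in>S. c * B (phi - phiH) \<omega> - R \<omega> + pe * M mu \<omega> = 0) \<and>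
    (\<forall>\<theta>\<in>S. B mu \<theta> = K phi \<theta> + r / U * G \<theta>) \<and>
    c * (r - rH) = 1 / (2 * U) * (c * G (phi - phiH)))" for z
  proof -
    obtain phi mu r where z_eq: "z = (phi, mu, r)" by (cases z) auto
    have "(\<forall>y\<in>W. F (phi, mu, r) y = L y) \<longleftrightarrow>
      (\<forall>\<omega>\<in>S. c * B (phi - phiH) \<omega> - R \<omega> + pe * M mu \<omega> = 0) \<and>
      (\<forall>\<theta>\<in>S. B mu \<theta> = K phi \<theta> + r / U * G \<theta>) \<and>
      c * (r - rH) = 1 / (2 * U) * (c * G (phi - phiH))" (is "?lhs \<longleftrightarrow> ?rhs")
      if in_S: "phi \<in> S" "mu \<in> S"
    proof -
      have d1: "B (phi - phiH) \<omega> = B phi \<omega> - B phiH \<omega>" if "\<omega> \<in> S" for \<omega>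
        by (rule linear_on_set_diff[OF lin(1)[OF that] sS in_S(1) phiH])
      have d2: "G (phi - phiH) = G phi - G phiH"
        by (rule linear_on_set_diff[OF G sS in_S(1) phiH])
      show ?thesis
      proof
        assume ?lhs
        then have *: "F (phi, mu, r) (\<omega>, \<theta>, t) = L (\<omega>, \<theta>, t)" if "\<omega> \<in> S" "\<theta> \<in> S" for \<omega> \<theta> t
          using that by (simp add: W)
        show ?rhs
        proof (intro conjI ballI)
          fix \<omega> assume "\<omega> \<in> S"
          then show "c * B (phi - phiH) \<omega> - R \<omega> + pe * M mu \<omega> = 0"
            using *[OF _ S0, of \<omega> 0] in_S phiH by (simp add: F_def L_def lin0 d1 algebra_simps)
        next
          fix \<theta> assume "\<theta> \<in> S"
          then show "B mu \<theta> = K phi \<theta> + r / U * G \<theta>"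
            using *[OF S0, of \<theta> 0] in_S phiH by (simp add: F_def L_def lin0)
        next
          show "c * (r - rH) = 1 / (2 * U) * (c * G (phi - phiH))"
            using *[OF S0 S0, of 1] in_S phiH by (simp add: F_def L_def lin0 d2 diff_divide_distrib algebra_simps)
        qed
      next
        assume rhs: ?rhs
        show ?lhs
        proof
          fix y assume "y \<in> W"
          then obtain \<omega> \<theta> t where y: "y = (\<omega>, \<theta>, t)" "\<omega> \<in> S" "\<theta> \<in> S" by (cases y) (auto simp: W)
          have 1: "c * B phi \<omega> + pe * M mu \<omega> = c * B phiH \<omega> + R \<omega>"
          proof -
            have "c * (B phi \<omega> - B phiH \<omega>) - R \<omega> + pe * M mu \<omega> = 0"
              using rhs y(2) by (simp add: d1)
            then show ?thesis by (simp add: right_diff_distrib)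
          qed
          have 2: "B mu \<theta> - K phi \<theta> - r / U * G \<theta> = 0" using rhs y(3) by auto
          have "c * r - c / (2 * U) * G phi = c * rH - c / (2 * U) * G phiH"
          proof -
            have "c * (r - rH) = 1 / (2 * U) * (c * (G phi - G phiH))" using rhs by (simp add: d2)
            then show ?thesis by (simp add: diff_divide_distrib algebra_simps)
          qed
          with 1 2 show "F (phi, mu, r) y = L y" by (simp add: F_def L_def y(1))
        qed
      qed
    qed
    then show ?thesis by (auto simp: z_eq W)
  qed
  ultimately show ?thesis by simp
qed

section \<open>One step of the scheme\<close>

lemma ex1_triple:
  "(\<exists>!(a, b, c). P a b c) \<longleftrightarrow> (\<exists>a b c. P a b c \<and> (\<forall>x y z. P x y z \<longrightarrow> x = a \<and> y = b \<and> z = c))"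
  unfolding Ex1_def split_paired_Ex split_paired_All by simp

text \<open>Collects the hypotheses on data, spaces and accepted states. Those on the new phase
  field enter only after it has been constructed.\<close>

locale scheme_step =
  fixes d :: "('d::finite) scheme" and k n :: nat
  assumes k: "k = 1 \<or> k = 2" and kn: "k = 2 \<Longrightarrow> 1 \<le> n"
    and par: "admissible_parameters d"
    and disc: "discretization d n"
    and acc: "accepted_states d n"
    and force: "force d (n+1) \<in> L2 (Omega d)"
    and fin: "finite_integrals d k n"
    and UE2: "0 < UE2 d k n"
    and transfers: "admissible_transfers d k n"
    and mobility: "AE x\<in>Omega d in lebesgue. 0 \<le> mE d k n x"
    and q_pos: "0 < qst d n"
    and inf_sup: "inf_sup_condition d (n+1)"
begin

lemma domain: "polyhedral_domain (Omega d)"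
  using disc by (simp add: discretization_def)

lemmas Om = polyhedral_domainD[OF domain]

lemma spaces:
  assumes "l \<le> n + 1"
  shows "fin_dim_space (Omega d) (Sh d l)" "Sh d l \<subseteq> H1 (Omega d)"
    "fin_dim_space (Omega d) (Vh d l)" "Vh d l \<subseteq> H1v (Omega d)"
    "fin_dim_space (Omega d) (Ph d l)"
  using disc assms unfolding discretization_def by auto

lemma L2_spaces:
  assumes "l \<le> n + 1"
  shows "Sh d l \<subseteq> L2 (Omega d)" "Vh d l \<subseteq> L2 (Omega d)" "Ph d l \<subseteq> L2 (Omega d)" "P0 d l \<subseteq> L2 (Omega d)"
  using fin_dim_space_L2[OF spaces(1)[OF assms]] fin_dim_space_L2[OF spaces(3)[OF assms]]
    fin_dim_space_L2[OF spaces(5)[OF assms]]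
  by (auto simp: P0_def zero_mean_def)

lemma finite_span_spaces:
  assumes "l \<le> n + 1"
  shows "finite_span (Sh d l)" "finite_span (Vh d l)" "finite_span (P0 d l)" "finite_span (S0 d l)"
  using fin_dim_space_finite_span[OF spaces(1)[OF assms]] fin_dim_space_finite_span[OF spaces(3)[OF assms]]
    zero_mean_finite_span[OF Om(5) spaces(5)[OF assms]] zero_mean_finite_span[OF Om(5) spaces(1)[OF assms]]
  by (simp_all add: P0_def S0_def)

lemma states:
  assumes "l \<le> n"
  shows "phist d l \<in> Sh d l" "ust d l \<in> Vh d l" "pist d l \<in> P0 d l" "within_bounds d (phist d l)"
    "phist d l \<in> L2 (Omega d)" "phist d l \<in> H1 (Omega d)" "ust d l \<in> L2 (Omega d)"
proof -
  have l: "l \<le> n + 1" using assms by simp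
  show "phist d l \<in> Sh d l" "ust d l \<in> Vh d l" "pist d l \<in> P0 d l" "within_bounds d (phist d l)"
    using acc assms by (simp_all add: accepted_states_def)
  then show "phist d l \<in> L2 (Omega d)" "phist d l \<in> H1 (Omega d)" "ust d l \<in> L2 (Omega d)"
    using L2_spaces[OF l] spaces(2)[OF l] by blast+
qed

lemma parameters:
  shows "0 < Cahn d" "0 < Pec d" "0 < Rey d" "0 < Web d" "0 < alphaq d" "0 < CA d" "0 < tau d" "0 < spar d"
    "0 < rho_lo d" "0 < eta_lo d"
  using par by (simp_all add: admissible_parameters_def)

lemma gam_pos: "0 < gam k" "0 < gam k / tau d"
  using parameters(7) by (simp_all add: gam_def)

lemma coefficient_bounds:
  assumes ph: "ph \<in> L2 (Omega d)" and wb: "within_bounds d ph"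
  shows "(\<lambda>x. rho d (ph x)) \<in> borel_measurable (lebesgue_on (Omega d))"
    "(\<lambda>x. eta d (ph x)) \<in> borel_measurable (lebesgue_on (Omega d))"
    "AE x in lebesgue_on (Omega d). rho_lo d \<le> rho d (ph x) \<and> rho d (ph x) \<le> rho_hi d"
    "AE x in lebesgue_on (Omega d). eta_lo d \<le> eta d (ph x) \<and> eta d (ph x) \<le> eta_hi d"
proof -
  show "(\<lambda>x. rho d (ph x)) \<in> borel_measurable (lebesgue_on (Omega d))"
    "(\<lambda>x. eta d (ph x)) \<in> borel_measurable (lebesgue_on (Omega d))"
    unfolding rho_def eta_def using L2_measurable[OF ph] by measurable
  have *: "AE x in lebesgue_on (Omega d). rho_lo d \<le> rho d (ph x) \<and> rho d (ph x) \<le> rho_hi d \<and>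
      eta_lo d \<le> eta d (ph x) \<and> eta d (ph x) \<le> eta_hi d"
    using wb AE_on_iff[OF Om(6)] by (simp add: within_bounds_def)
  show "AE x in lebesgue_on (Omega d). rho_lo d \<le> rho d (ph x) \<and> rho d (ph x) \<le> rho_hi d"
    using * by eventually_elim simp
  show "AE x in lebesgue_on (Omega d). eta_lo d \<le> eta d (ph x) \<and> eta d (ph x) \<le> eta_hi d"
    using * by eventually_elim simp
qed

lemma coefficient_mult_L2:
  assumes ph: "ph \<in> L2 (Omega d)" and wb: "within_bounds d ph" and v: "v \<in> L2 (Omega d)"
  shows "(\<lambda>x. rho d (ph x) *\<^sub>R v x) \<in> L2 (Omega d)" "(\<lambda>x. sqrt (rho d (ph x)) *\<^sub>R v x) \<in> L2 (Omega d)"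
    "(\<lambda>x. eta d (ph x) *\<^sub>R v x) \<in> L2 (Omega d)" "(\<lambda>x. sqrt (eta d (ph x)) *\<^sub>R v x) \<in> L2 (Omega d)"
proof -
  note b = coefficient_bounds[OF ph wb]
  have m: "(\<lambda>x. sqrt (rho d (ph x))) \<in> borel_measurable (lebesgue_on (Omega d))"
    "(\<lambda>x. sqrt (eta d (ph x))) \<in> borel_measurable (lebesgue_on (Omega d))"
    using b(1,2) by measurable
  have "AE x in lebesgue_on (Omega d). \<bar>rho d (ph x)\<bar> \<le> rho_hi d"
    using b(3) by eventually_elim (use parameters(9) in auto)
  then show "(\<lambda>x. rho d (ph x) *\<^sub>R v x) \<in> L2 (Omega d)" by (rule L2_bounded_mult[OF Om(6) v b(1)])
  have "AE x in lebesgue_on (Omega d). \<bar>sqrt (rho d (ph x))\<bar> \<le> sqrt (rho_hi d)"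
    using b(3) by eventually_elim (use parameters(9) in auto)
  then show "(\<lambda>x. sqrt (rho d (ph x)) *\<^sub>R v x) \<in> L2 (Omega d)" by (rule L2_bounded_mult[OF Om(6) v m(1)])
  have "AE x in lebesgue_on (Omega d). \<bar>eta d (ph x)\<bar> \<le> eta_hi d"
    using b(4) by eventually_elim (use parameters(10) in auto)
  then show "(\<lambda>x. eta d (ph x) *\<^sub>R v x) \<in> L2 (Omega d)" by (rule L2_bounded_mult[OF Om(6) v b(2)])
  have "AE x in lebesgue_on (Omega d). \<bar>sqrt (eta d (ph x))\<bar> \<le> sqrt (eta_hi d)"
    using b(4) by eventually_elim (use parameters(10) in auto)
  then show "(\<lambda>x. sqrt (eta d (ph x)) *\<^sub>R v x) \<in> L2 (Omega d)" by (rule L2_bounded_mult[OF Om(6) v m(2)])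
qed

lemma g0_L2: "l \<le> n \<Longrightarrow> g0 d l \<in> L2 (Omega d)"
  unfolding g0_def[abs_def] using states by (intro coefficient_mult_L2(2))

lemma transfer_L2:
  assumes "m \<le> n" "g \<in> L2 (Omega d)"
  shows "transfer d m g \<in> L2 (Omega d)"
proof -
  have t: "if ALE d m then ale_admissible d m {m, m+1} else fin_dim_space (Omega d) (Hist d m) \<and>
      (\<forall>w\<in>Hist d m. piecewise_polynomial (Mesh d (m+1)) w) \<and> proj_admissible d m (g0 d m)"
    using transfers assms(1) unfolding admissible_transfers_def by blast
  show ?thesis
  proof (cases "ALE d m")
    case True
    then have "ale_admissible d m {m, m+1}" using t by simp
    from ale_transfer_L2[OF this _ _ domain assms(2)] show ?thesis by (simp add: transfer_def True)
  next
    case False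
    then show ?thesis
      using remesh_transfer_L2[OF Om(6) _ assms(2)] t by (simp add: transfer_def)
  qed
qed

lemma zetaH_L2: "zetaH d k n \<in> L2 (Omega d)"
proof (cases "k = 1")
  case True
  then show ?thesis using transfer_L2[OF order_refl g0_L2[OF order_refl]] by (simp add: zetaH_def[abs_def])
next
  case False
  then have n: "1 \<le> n" using k kn by auto
  have t: "transfer d (n - 1) (g0 d (n - 1)) \<in> L2 (Omega d)" by (intro transfer_L2 g0_L2) auto
  have "g1 d n \<in> L2 (Omega d)"
    unfolding g1_def[abs_def] by (intro L2_diff[OF Om(6)] L2_scaleR[OF Om(6)] g0_L2 t) simp
  then have "transfer d n (g1 d n) \<in> L2 (Omega d)" by (rule transfer_L2[OF order_refl])
  then have "(\<lambda>x. (2 *\<^sub>R transfer d n (g0 d n) x + transfer d n (g1 d n) x) /\<^sub>R 3) \<in> L2 (Omega d)"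
    using transfer_L2[OF order_refl g0_L2[OF order_refl]]
    by (intro L2_scaleR[OF Om(6)] L2_add[OF Om(6)])
  then show ?thesis using False by (simp add: zetaH_def[abs_def])
qed

lemma uE_L2: "uE d k n \<in> L2 (Omega d)"
  unfolding uE_def[abs_def] histE_def
  using states(7)[of n] states(7)[of "n - 1"] L2_diff[OF Om(6) L2_scaleR[OF Om(6)], of "ust d n" "ust d (n - 1)" 2]
  by (cases "k = 1") simp_all

lemma uhatE_L2:
  assumes "ALE d n"
  shows "uhatE d k n \<in> L2 (RefDom d n)"
proof (cases "k = 1")
  case True
  have "ale_admissible d n {n, n+1}" using transfers assms unfolding admissible_transfers_def by auto
  from uhat_L2[OF this _ domain states(7)] True show ?thesis by (simp add: uhatE_def[abs_def] histE_def)
next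
  case False
  then have ale: "ale_admissible d n {n-1, n, n+1}"
    using transfers assms k unfolding admissible_transfers_def by auto
  note R = polyhedral_domainD[OF ale_admissibleD(1)[OF ale]]
  have "uhat d n n \<in> L2 (RefDom d n)" "uhat d n (n - 1) \<in> L2 (RefDom d n)"
    by (intro uhat_L2[OF ale _ domain states(7)]; simp)+
  from L2_diff[OF R(6) L2_scaleR[OF R(6) this(1)] this(2), of 2] False
  show ?thesis by (simp add: uhatE_def[abs_def] histE_def)
qed

lemma cns_in_bilinear: "bilinear_on_set (H1 (Omega d)) (H1 (Omega d)) (cns_in d)"
  unfolding cns_in_def
proof (rule bilinear_on_setI)
  note wl = ae_linear_on_wgrad[OF Om(1,5)]
  note H = H1_subspace[OF Om(5)]
  have sub: "H1 (Omega d) \<subseteq> L2 (Omega d)" using H1_L2 by blast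
  fix w :: "'d sfun" assume w: "w \<in> H1 (Omega d)"
  show "linear_on_set (H1 (Omega d)) (\<lambda>v. (Cahn d)\<^sup>2 * l2in (Omega d) (wgrad (Omega d) v) (wgrad (Omega d) w)
      + spar d * l2in (Omega d) v w)"
    using w by (intro linear_on_set_plus linear_on_set_cmult linear_on_l2in_op_left[OF Om(6) wl H]
        L2_inner_integrable[OF Om(6)] wgrad_L2 linear_on_set_mono[OF linear_on_l2in_left[OF Om(6) H1_L2] sub])
  show "linear_on_set (H1 (Omega d)) (\<lambda>v. (Cahn d)\<^sup>2 * l2in (Omega d) (wgrad (Omega d) w) (wgrad (Omega d) v)
      + spar d * l2in (Omega d) w v)"
    using w by (intro linear_on_set_plus linear_on_set_cmult linear_on_l2in_op_right[OF Om(6) wl H]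
        L2_inner_integrable[OF Om(6)] wgrad_L2 linear_on_set_mono[OF linear_on_l2in_right[OF Om(6) H1_L2] sub])
qed

lemma bilinear_on_set_mono:
  "bilinear_on_set V W b \<Longrightarrow> V' \<subseteq> V \<Longrightarrow> W' \<subseteq> W \<Longrightarrow> bilinear_on_set V' W' b"
  unfolding bilinear_on_set_def by (meson linear_on_set_mono subsetD)

lemma cns_in_nonneg: "0 \<le> cns_in d f f"
  using parameters(8) by (simp add: cns_in_def l2in_nonneg)

lemma cns_in_eq_0:
  assumes "f \<in> Sh d (n + 1)" "cns_in d f f = 0"
  shows "f = 0"
proof -
  have "spar d * l2in (Omega d) f f = 0"
    using assms(2) parameters(8) l2in_nonneg[of "Omega d" f] l2in_nonneg[of "Omega d" "wgrad (Omega d) f"]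
    by (simp add: cns_in_def add_nonneg_eq_0_iff)
  then have "l2in (Omega d) f f = 0" using parameters(8) by simp
  then show ?thesis
    using fin_dim_space_l2in_eq_0[OF Om(6) spaces(1)[OF order_refl]] assms(1) by blast
qed

text \<open>The old phase fields live on their own meshes, so their combination need not lie in the
  new discrete space; the load of the projection is therefore treated on all of
  \<open>H1\<close>.\<close>

lemma phiH_old_H1: "phiH_old d k n \<in> H1 (Omega d)"
proof -
  note H = H1_subspace[OF Om(5)]
  have "phist d n \<in> H1 (Omega d)" "phist d (n - 1) \<in> H1 (Omega d)" by (auto intro: states)
  from this(1) subspace_scale[OF H subspace_diff[OF H subspace_scale[OF H this(1)] this(2)], of "inverse 3" 4]
  show ?thesis
    by (cases "k = 1") (simp_all add: phiH_old_def[abs_def] histH_def fun_vec_defs)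
qed

lemma phase_history_ex1: "\<exists>!phiH. phase_history d k n phiH"
  unfolding phase_history_def
proof (rule form_solution_unique_pos)
  note b = bilinear_on_setD[OF bilinear_on_set_mono[OF cns_in_bilinear spaces(2)[OF order_refl] spaces(2)[OF order_refl]]]
  show "finite_span (Sh d (n + 1))" by (rule finite_span_spaces) simp
  show "linear_on_set (Sh d (n + 1)) (\<lambda>u. cns_in d u w)" if "w \<in> Sh d (n + 1)" for w by (rule b(1)[OF that])
  show "linear_on_set (Sh d (n + 1)) (cns_in d u)" if "u \<in> Sh d (n + 1)" for u by (rule b(2)[OF that])
  show "linear_on_set (Sh d (n + 1)) (cns_in d (phiH_old d k n))"
    by (rule linear_on_set_mono[OF bilinear_on_setD(2)[OF cns_in_bilinear phiH_old_H1] spaces(2)[OF order_refl]])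
  show "u = 0" if "u \<in> Sh d (n + 1)" "cns_in d u u = 0" for u by (rule cns_in_eq_0[OF that])
qed

text \<open>Covers both carrier problems: on the reference domain with load \<open>uhatE\<close>,
  and on \<open>Omega d\<close> with load \<open>uE\<close>. The zero mean removes the constants,
  which are the kernel of the Dirichlet form on a connected domain.\<close>

lemma zero_mean_poisson_ex1:
  assumes A: "polyhedral_domain A" and M: "fin_dim_space A M" "M \<subseteq> H1 A" and g: "g \<in> L2 A"
  shows "\<exists>!u. u \<in> zero_mean A M \<and>
    (\<forall>\<theta>\<in>zero_mean A M. l2in A (wgrad A u) (wgrad A \<theta>) = l2in A g (wgrad A \<theta>))"
proof -
  note A' = polyhedral_domainD[OF A]
  have sub: "zero_mean A M \<subseteq> H1 A" using M(2) by (auto simp: zero_mean_def)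
  note fs = zero_mean_finite_span[OF A'(5) M(1)]
  note lin = ae_linear_on_mono[OF ae_linear_on_wgrad[OF A'(1,5)] sub]
  show ?thesis
  proof (rule form_solution_unique_pos[OF fs])
    show "linear_on_set (zero_mean A M) (\<lambda>u. l2in A (wgrad A u) (wgrad A w))" if "w \<in> zero_mean A M" for w
      using that sub by (intro linear_on_l2in_op_left[OF A'(6) lin finite_span_subspace[OF fs]]
          L2_inner_integrable[OF A'(6)] wgrad_L2) auto
    show "linear_on_set (zero_mean A M) (\<lambda>w. l2in A (wgrad A u) (wgrad A w))" if "u \<in> zero_mean A M" for u
      using that sub by (intro linear_on_l2in_op_right[OF A'(6) lin finite_span_subspace[OF fs]]
          L2_inner_integrable[OF A'(6)] wgrad_L2) auto
    show "linear_on_set (zero_mean A M) (\<lambda>w. l2in A g (wgrad A w))"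
      using sub by (intro linear_on_l2in_op_right[OF A'(6) lin finite_span_subspace[OF fs]]
          L2_inner_integrable[OF A'(6)] wgrad_L2 g) auto
    show "u = 0" if "u \<in> zero_mean A M" "l2in A (wgrad A u) (wgrad A u) = 0" for u
      by (rule zero_mean_zero_wgrad_eq_0[OF A'(1,2,5,4) M that])
  qed
qed

lemma carrier_potential_ex1: "\<exists>!lam. carrier_potential d k n lam"
proof (cases "ALE d n")
  case True
  then have "ale_admissible d n {n, n+1}" using transfers unfolding admissible_transfers_def by auto
  note ale = ale_admissibleD[OF this]
  show ?thesis
    unfolding carrier_potential_def if_P[OF True]
    by (rule zero_mean_poisson_ex1[OF ale(1,3,4) uhatE_L2[OF True]])
next
  case False
  show ?thesis
    unfolding carrier_potential_def if_not_P[OF False] S0_def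
    by (rule zero_mean_poisson_ex1[OF domain spaces(1,2)[OF order_refl] uE_L2])
qed

lemma finite_integralsD:
  shows "\<theta> \<in> Sh d (n+1) \<Longrightarrow> integrable (lebesgue_on (Omega d)) (\<lambda>x. dGE d k n x \<bullet> \<theta> x)"
    "\<mu> \<in> Sh d (n+1) \<Longrightarrow> \<omega> \<in> Sh d (n+1) \<Longrightarrow>
      integrable (lebesgue_on (Omega d)) (\<lambda>x. (mE d k n x *\<^sub>R wgrad (Omega d) \<mu> x) \<bullet> wgrad (Omega d) \<omega> x)"
    "\<phi> \<in> Sh d (n+1) \<Longrightarrow> \<mu> \<in> Sh d (n+1) \<Longrightarrow> v \<in> Vh d (n+1) \<Longrightarrow>
      integrable (lebesgue_on (Omega d)) (\<lambda>x. (\<phi> x *\<^sub>R wgrad (Omega d) \<mu> x) \<bullet> v x)"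
    "carrier_potential d k n lam \<Longrightarrow> \<omega> \<in> Sh d (n+1) \<Longrightarrow>
      integrable (lebesgue_on (Omega d)) (\<lambda>x. (phiE d k n x *\<^sub>R carrier d k n lam x) \<bullet> wgrad (Omega d) \<omega> x)"
    "carrier_potential d k n lam \<Longrightarrow> \<phi> \<in> Sh d (n+1) \<Longrightarrow> \<mu> \<in> Sh d (n+1) \<Longrightarrow> v \<in> Vh d (n+1) \<Longrightarrow>
      z \<in> Vh d (n+1) \<Longrightarrow> integrable (lebesgue_on (Omega d)) (\<lambda>x. advect d k n (carrier d k n lam) \<phi> \<mu> v x \<bullet> z x)"
  using fin unfolding finite_integrals_def Let_def set_integrable_iff_on[OF Om(6)] inner_real_def
  by blast+

lemma phase_sav_ex1:
  assumes phiH: "phiH \<in> Sh d (n+1)" and lam: "carrier_potential d k n lam"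
  shows "\<exists>!(phi, mu, r). phase_sav d k n phiH (carrier d k n lam) phi mu r"
proof -
  define S where "S = Sh d (n+1)"
  define M where "M mu \<omega> = l2in (Omega d) (\<lambda>x. mE d k n x *\<^sub>R wgrad (Omega d) mu x) (wgrad (Omega d) \<omega>)" for mu \<omega>
  define R where "R \<omega> = l2in (Omega d) (\<lambda>x. phiE d k n x *\<^sub>R carrier d k n lam x) (wgrad (Omega d) \<omega>)" for \<omega>
  define c where "c = gam k / tau d"
  note fi = finite_integralsD[folded S_def]
  have S: "finite_span S" "S \<subseteq> H1 (Omega d)" "S \<subseteq> L2 (Omega d)"
    unfolding S_def using finite_span_spaces spaces L2_spaces by auto
  note sS = finite_span_subspace[OF S(1)]
  note wl = ae_linear_on_mono[OF ae_linear_on_wgrad[OF Om(1,5)] S(2)]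
  have U: "0 < UE d k n" unfolding UE_def using UE2 by simp
  have "\<exists>!(phi, mu, r). phi \<in> S \<and> mu \<in> S \<and>
    (\<forall>\<omega>\<in>S. c * l2in (Omega d) (phi - phiH) \<omega> - R \<omega> + 1 / Pec d * M mu \<omega> = 0) \<and>
    (\<forall>\<theta>\<in>S. l2in (Omega d) mu \<theta> = cns_in d phi \<theta> + r / UE d k n * l2in (Omega d) (dGE d k n) \<theta>) \<and>
    c * (r - histH k (rst d) n) = 1 / (2 * UE d k n) * (c * l2in (Omega d) (dGE d k n) (phi - phiH))"
  \<comment> \<open>The \<open>L2\<close> product plays the role of the coupling form and
    \<open>cns_in\<close> that of the definite stiffness. The mobility may degenerate, so
    \<open>M\<close> is only semidefinite.\<close>
  proof (rule phase_sav_system_unique[OF S(1)])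
    show "bilinear_on_set S S (l2in (Omega d))"
      using S(3) by (intro bilinear_on_setI linear_on_set_mono[OF linear_on_l2in_left[OF Om(6)] S(3)]
          linear_on_set_mono[OF linear_on_l2in_right[OF Om(6)] S(3)]) auto
    show "bilinear_on_set S S M"
      unfolding M_def
      by (intro bilinear_on_setI linear_on_l2in_op_left[OF Om(6) ae_linear_on_mult[OF wl] sS]
          linear_on_l2in_op_right[OF Om(6) wl sS] fi(2))
    show "bilinear_on_set S S (cns_in d)" by (rule bilinear_on_set_mono[OF cns_in_bilinear S(2,2)])
    show "linear_on_set S (l2in (Omega d) (dGE d k n))"
      by (intro linear_on_l2in_op_right[OF Om(6) ae_linear_on_id sS] fi(1))
    show "linear_on_set S R"
      unfolding R_def by (intro linear_on_l2in_op_right[OF Om(6) wl sS] fi(4)[OF lam])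
    show "phiH \<in> S" using phiH by (simp add: S_def)
    show "0 < UE d k n" by (rule U)
    show "0 < c" using gam_pos by (simp add: c_def)
    show "0 < 1 / Pec d" using parameters(2) by simp
    show "l2in (Omega d) u v = l2in (Omega d) v u" for u v :: "'d sfun" by (rule l2in_commute)
    show "u = 0" if "u \<in> S" "l2in (Omega d) u u = 0" for u
      using fin_dim_space_l2in_eq_0[OF Om(6) spaces(1)[OF order_refl] _ that(2)] that(1) by (simp add: S_def)
    show "0 \<le> M u u" for u
      unfolding M_def l2in_eq[OF Om(6)]
    proof (rule integral_nonneg_AE)
      show "AE x in lebesgue_on (Omega d). 0 \<le> (mE d k n x *\<^sub>R wgrad (Omega d) u x) \<bullet> wgrad (Omega d) u x"
        using mobility unfolding AE_on_iff[OF Om(6)] by eventually_elim simp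
    qed
    show "0 \<le> cns_in d u u" for u by (rule cns_in_nonneg)
    show "u = 0" if "u \<in> S" "cns_in d u u = 0" for u
      using cns_in_eq_0 that by (simp add: S_def)
  qed
  \<comment> \<open>The factor \<open>c\<close> stands inside the integrals of
    \<open>phase_sav\<close> and is pulled out to match the abstract system.\<close>
  moreover have e1: "l2in (Omega d) (\<lambda>x. c * (phi x - phiH x)) \<omega> = c * l2in (Omega d) (phi - phiH) \<omega>" for phi \<omega>
    using l2in_scale_left[OF Om(6), of c "phi - phiH"] by (simp add: fun_diff_def)
  moreover have e2: "l2in (Omega d) (dGE d k n) (\<lambda>x. c * (phi x - phiH x)) = c * l2in (Omega d) (dGE d k n) (phi - phiH)" for phi
    using l2in_scale_right[OF Om(6), of _ c "phi - phiH"] by (simp add: fun_diff_def)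
  ultimately show ?thesis
    unfolding phase_sav_def Let_def c_def[symmetric] S_def[symmetric] M_def[symmetric] R_def[symmetric]
      cns_in_def[symmetric]
    by (simp only: add.assoc)
qed

lemma steps_1_to_3_ex1: "\<exists>!(phiH, lam, phi, mu, r). steps_1_to_3 d k n phiH lam phi mu r"
proof -
  obtain phiH where phiH: "phase_history d k n phiH" "\<And>p. phase_history d k n p \<Longrightarrow> p = phiH"
    using phase_history_ex1 by blast
  obtain lam where lam: "carrier_potential d k n lam" "\<And>l. carrier_potential d k n l \<Longrightarrow> l = lam"
    using carrier_potential_ex1 by blast
  have "phiH \<in> Sh d (n+1)" using phiH(1) by (simp add: phase_history_def)
  from phase_sav_ex1[OF this lam(1)] obtain phi mu r where sav: "phase_sav d k n phiH (carrier d k n lam) phi mu r"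
    "\<forall>a b c. phase_sav d k n phiH (carrier d k n lam) a b c \<longrightarrow> a = phi \<and> b = mu \<and> c = r"
    unfolding ex1_triple by (elim exE conjE)
  show ?thesis
  proof (rule ex1I[of _ "(phiH, lam, phi, mu, r)"])
    show "case (phiH, lam, phi, mu, r) of (phiH, lam, phi, mu, r) \<Rightarrow> steps_1_to_3 d k n phiH lam phi mu r"
      using phiH(1) lam(1) sav(1) by (simp add: steps_1_to_3_def)
    fix z assume z: "case z of (phiH, lam, phi, mu, r) \<Rightarrow> steps_1_to_3 d k n phiH lam phi mu r"
    obtain p l a b c where z_eq: "z = (p, l, a, b, c)" by (cases z)
    have *: "phase_history d k n p" "carrier_potential d k n l" "phase_sav d k n p (carrier d k n l) a b c"
      using z by (simp_all add: z_eq steps_1_to_3_def)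
    have "p = phiH" "l = lam" by (rule phiH(2)[OF *(1)], rule lam(2)[OF *(2)])
    then show "z = (phiH, lam, phi, mu, r)"
      using *(3) sav(2) by (simp add: z_eq)
  qed
qed

end

section \<open>The positive root, the modified energy and the discrete gradient\<close>

lemma unique_positive_root:
  fixes a b c :: real
  assumes "0 < a" "0 < c"
  shows "\<exists>!q. 0 < q \<and> a * q\<^sup>2 + b * q - c = 0"
proof (rule ex_ex1I)
  define s where "s = sqrt (b\<^sup>2 + 4 * a * c)"
  have "b\<^sup>2 < b\<^sup>2 + 4 * a * c" using assms by simp
  \<comment> \<open>The discriminant exceeds \<open>b\<^sup>2\<close> because \<open>a * c\<close>
    is positive; hence \<open>(s - b) / (2 * a)\<close> is positive for either sign of
    \<open>b\<close>.\<close>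
  then have "\<bar>b\<bar> < s" unfolding s_def using real_sqrt_less_mono[of "b\<^sup>2"] by simp
  moreover have "s\<^sup>2 = b\<^sup>2 + 4 * a * c" unfolding s_def using assms by simp
  ultimately have "0 < (s - b) / (2 * a) \<and> a * ((s - b) / (2 * a))\<^sup>2 + b * ((s - b) / (2 * a)) - c = 0"
    using assms(1) by (auto simp: power2_eq_square field_simps)
  then show "\<exists>q. 0 < q \<and> a * q\<^sup>2 + b * q - c = 0" by blast
next
  fix q q' assume q: "0 < q \<and> a * q\<^sup>2 + b * q - c = 0" and q': "0 < q' \<and> a * q'\<^sup>2 + b * q' - c = 0"
  \<comment> \<open>Multiplying each equation by the other root and subtracting cancels
    \<open>b\<close>; what remains is \<open>q - q'\<close> times a positive number.\<close>
  have "(q - q') * (a * (q * q') + c) = q' * (a * q\<^sup>2 + b * q - c) - q * (a * q'\<^sup>2 + b * q' - c)"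
    by (simp add: power2_eq_square algebra_simps)
  also have "\<dots> = 0" using q q' by simp
  finally have "(q - q') * (a * (q * q') + c) = 0" .
  moreover have "0 < a * (q * q') + c" using assms q q' by (simp add: add_pos_pos)
  ultimately show "q = q'" by simp
qed

context scheme_step
begin

text \<open>The quadratic terms are merely nonnegative and may all vanish; the shift
  \<open>CA d\<close> makes the energy strictly positive, and with it \<open>Cq\<close>.\<close>

lemma Ephir_pos: "0 < Ephir d k l"
proof -
  have cns: "0 \<le> cns_norm2 d f" for f
    using parameters(8) by (simp add: cns_norm2_def)
  have w: "0 < Web d * Cahn d" using parameters by simp
  show ?thesis
    using parameters(1,4,6) w cns
    by (cases "k = 1")
      (auto simp: Ephir_def intro!: add_nonneg_pos add_nonneg_nonneg mult_nonneg_nonneg divide_nonneg_nonneg)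
qed

text \<open>The definite description in \<open>dgrad\<close> denotes because the density-weighted
  mass form is definite on \<open>Vh\<close>: the density is at least \<open>rho_lo d > 0\<close>
  almost everywhere. The third part is the uniqueness by which \<open>dgrad\<close> of a combination
  is computed.\<close>

lemma dgrad_works:
  assumes l: "l \<le> n + 1" and ph: "ph \<in> L2 (Omega d)" "within_bounds d ph" and pr: "pr \<in> P0 d l"
  shows "dgrad d l ph pr \<in> Vh d l"
    and "v \<in> Vh d l \<Longrightarrow> l2in (Omega d) (\<lambda>x. rho d (ph x) *\<^sub>R dgrad d l ph pr x) v = - l2in (Omega d) pr (wdiv (Omega d) v)"
    and "g \<in> Vh d l \<Longrightarrow> (\<And>v. v \<in> Vh d l \<Longrightarrow>
      l2in (Omega d) (\<lambda>x. rho d (ph x) *\<^sub>R g x) v = - l2in (Omega d) pr (wdiv (Omega d) v)) \<Longrightarrow> dgrad d l ph pr = g"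
proof -
  note V = finite_span_spaces(2)[OF l] and sub = L2_spaces(2)[OF l] and H = spaces(4)[OF l]
  note sV = finite_span_subspace[OF V]
  have L: "v \<in> L2 (Omega d)" "v \<in> H1v (Omega d)" if "v \<in> Vh d l" for v using that sub H by auto
  have piL: "pr \<in> L2 (Omega d)" using pr L2_spaces(4)[OF l] by blast
  have ex1: "\<exists>!g. g \<in> Vh d l \<and> (\<forall>v\<in>Vh d l. l2in (Omega d) (\<lambda>x. rho d (ph x) *\<^sub>R g x) v
    = - 1 * l2in (Omega d) pr (wdiv (Omega d) v))"
  proof (rule form_solution_unique_pos[OF V])
    show "linear_on_set (Vh d l) (\<lambda>g. l2in (Omega d) (\<lambda>x. rho d (ph x) *\<^sub>R g x) v)" if "v \<in> Vh d l" for v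
      using that by (intro linear_on_l2in_op_left[OF Om(6) ae_linear_on_mult[OF ae_linear_on_id] sV]
          L2_inner_integrable[OF Om(6)] coefficient_mult_L2(1)[OF ph] L)
    show "linear_on_set (Vh d l) (l2in (Omega d) (\<lambda>x. rho d (ph x) *\<^sub>R g x))" if "g \<in> Vh d l" for g
      using that by (intro linear_on_set_mono[OF linear_on_l2in_right[OF Om(6)] sub] coefficient_mult_L2(1)[OF ph] L)
    \<comment> \<open>The minus sign is written as a factor so that the rule for multiples applies;
      \<open>neg\<close> removes it afterwards.\<close>
    show "linear_on_set (Vh d l) (\<lambda>v. - 1 * l2in (Omega d) pr (wdiv (Omega d) v))"
      by (intro linear_on_set_cmult linear_on_l2in_op_right[OF Om(6) ae_linear_on_mono[OF ae_linear_on_wdiv[OF Om(1,5)] H] sV]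
          L2_inner_integrable[OF Om(6)] piL wdiv_L2[OF Om(6)] L)
    fix g assume g: "g \<in> Vh d l" and zero: "l2in (Omega d) (\<lambda>x. rho d (ph x) *\<^sub>R g x) g = 0"
    have "AE x in lebesgue_on (Omega d). (rho d (ph x) *\<^sub>R g x) \<bullet> g x = 0"
    proof (rule integral_nonneg_eq_0_iff_AE[THEN iffD1])
      show "integrable (lebesgue_on (Omega d)) (\<lambda>x. (rho d (ph x) *\<^sub>R g x) \<bullet> g x)"
        by (intro L2_inner_integrable[OF Om(6)] coefficient_mult_L2(1)[OF ph] L g)
      show "AE x in lebesgue_on (Omega d). 0 \<le> (rho d (ph x) *\<^sub>R g x) \<bullet> g x"
        using coefficient_bounds(3)[OF ph] by eventually_elim (use parameters(9) in simp)
      show "(LINT x|lebesgue_on (Omega d). (rho d (ph x) *\<^sub>R g x) \<bullet> g x) = 0"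
        using zero by (simp add: l2in_eq[OF Om(6)])
    qed
    then have "AE x in lebesgue_on (Omega d). g x = 0"
      using coefficient_bounds(3)[OF ph] by eventually_elim (use parameters(9) in auto)
    then show "g = 0" by (rule fin_dim_space_eq_0[OF Om(6) spaces(3)[OF l] g])
  qed
  have neg: "- 1 * x = - x" for x :: real by simp
  note ex1' = ex1[unfolded neg]
  show "dgrad d l ph pr \<in> Vh d l"
    "v \<in> Vh d l \<Longrightarrow> l2in (Omega d) (\<lambda>x. rho d (ph x) *\<^sub>R dgrad d l ph pr x) v = - l2in (Omega d) pr (wdiv (Omega d) v)"
    using theI'[OF ex1'] unfolding dgrad_def by blast+
  show "dgrad d l ph pr = g" if "g \<in> Vh d l" "\<And>v. v \<in> Vh d l \<Longrightarrow>
      l2in (Omega d) (\<lambda>x. rho d (ph x) *\<^sub>R g x) v = - l2in (Omega d) pr (wdiv (Omega d) v)"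
    unfolding dgrad_def using that by (intro the1_equality[OF ex1']) blast
qed

lemma dgrad_L2:
  assumes "l \<le> n + 1" "ph \<in> L2 (Omega d)" "within_bounds d ph" "pr \<in> P0 d l"
  shows "dgrad d l ph pr \<in> L2 (Omega d)"
  using dgrad_works(1)[OF assms] L2_spaces(2)[OF assms(1)] by blast

lemma dgrad_add_scale:
  assumes l: "l \<le> n + 1" and ph: "ph \<in> L2 (Omega d)" "within_bounds d ph"
  shows "pr \<in> P0 d l \<Longrightarrow> pr' \<in> P0 d l \<Longrightarrow> dgrad d l ph (pr + pr') = dgrad d l ph pr + dgrad d l ph pr'"
    and "pr \<in> P0 d l \<Longrightarrow> dgrad d l ph (c *\<^sub>R pr) = c *\<^sub>R dgrad d l ph pr"
proof -
  note sP = finite_span_subspace[OF finite_span_spaces(3)[OF l]]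
  note sV = finite_span_subspace[OF finite_span_spaces(2)[OF l]]
  note W = dgrad_works[OF l ph]
  have L: "v \<in> L2 (Omega d)" "v \<in> H1v (Omega d)" if "v \<in> Vh d l" for v
    using that L2_spaces(2)[OF l] spaces(4)[OF l] by auto
  have PL: "pr \<in> L2 (Omega d)" if "pr \<in> P0 d l" for pr using that L2_spaces(4)[OF l] by blast
  have lin1: "linear_on_set (Vh d l) (\<lambda>g. l2in (Omega d) (\<lambda>x. rho d (ph x) *\<^sub>R g x) v)" if "v \<in> Vh d l" for v
    using that by (intro linear_on_l2in_op_left[OF Om(6) ae_linear_on_mult[OF ae_linear_on_id] sV]
        L2_inner_integrable[OF Om(6)] coefficient_mult_L2(1)[OF ph] L)
  have lin2: "linear_on_set (L2 (Omega d)) (\<lambda>pr. l2in (Omega d) pr (wdiv (Omega d) v))" if "v \<in> Vh d l" for v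
    by (rule linear_on_l2in_left[OF Om(6) wdiv_L2[OF Om(6) L(2)[OF that]]])
  show "dgrad d l ph (pr + pr') = dgrad d l ph pr + dgrad d l ph pr'" if pr: "pr \<in> P0 d l" "pr' \<in> P0 d l"
  proof (rule W(3)[OF subspace_add[OF sP pr] subspace_add[OF sV W(1)[OF pr(1)] W(1)[OF pr(2)]]])
    fix v assume v: "v \<in> Vh d l"
    show "l2in (Omega d) (\<lambda>x. rho d (ph x) *\<^sub>R (dgrad d l ph pr + dgrad d l ph pr') x) v
      = - l2in (Omega d) (pr + pr') (wdiv (Omega d) v)"
      using linear_on_set_add[OF lin1[OF v] W(1)[OF pr(1)] W(1)[OF pr(2)]]
        linear_on_set_add[OF lin2[OF v] PL[OF pr(1)] PL[OF pr(2)]] W(2)[OF pr(1) v] W(2)[OF pr(2) v] by simp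
  qed
  show "dgrad d l ph (c *\<^sub>R pr) = c *\<^sub>R dgrad d l ph pr" if pr: "pr \<in> P0 d l"
  proof (rule W(3)[OF subspace_scale[OF sP pr] subspace_scale[OF sV W(1)[OF pr]]])
    fix v assume v: "v \<in> Vh d l"
    show "l2in (Omega d) (\<lambda>x. rho d (ph x) *\<^sub>R (c *\<^sub>R dgrad d l ph pr) x) v
      = - l2in (Omega d) (c *\<^sub>R pr) (wdiv (Omega d) v)"
      using linear_on_set_scale[OF lin1[OF v] W(1)[OF pr], of c]
        linear_on_set_scale[OF lin2[OF v] PL[OF pr], of c] W(2)[OF pr v] by simp
  qed
qed

lemma ae_linear_on_dgrad:
  assumes "l \<le> n + 1" "ph \<in> L2 (Omega d)" "within_bounds d ph"
  shows "ae_linear_on (Omega d) (P0 d l) (dgrad d l ph)"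
  unfolding ae_linear_on_def using dgrad_add_scale[OF assms] by (simp add: fun_vec_defs)

lemma xi_p_L2: "xi_p d n \<in> L2 (Omega d)"
proof -
  have g: "(\<lambda>x. sqrt (rho d (phist d n x)) *\<^sub>R dgrad d n (phist d n) (pist d n) x) \<in> L2 (Omega d)"
    by (intro coefficient_mult_L2(2) dgrad_L2 states) simp_all
  show ?thesis
  proof (cases "ALE d n")
    case True
    then show ?thesis using transfer_L2[OF order_refl g] by (simp add: xi_p_def transfer_def Let_def)
  next
    case False
    then show ?thesis using g by (simp add: xi_p_def Let_def)
  qed
qed

lemma divergence_bilinear:
  "bilinear_on_set (P0 d (n + 1)) (Vh d (n + 1)) (\<lambda>p v. l2in (Omega d) p (wdiv (Omega d) v))"
proof -
  note V = finite_span_subspace[OF finite_span_spaces(2)[OF order_refl]]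
  have L: "v \<in> H1v (Omega d)" if "v \<in> Vh d (n + 1)" for v using that spaces(4)[OF order_refl] by auto
  have PL: "pr \<in> L2 (Omega d)" if "pr \<in> P0 d (n + 1)" for pr using that L2_spaces(4)[OF order_refl] by blast
  show ?thesis
    by (intro bilinear_on_setI linear_on_set_mono[OF linear_on_l2in_left[OF Om(6)] L2_spaces(4)[OF order_refl]]
        linear_on_l2in_op_right[OF Om(6) ae_linear_on_mono[OF ae_linear_on_wdiv[OF Om(1,5)] spaces(4)[OF order_refl]] V]
        L2_inner_integrable[OF Om(6)] wdiv_L2[OF Om(6)] L PL)
qed

text \<open>If \<open>p\<close> annihilates all divergences, every quotient in the supremum is 0, so
  the supremum is at most 0; this includes a trivial \<open>Vh\<close>, where it is minus infinity.
  A positive \<open>\<beta>\<close> below it is impossible.\<close>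

lemma inf_sup_injective:
  assumes p: "p \<in> P0 d (n + 1)" and zero: "\<And>v. v \<in> Vh d (n + 1) \<Longrightarrow> l2in (Omega d) p (wdiv (Omega d) v) = 0"
  shows "p = 0"
proof (rule ccontr)
  assume "p \<noteq> 0"
  then have p': "p \<in> P0 d (n + 1) - {\<lambda>_. 0}" using p by (simp add: zero_fun_def)
  obtain \<beta> where \<beta>: "0 < \<beta>" "ereal \<beta> \<le> (INF \<alpha>\<in>P0 d (n + 1) - {\<lambda>_. 0}. SUP v\<in>Vh d (n + 1) - {\<lambda>_. 0}.
         ereal (l2in (Omega d) \<alpha> (wdiv (Omega d) v) / (h1norm (Omega d) v * l2norm (Omega d) \<alpha>)))"
    using inf_sup unfolding inf_sup_condition_def by blast
  note \<beta>(2)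
  also have "(INF \<alpha>\<in>P0 d (n + 1) - {\<lambda>_. 0}. SUP v\<in>Vh d (n + 1) - {\<lambda>_. 0}.
         ereal (l2in (Omega d) \<alpha> (wdiv (Omega d) v) / (h1norm (Omega d) v * l2norm (Omega d) \<alpha>)))
      \<le> (SUP v\<in>Vh d (n + 1) - {\<lambda>_. 0}.
         ereal (l2in (Omega d) p (wdiv (Omega d) v) / (h1norm (Omega d) v * l2norm (Omega d) p)))"
    by (rule INF_lower[OF p'])
  also have "\<dots> \<le> 0"
    by (rule SUP_least) (use zero in simp)
  finally show False using \<beta>(1) by simp
qed

end

section \<open>Momentum, pressure and scalar problems for given phase data\<close>

locale momentum_step = scheme_step d k n for d :: "('d::finite) scheme" and k n +
  fixes lam phi mu :: "'d sfun"
  assumes lam: "carrier_potential d k n lam" and phi: "phi \<in> Sh d (n+1)" and mu: "mu \<in> Sh d (n+1)"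
    and bounds: "within_bounds d phi"
begin

text \<open>\<open>momentum_lhs\<close> is affine in the velocity because of the history
  \<open>zetaH\<close>; its linear part is separated here, and the history term goes to the
  right-hand side \<open>load\<close>.\<close>

definition mform :: "'d vfun \<Rightarrow> 'd vfun \<Rightarrow> real"
  where "mform u v = gam k / tau d *
      l2in (Omega d) (\<lambda>x. sqrt (rho d (phi x)) *\<^sub>R u x) (\<lambda>x. sqrt (rho d (phi x)) *\<^sub>R v x)
    + Crho d k n (carrier d k n lam) phi mu u v
    + 2 / Rey d * l2in (Omega d) (\<lambda>x. eta d (phi x) *\<^sub>R symgrad (Omega d) u x) (symgrad (Omega d) v)"

definition load :: "real \<Rightarrow> 'd vfun \<Rightarrow> real"
  where "load q v = gam k / tau d * l2in (Omega d) (zetaH d k n) (\<lambda>x. sqrt (rho d (phi x)) *\<^sub>R v x)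
    + l2in (Omega d) (force d (n+1)) v - q / (Web d * Cahn d) * capillary d phi mu v"

lemma phi_L2: "phi \<in> L2 (Omega d)"
  using phi L2_spaces(1)[OF order_refl] by blast

lemma V_fields:
  assumes "v \<in> Vh d (n+1)"
  shows "v \<in> L2 (Omega d)" "v \<in> H1v (Omega d)" "symgrad (Omega d) v \<in> L2 (Omega d)"
    "wdiv (Omega d) v \<in> L2 (Omega d)"
proof -
  show "v \<in> L2 (Omega d)" "v \<in> H1v (Omega d)"
    using assms spaces(4)[OF order_refl] L2_spaces(2)[OF order_refl] by blast+
  then show "symgrad (Omega d) v \<in> L2 (Omega d)" "wdiv (Omega d) v \<in> L2 (Omega d)"
    by (auto intro: symgrad_L2[OF Om(6)] wdiv_L2[OF Om(6)])
qed

lemmas coeff = coefficient_mult_L2[OF phi_L2 bounds]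
lemmas V_span = finite_span_spaces(2)[OF order_refl]
lemmas V_subspace = finite_span_subspace[OF V_span]
lemmas P_span = finite_span_spaces(3)[OF order_refl]
lemmas P_subspace = finite_span_subspace[OF P_span]
lemmas V_H1v = spaces(4)[OF order_refl]
lemmas advect_integrable = finite_integralsD(5)[OF lam phi mu]
lemmas advect_linear = ae_linear_on_mono[OF ae_linear_on_advect[OF Om(1,5)] V_H1v]
lemmas symgrad_linear = ae_linear_on_mono[OF ae_linear_on_symgrad[OF Om(1,5)] V_H1v]

lemma mform_bilinear: "bilinear_on_set (Vh d (n+1)) (Vh d (n+1)) mform"
  unfolding mform_def Crho_def
  by (intro bilinear_on_setI linear_on_set_plus linear_on_set_cmult linear_on_set_minus;
      intro linear_on_l2in_op_left[OF Om(6) ae_linear_on_mult[OF ae_linear_on_id] V_subspace]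
        linear_on_l2in_op_right[OF Om(6) ae_linear_on_mult[OF ae_linear_on_id] V_subspace]
        linear_on_l2in_op_left[OF Om(6) advect_linear V_subspace]
        linear_on_l2in_op_right[OF Om(6) advect_linear V_subspace]
        linear_on_l2in_op_left[OF Om(6) ae_linear_on_mult[OF symgrad_linear] V_subspace]
        linear_on_l2in_op_right[OF Om(6) symgrad_linear V_subspace]
        linear_on_l2in_op_left[OF Om(6) ae_linear_on_id V_subspace]
        linear_on_l2in_op_right[OF Om(6) ae_linear_on_id V_subspace]
        L2_inner_integrable[OF Om(6)] coeff V_fields advect_integrable; assumption)

end

text \<open>\<open>a\<close> and \<open>b\<close> stand for the solutions at \<open>q = 0\<close>
  and \<open>q = 1\<close>. The interpolant solves for every \<open>q\<close>, uniqueness leaves no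
  other solution, and evaluation at 0 and 1 recovers the coefficients.\<close>

lemma affine_family_ex1:
  fixes R :: "real \<Rightarrow> ('a \<Rightarrow> 'b::real_vector) \<Rightarrow> bool"
  assumes unique: "\<And>q u u'. R q u \<Longrightarrow> R q u' \<Longrightarrow> u = u'"
    and comb: "\<And>q. R q (a + q *\<^sub>R (b - a))"
  shows "\<exists>!(u0, u1). \<forall>q u. R q u \<longleftrightarrow> u = (\<lambda>x. u0 x + q *\<^sub>R u1 x)"
proof -
  have sol: "R q u \<longleftrightarrow> u = (\<lambda>x. a x + q *\<^sub>R (b - a) x)" for q u
    using unique comb[of q] by (auto simp: fun_vec_defs)
  show ?thesis
  proof (rule ex1I[of _ "(a, b - a)"])
    show "case (a, b - a) of (u0, u1) \<Rightarrow> \<forall>q u. R q u \<longleftrightarrow> u = (\<lambda>x. u0 x + q *\<^sub>R u1 x)"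
      using sol by simp
    fix z assume z: "case z of (u0, u1) \<Rightarrow> \<forall>q u. R q u \<longleftrightarrow> u = (\<lambda>x. u0 x + q *\<^sub>R u1 x)"
    obtain u0 u1 where z_eq: "z = (u0, u1)" by (cases z)
    have eq: "(\<lambda>x. u0 x + q *\<^sub>R u1 x) = (\<lambda>x. a x + q *\<^sub>R (b - a) x)" for q
      using z sol unfolding z_eq by simp
    have "u0 = a" using eq[of 0] by simp
    moreover have "u1 = b - a" using fun_cong[OF eq[of 1]] \<open>u0 = a\<close> by (intro ext) (simp add: algebra_simps)
    ultimately show "z = (a, b - a)" by (simp add: z_eq)
  qed
qed

context momentum_step
begin

lemma mform_diag:
  assumes u: "u \<in> Vh d (n+1)"
  shows "mform u u = gam k / tau d * (l2norm (Omega d) (\<lambda>x. sqrt (rho d (phi x)) *\<^sub>R u x))\<^sup>2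
    + 2 / Rey d * (l2norm (Omega d) (\<lambda>x. sqrt (eta d (phi x)) *\<^sub>R symgrad (Omega d) u x))\<^sup>2"
proof -
  note D = V_fields(3)[OF u]
  \<comment> \<open>Splitting \<open>eta\<close> into square roots is legitimate where its lower
    bound holds, hence only almost everywhere. The convective part cancels since \<open>Crho\<close>
    vanishes on equal arguments.\<close>
  have "l2in (Omega d) (\<lambda>x. eta d (phi x) *\<^sub>R symgrad (Omega d) u x) (symgrad (Omega d) u)
    = l2in (Omega d) (\<lambda>x. sqrt (eta d (phi x)) *\<^sub>R symgrad (Omega d) u x)
        (\<lambda>x. sqrt (eta d (phi x)) *\<^sub>R symgrad (Omega d) u x)"
  proof (rule l2in_cong_AE[OF Om(6) L2_inner_integrable[OF Om(6) coeff(3)[OF D] D]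
        L2_inner_integrable[OF Om(6) coeff(4)[OF D] coeff(4)[OF D]]])
    show "AE x in lebesgue_on (Omega d). (eta d (phi x) *\<^sub>R symgrad (Omega d) u x) \<bullet> symgrad (Omega d) u x
      = (sqrt (eta d (phi x)) *\<^sub>R symgrad (Omega d) u x) \<bullet> (sqrt (eta d (phi x)) *\<^sub>R symgrad (Omega d) u x)"
      using coefficient_bounds(4)[OF phi_L2 bounds]
    proof eventually_elim
      case (elim x)
      then have "sqrt (eta d (phi x)) * sqrt (eta d (phi x)) = eta d (phi x)" using parameters(10) by simp
      then show ?case by (simp add: mult.assoc[symmetric])
    qed
  qed
  then show ?thesis by (simp add: mform_def Crho_def l2norm_power2)
qed

text \<open>The inertial term alone is definite on \<open>Vh\<close>; the viscous term only adds
  something nonnegative, so no Korn inequality enters.\<close>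

lemma mform_pos:
  assumes u: "u \<in> Vh d (n+1)" and zero: "mform u u = 0"
  shows "u = 0"
proof -
  define r where "r = (l2norm (Omega d) (\<lambda>x. sqrt (rho d (phi x)) *\<^sub>R u x))\<^sup>2"
  define e where "e = 2 / Rey d * (l2norm (Omega d) (\<lambda>x. sqrt (eta d (phi x)) *\<^sub>R symgrad (Omega d) u x))\<^sup>2"
  have "gam k / tau d * r + e = 0" using zero mform_diag[OF u] by (simp add: r_def e_def)
  moreover have "0 \<le> r" "0 \<le> e" using parameters(3) by (simp_all add: r_def e_def)
  moreover have "0 \<le> gam k / tau d * r" using gam_pos(2) \<open>0 \<le> r\<close> by (rule mult_nonneg_nonneg[OF less_imp_le])
  ultimately have "gam k / tau d * r = 0" by linarith
  then have "l2in (Omega d) (\<lambda>x. sqrt (rho d (phi x)) *\<^sub>R u x) (\<lambda>x. sqrt (rho d (phi x)) *\<^sub>R u x) = 0"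
    using gam_pos(1) parameters(7) by (simp add: r_def l2norm_power2)
  then have "AE x in lebesgue_on (Omega d). sqrt (rho d (phi x)) *\<^sub>R u x = 0"
    by (intro l2in_eq_0_imp[OF Om(6)] coeff(2) V_fields(1)[OF u])
  then have "AE x in lebesgue_on (Omega d). u x = 0"
    using coefficient_bounds(3)[OF phi_L2 bounds] by eventually_elim (use parameters(9) in auto)
  then show ?thesis by (rule fin_dim_space_eq_0[OF Om(6) spaces(3)[OF order_refl] u])
qed

lemma load_linear: "linear_on_set (Vh d (n+1)) (load q)"
  unfolding load_def capillary_def
  by (intro linear_on_set_minus linear_on_set_plus linear_on_set_cmult
      linear_on_l2in_op_right[OF Om(6) ae_linear_on_mult[OF ae_linear_on_id] V_subspace]
      linear_on_l2in_op_right[OF Om(6) ae_linear_on_id V_subspace]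
      L2_inner_integrable[OF Om(6)] zetaH_L2 coeff force V_fields finite_integralsD(3)[OF phi mu])

lemma load_affine: "load q v = load 0 v - q / (Web d * Cahn d) * capillary d phi mu v"
  by (simp add: load_def)

lemma momentum_lhs_eq:
  assumes "u \<in> Vh d (n+1)" "v \<in> Vh d (n+1)"
  shows "momentum_lhs d k n (carrier d k n lam) phi mu u v
    = mform u v - gam k / tau d * l2in (Omega d) (zetaH d k n) (\<lambda>x. sqrt (rho d (phi x)) *\<^sub>R v x)"
proof -
  have "l2in (Omega d) (\<lambda>x. sqrt (rho d (phi x)) *\<^sub>R u x - zetaH d k n x) (\<lambda>x. sqrt (rho d (phi x)) *\<^sub>R v x)
    = l2in (Omega d) (\<lambda>x. sqrt (rho d (phi x)) *\<^sub>R u x) (\<lambda>x. sqrt (rho d (phi x)) *\<^sub>R v x)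
      - l2in (Omega d) (zetaH d k n) (\<lambda>x. sqrt (rho d (phi x)) *\<^sub>R v x)"
    using assms by (intro l2in_diff_left[OF Om(6)] L2_inner_integrable[OF Om(6)] coeff V_fields zetaH_L2)
  then show ?thesis by (simp add: momentum_lhs_def mform_def right_diff_distrib)
qed

lemma saddle_momentum_iff:
  "saddle_momentum d k n (carrier d k n lam) phi mu q u p \<longleftrightarrow>
    u \<in> Vh d (n+1) \<and> p \<in> P0 d (n+1) \<and>
    (\<forall>v\<in>Vh d (n+1). mform u v - l2in (Omega d) p (wdiv (Omega d) v) = load q v) \<and>
    (\<forall>\<alpha>\<in>P0 d (n+1). l2in (Omega d) \<alpha> (wdiv (Omega d) u) = 0)"
proof (cases "u \<in> Vh d (n+1)")
  case True
  have "(momentum_lhs d k n (carrier d k n lam) phi mu u v - l2in (Omega d) p (wdiv (Omega d) v)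
      = l2in (Omega d) (force d (n+1)) v - q / (Web d * Cahn d) * capillary d phi mu v) \<longleftrightarrow>
    mform u v - l2in (Omega d) p (wdiv (Omega d) v) = load q v" if "v \<in> Vh d (n+1)" for v
    unfolding momentum_lhs_eq[OF True that] load_def by linarith
  then show ?thesis
    unfolding saddle_momentum_def Let_def by (simp add: l2in_commute[of "Omega d" "wdiv (Omega d) u"] cong: ball_cong)
next
  case False
  then show ?thesis by (simp add: saddle_momentum_def Let_def)
qed

lemma saddle_momentum_ex1: "\<exists>!(u, p). saddle_momentum d k n (carrier d k n lam) phi mu q u p"
  unfolding saddle_momentum_iff
  by (rule saddle_point_unique[OF V_span P_span mform_bilinear divergence_bilinear load_linear])
    (auto intro: mform_pos inf_sup_injective)

lemma pc_momentum_iff: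
  "pc_momentum d k n (carrier d k n lam) phi mu pibar q u \<longleftrightarrow> u \<in> Vh d (n+1) \<and>
    (\<forall>v\<in>Vh d (n+1). mform u v = load q v + l2in (Omega d) pibar (wdiv (Omega d) v))"
proof (cases "u \<in> Vh d (n+1)")
  case True
  have "(momentum_lhs d k n (carrier d k n lam) phi mu u v = l2in (Omega d) pibar (wdiv (Omega d) v)
      + l2in (Omega d) (force d (n+1)) v - q / (Web d * Cahn d) * capillary d phi mu v) \<longleftrightarrow>
    mform u v = load q v + l2in (Omega d) pibar (wdiv (Omega d) v)" if "v \<in> Vh d (n+1)" for v
    unfolding momentum_lhs_eq[OF True that] load_def by linarith
  then show ?thesis unfolding pc_momentum_def Let_def by (simp cong: ball_cong)
next
  case False
  then show ?thesis by (simp add: pc_momentum_def Let_def)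
qed

lemma pc_momentum_ex1:
  assumes "pibar \<in> P0 d (n+1)"
  shows "\<exists>!u. pc_momentum d k n (carrier d k n lam) phi mu pibar q u"
  unfolding pc_momentum_iff
  by (rule form_solution_unique_pos[OF V_span bilinear_on_setD[OF mform_bilinear]
        linear_on_set_plus[OF load_linear bilinear_on_setD(2)[OF divergence_bilinear assms]] mform_pos])

lemma mform_comb:
  assumes "u \<in> Vh d (n+1)" "u' \<in> Vh d (n+1)" "v \<in> Vh d (n+1)"
  shows "mform (u + q *\<^sub>R (u' - u)) v = mform u v + q * (mform u' v - mform u v)"
proof -
  note lin = bilinear_on_setD(1)[OF mform_bilinear assms(3)]
  have "u' - u \<in> Vh d (n+1)" by (rule subspace_diff[OF V_subspace assms(2,1)])
  then show ?thesis
    using subspace_scale[OF V_subspace] assms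
    by (simp add: linear_on_set_add[OF lin] linear_on_set_scale[OF lin] linear_on_set_diff[OF lin V_subspace])
qed

text \<open>Velocity and pressure at \<open>q = 0\<close> and \<open>q = 1\<close> are interpolated
  together: \<open>load\<close> is affine in \<open>q\<close>, while \<open>mform\<close> and the
  divergence form do not contain \<open>q\<close>.\<close>

lemma saddle_affine_ex1: "\<exists>!(u0, u1). saddle_affine d k n (carrier d k n lam) phi mu u0 u1"
proof -
  let ?M = "saddle_momentum d k n (carrier d k n lam) phi mu"
  have unique: "u = u' \<and> p = p'" if "?M q u p" "?M q u' p'" for q u u' p p'
    using saddle_momentum_ex1[of q] that by auto
  obtain u p where 0: "?M 0 u p" using saddle_momentum_ex1[of 0] by auto
  obtain u' p' where 1: "?M 1 u' p'" using saddle_momentum_ex1[of 1] by auto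
  have "?M q (u + q *\<^sub>R (u' - u)) (p + q *\<^sub>R (p' - p))" for q
    unfolding saddle_momentum_iff
  proof (intro conjI ballI)
    have u: "u \<in> Vh d (n+1)" "u' \<in> Vh d (n+1)" and p: "p \<in> P0 d (n+1)" "p' \<in> P0 d (n+1)"
      using 0 1 by (auto simp: saddle_momentum_iff)
    note du = subspace_diff[OF V_subspace u(2,1)] and dp = subspace_diff[OF P_subspace p(2,1)]
    show "u + q *\<^sub>R (u' - u) \<in> Vh d (n+1)"
      by (intro subspace_add[OF V_subspace] subspace_scale[OF V_subspace] u du)
    show "p + q *\<^sub>R (p' - p) \<in> P0 d (n+1)"
      by (intro subspace_add[OF P_subspace] subspace_scale[OF P_subspace] p dp)
    fix v assume v: "v \<in> Vh d (n+1)"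
    note lin = bilinear_on_setD(1)[OF divergence_bilinear v]
    have "l2in (Omega d) (p + q *\<^sub>R (p' - p)) (wdiv (Omega d) v) = l2in (Omega d) p (wdiv (Omega d) v)
      + q * (l2in (Omega d) p' (wdiv (Omega d) v) - l2in (Omega d) p (wdiv (Omega d) v))"
      using subspace_scale[OF P_subspace dp] p dp
      by (simp add: linear_on_set_add[OF lin] linear_on_set_scale[OF lin] linear_on_set_diff[OF lin P_subspace])
    moreover have "mform u v - l2in (Omega d) p (wdiv (Omega d) v) = load 0 v"
      "mform u' v - l2in (Omega d) p' (wdiv (Omega d) v) = load 1 v"
      using 0 1 v by (auto simp: saddle_momentum_iff)
    moreover have "load q v = load 0 v + q * (load 1 v - load 0 v)"
      using load_affine[of q v] load_affine[of 1 v] by simp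
    ultimately show "mform (u + q *\<^sub>R (u' - u)) v - l2in (Omega d) (p + q *\<^sub>R (p' - p)) (wdiv (Omega d) v) = load q v"
      using mform_comb[OF u v, of q] by (simp add: algebra_simps)
  next
    have u: "u \<in> Vh d (n+1)" "u' \<in> Vh d (n+1)" using 0 1 by (auto simp: saddle_momentum_iff)
    note du = subspace_diff[OF V_subspace u(2,1)]
    fix \<alpha> assume \<alpha>: "\<alpha> \<in> P0 d (n+1)"
    note lin = bilinear_on_setD(2)[OF divergence_bilinear \<alpha>]
    show "l2in (Omega d) \<alpha> (wdiv (Omega d) (u + q *\<^sub>R (u' - u))) = 0"
      using 0 1 \<alpha> subspace_scale[OF V_subspace du] u du
      by (simp add: saddle_momentum_iff linear_on_set_add[OF lin] linear_on_set_scale[OF lin] linear_on_set_diff[OF lin V_subspace])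
  qed
  then show ?thesis
    unfolding saddle_affine_def
    by (intro affine_family_ex1[where a=u and b=u']) (use unique in blast)+
qed

text \<open>\<open>pibar\<close> is fixed before \<open>q\<close> is known, so its load is the same
  at 0 and 1 and survives the interpolation unchanged.\<close>

lemma pc_affine_ex1:
  assumes pibar: "pibar \<in> P0 d (n+1)"
  shows "\<exists>!(u0, u1). pc_affine d k n (carrier d k n lam) phi mu pibar u0 u1"
proof -
  let ?M = "pc_momentum d k n (carrier d k n lam) phi mu pibar"
  obtain u where 0: "?M 0 u" using pc_momentum_ex1[OF pibar, of 0] by auto
  obtain u' where 1: "?M 1 u'" using pc_momentum_ex1[OF pibar, of 1] by auto
  have "?M q (u + q *\<^sub>R (u' - u))" for q
    unfolding pc_momentum_iff
  proof (intro conjI ballI)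
    have u: "u \<in> Vh d (n+1)" "u' \<in> Vh d (n+1)" using 0 1 by (auto simp: pc_momentum_iff)
    show "u + q *\<^sub>R (u' - u) \<in> Vh d (n+1)"
      by (intro subspace_add[OF V_subspace] subspace_scale[OF V_subspace] subspace_diff[OF V_subspace] u)
    fix v assume v: "v \<in> Vh d (n+1)"
    have "mform u v = load 0 v + l2in (Omega d) pibar (wdiv (Omega d) v)"
      "mform u' v = load 1 v + l2in (Omega d) pibar (wdiv (Omega d) v)"
      using 0 1 v by (auto simp: pc_momentum_iff)
    moreover have "load q v = load 0 v + q * (load 1 v - load 0 v)"
      using load_affine[of q v] load_affine[of 1 v] by simp
    ultimately show "mform (u + q *\<^sub>R (u' - u)) v = load q v + l2in (Omega d) pibar (wdiv (Omega d) v)"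
      using mform_comb[OF u v, of q] by (simp add: algebra_simps)
  qed
  then show ?thesis
    unfolding pc_affine_def
    by (intro affine_family_ex1[where a=u and b=u']) (use pc_momentum_ex1[OF pibar] in blast)+
qed

text \<open>The affine families provide solutions at \<open>q = 0\<close> and \<open>q = 1\<close>
  only; the coefficient \<open>w = u1\<close> and its equation are recovered from their
  difference.\<close>

lemma mform_diff_eq:
  assumes "u \<in> Vh d (n+1)" "(\<lambda>x. u x + w x) \<in> Vh d (n+1)" "v \<in> Vh d (n+1)"
  shows "w \<in> Vh d (n+1)" "mform w v = mform (\<lambda>x. u x + w x) v - mform u v"
proof -
  have w: "w = (\<lambda>x. u x + w x) - u" by (simp add: fun_diff_def)
  show "w \<in> Vh d (n+1)" by (subst w) (rule subspace_diff[OF V_subspace assms(2,1)])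
  show "mform w v = mform (\<lambda>x. u x + w x) v - mform u v"
    using linear_on_set_diff[OF bilinear_on_setD(1)[OF mform_bilinear assms(3)] V_subspace assms(2,1)] w by simp
qed

text \<open>Subtracting the momentum equations at \<open>q = 1\<close> and \<open>q = 0\<close>
  leaves the capillary load as the only datum. As a difference of discretely divergence-free fields
  \<open>u1\<close> is of this kind too, so testing with it removes both pressures.\<close>

lemma saddle_affine_energy:
  assumes aff: "saddle_affine d k n (carrier d k n lam) phi mu u0 u1"
  shows "u0 \<in> Vh d (n+1)" "u1 \<in> Vh d (n+1)" "mform u1 u1 = - capillary d phi mu u1 / (Web d * Cahn d)"
proof -
  obtain p0 where 0: "saddle_momentum d k n (carrier d k n lam) phi mu 0 u0 p0"
    using aff unfolding saddle_affine_def by (metis (no_types, lifting) add.right_neutral scale_zero_left ext)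
  obtain p1 where 1: "saddle_momentum d k n (carrier d k n lam) phi mu 1 (\<lambda>x. u0 x + u1 x) p1"
    using aff unfolding saddle_affine_def by (metis (no_types, lifting) scaleR_one ext)
  have s: "(\<lambda>x. u0 x + u1 x) \<in> Vh d (n+1)" using 1 by (simp add: saddle_momentum_iff)
  show u0: "u0 \<in> Vh d (n+1)" using 0 by (simp add: saddle_momentum_iff)
  show u1: "u1 \<in> Vh d (n+1)" by (rule mform_diff_eq(1)[OF u0 s u0])
  have p: "p0 \<in> P0 d (n+1)" "p1 \<in> P0 d (n+1)" using 0 1 by (auto simp: saddle_momentum_iff)
  have div: "l2in (Omega d) p (wdiv (Omega d) u1) = 0" if "p \<in> P0 d (n+1)" for p
  proof -
    note lin = bilinear_on_setD(2)[OF divergence_bilinear that]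
    have "l2in (Omega d) p (wdiv (Omega d) (u0 + u1)) = 0" "l2in (Omega d) p (wdiv (Omega d) u0) = 0"
      using 0 1 that by (auto simp: saddle_momentum_iff plus_fun_def)
    then show ?thesis using linear_on_set_add[OF lin u0 u1] by simp
  qed
  have "mform u0 u1 = load 0 u1" "mform (\<lambda>x. u0 x + u1 x) u1 = load 1 u1"
    using 0 1 u1 div[OF p(1)] div[OF p(2)] by (auto simp: saddle_momentum_iff)
  then show "mform u1 u1 = - capillary d phi mu u1 / (Web d * Cahn d)"
    using mform_diff_eq(2)[OF u0 s u1] load_affine[of 1 u1] by simp
qed

text \<open>Here \<open>u1\<close> need not be divergence-free, but the predicted pressure is the
  same at \<open>q = 0\<close> and \<open>q = 1\<close> and cancels in the difference.\<close>

lemma pc_affine_energy: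
  assumes aff: "pc_affine d k n (carrier d k n lam) phi mu pibar u0 u1"
  shows "u0 \<in> Vh d (n+1)" "u1 \<in> Vh d (n+1)" "mform u1 u1 = - capillary d phi mu u1 / (Web d * Cahn d)"
proof -
  have 0: "pc_momentum d k n (carrier d k n lam) phi mu pibar 0 u0"
    using aff unfolding pc_affine_def by simp
  have 1: "pc_momentum d k n (carrier d k n lam) phi mu pibar 1 (\<lambda>x. u0 x + u1 x)"
    using aff unfolding pc_affine_def by simp
  have s: "(\<lambda>x. u0 x + u1 x) \<in> Vh d (n+1)" using 1 by (simp add: pc_momentum_iff)
  show u0: "u0 \<in> Vh d (n+1)" using 0 by (simp add: pc_momentum_iff)
  show u1: "u1 \<in> Vh d (n+1)" by (rule mform_diff_eq(1)[OF u0 s u0])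
  have "mform u0 u1 = load 0 u1 + l2in (Omega d) pibar (wdiv (Omega d) u1)"
    "mform (\<lambda>x. u0 x + u1 x) u1 = load 1 u1 + l2in (Omega d) pibar (wdiv (Omega d) u1)"
    using 0 1 u1 by (auto simp: pc_momentum_iff)
  then show "mform u1 u1 = - capillary d phi mu u1 / (Web d * Cahn d)"
    using mform_diff_eq(2)[OF u0 s u1] load_affine[of 1 u1] by simp
qed

lemma capillary_affine:
  assumes "u0 \<in> Vh d (n+1)" "u1 \<in> Vh d (n+1)"
  shows "capillary d phi mu (\<lambda>x. u0 x + q *\<^sub>R u1 x) = capillary d phi mu u0 + q * capillary d phi mu u1"
proof -
  have lin: "linear_on_set (Vh d (n+1)) (capillary d phi mu)"
    unfolding capillary_def
    by (intro linear_on_l2in_op_right[OF Om(6) ae_linear_on_id V_subspace] finite_integralsD(3)[OF phi mu])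
  have "(\<lambda>x. u0 x + q *\<^sub>R u1 x) = u0 + q *\<^sub>R u1" by (simp add: fun_vec_defs)
  then show ?thesis
    using linear_on_set_add[OF lin assms(1) subspace_scale[OF V_subspace assms(2)]]
      linear_on_set_scale[OF lin assms(2)] by simp
qed

text \<open>Testing the difference of two momentum equations with \<open>u\<^sub>1\<close> identifies the quadratic part of
  the capillary work with the dissipation in \<open>A\<^sub>q\<close>; the convective form drops out by antisymmetry.\<close>

lemma scalar_eq_iff_root:
  assumes u: "u0 \<in> Vh d (n+1)" "u1 \<in> Vh d (n+1)"
    and energy: "mform u1 u1 = - capillary d phi mu u1 / (Web d * Cahn d)"
  shows "scalar_eq d k n uc phi mu (\<lambda>x. u0 x + q *\<^sub>R u1 x) q \<longleftrightarrow> q_root d k n uc phi mu u0 u1 q"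
proof -
  define X where "X = l2in (Omega d) (\<lambda>x. phiE d k n x *\<^sub>R uc x) (wgrad (Omega d) mu)"
  define c0 where "c0 = capillary d phi mu u0 / (Web d * Cahn d)"
  define c1 where "c1 = capillary d phi mu u1 / (Web d * Cahn d)"
  define E where "E = Ephir d k n"
  have t: "tau d \<noteq> 0" "alphaq d \<noteq> 0" using parameters by auto
  \<comment> \<open>By \<open>energy\<close>, \<open>- c1\<close> is the dissipation of
    \<open>u1\<close>; so the part of the capillary term quadratic in \<open>q\<close> raises the
    leading coefficient instead of threatening its sign.\<close>
  have A: "Aq d k phi u1 = gam k / alphaq d - tau d * c1"
  proof -
    have "Aq d k phi u1 = gam k / alphaq d + tau d * mform u1 u1"
      using t by (simp add: Aq_def mform_diag[OF u(2)] distrib_left)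
    then show ?thesis using energy by (simp add: c1_def)
  qed
  have B: "Bq d k n uc phi mu u0 = - (gam k / alphaq d) * histH k (qst d) n + E
      + tau d * (X / (Web d * Cahn d)) - tau d * c0"
    by (simp add: Bq_def X_def c0_def E_def)
  have C: "Cq d k n = qst d n * E" by (simp add: Cq_def E_def)
  have "scalar_eq d k n uc phi mu (\<lambda>x. u0 x + q *\<^sub>R u1 x) q \<longleftrightarrow>
    gam k * q / (alphaq d * tau d) * (q - histH k (qst d) n) + (q - qst d n) / tau d * E
      + q * (X / (Web d * Cahn d)) - q * (c0 + q * c1) = 0"
    by (simp add: scalar_eq_def capillary_affine[OF u] X_def c0_def c1_def E_def add_divide_distrib distrib_left)
  \<comment> \<open>Multiplication by the positive time step clears it from the denominators; the
    result is compared coefficientwise with \<open>Aq\<close>, \<open>Bq\<close> and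
    \<open>Cq\<close>.\<close>
  also have "\<dots> \<longleftrightarrow> tau d * (gam k * q / (alphaq d * tau d) * (q - histH k (qst d) n) + (q - qst d n) / tau d * E
      + q * (X / (Web d * Cahn d)) - q * (c0 + q * c1)) = 0"
    using t by simp
  also have "tau d * (gam k * q / (alphaq d * tau d) * (q - histH k (qst d) n) + (q - qst d n) / tau d * E
      + q * (X / (Web d * Cahn d)) - q * (c0 + q * c1))
    = gam k * q / alphaq d * (q - histH k (qst d) n) + (q - qst d n) * E
      + tau d * (q * (X / (Web d * Cahn d))) - tau d * (q * (c0 + q * c1))"
    using t by (simp add: distrib_left right_diff_distrib)
  also have "\<dots> = Aq d k phi u1 * q\<^sup>2 + Bq d k n uc phi mu u0 * q - Cq d k n"
    unfolding A B C by (simp add: power2_eq_square algebra_simps diff_divide_distrib)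
  finally show ?thesis by (simp add: q_root_def)
qed

text \<open>\<open>Aq\<close> is at least \<open>gam k / alphaq d > 0\<close>, and \<open>Cq\<close>
  is positive as a product of the accepted \<open>q\<close> and the shifted energy;
  \<open>Bq\<close> may have either sign.\<close>

lemma q_root_ex1: "\<exists>!q. 0 < q \<and> q_root d k n uc phi mu u0 u1 q"
  unfolding q_root_def
proof (rule unique_positive_root)
  have "0 < gam k / alphaq d" using gam_pos(1) parameters(5) by simp
  moreover have "0 \<le> gam k * (l2norm (Omega d) (\<lambda>x. sqrt (rho d (phi x)) *\<^sub>R u1 x))\<^sup>2"
    using gam_pos(1) by simp
  moreover have "0 \<le> 2 * tau d / Rey d * (l2norm (Omega d) (\<lambda>x. sqrt (eta d (phi x)) *\<^sub>R symgrad (Omega d) u1 x))\<^sup>2"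
    using parameters(3,7) by simp
  ultimately show "0 < Aq d k phi u1" unfolding Aq_def by linarith
  show "0 < Cq d k n" using q_pos Ephir_pos by (simp add: Cq_def)
qed

text \<open>The transported, predicted and corrected pressures solve problems with this same
  left-hand side and different loads.\<close>

lemma pressure_problem_ex1:
  assumes pos: "pressure_form_pos_def d (n+1) phi" and l: "linear_on_set (P0 d (n+1)) l"
  shows "\<exists>!p. p \<in> P0 d (n+1) \<and> (\<forall>\<alpha>\<in>P0 d (n+1). pressure_form d (n+1) phi p \<alpha> = l \<alpha>)"
proof (rule form_solution_unique_pos[OF P_span _ _ l])
  note dl = ae_linear_on_dgrad[OF order_refl phi_L2 bounds]
  note dL = dgrad_L2[OF order_refl phi_L2 bounds]
  show "linear_on_set (P0 d (n+1)) (\<lambda>u. pressure_form d (n+1) phi u w)" if "w \<in> P0 d (n+1)" for w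
    unfolding pressure_form_def using that
    by (intro linear_on_l2in_op_left[OF Om(6) ae_linear_on_mult[OF dl] P_subspace]
        L2_inner_integrable[OF Om(6)] coeff dL)
  show "linear_on_set (P0 d (n+1)) (pressure_form d (n+1) phi u)" if "u \<in> P0 d (n+1)" for u
    unfolding pressure_form_def using that
    by (intro linear_on_l2in_op_right[OF Om(6) dl P_subspace] L2_inner_integrable[OF Om(6)] coeff dL)
  show "u = 0" if "u \<in> P0 d (n+1)" "pressure_form d (n+1) phi u u = 0" for u
    using pos that by (force simp: pressure_form_pos_def_def zero_fun_def)
qed

lemma pressure_load_linear:
  assumes "h \<in> L2 (Omega d)"
  shows "linear_on_set (P0 d (n+1)) (\<lambda>\<alpha>. l2in (Omega d) h (\<lambda>x. sqrt (rho d (phi x)) *\<^sub>R dgrad d (n+1) phi \<alpha> x))"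
  using assms
  by (intro linear_on_l2in_op_right[OF Om(6) ae_linear_on_mult[OF ae_linear_on_dgrad[OF order_refl phi_L2 bounds]] P_subspace]
      L2_inner_integrable[OF Om(6)] coeff dgrad_L2[OF order_refl phi_L2 bounds])

lemma pc_transported_ex1:
  "pressure_form_pos_def d (n+1) phi \<Longrightarrow> \<exists>!p. pc_transported d n phi p"
  unfolding pc_transported_def by (rule pressure_problem_ex1[OF _ pressure_load_linear[OF xi_p_L2]])

lemma pc_predicted_ex1:
  "pressure_form_pos_def d (n+1) phi \<Longrightarrow> \<exists>!p. pc_predicted d k n phi p"
  unfolding pc_predicted_def
  by (rule pressure_problem_ex1[OF _ pressure_load_linear])
    (assumption, intro L2_add[OF Om(6)] L2_scaleR[OF Om(6)] xi_p_L2 zetaH_L2)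

lemma pc_correction_ex1:
  assumes "pressure_form_pos_def d (n+1) phi" "u \<in> Vh d (n+1)"
  shows "\<exists>!p. pc_correction d k n phi u p"
  unfolding pc_correction_def
  by (rule pressure_problem_ex1[OF assms(1)])
    (intro linear_on_set_cmult linear_on_set_mono[OF linear_on_l2in_right[OF Om(6)] L2_spaces(4)[OF order_refl]]
      V_fields(4) assms(2))

end

section \<open>Assembly of one step of either scheme\<close>

context momentum_step
begin

text \<open>The velocity of any step solution is forced to be the member of the affine family at
  \<open>q\<close>, which turns the scalar equation into the quadratic. Conversely a positive root
  supplies the velocity, and \<open>saddle_affine\<close> a pressure belonging to it.\<close>

lemma saddle_summary:
  assumes steps: "steps_1_to_3 d k n phiH lam phi mu r"
    and aff: "saddle_affine d k n (carrier d k n lam) phi mu u0 u1"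
  shows "scalar_eq d k n (carrier d k n lam) phi mu (\<lambda>x. u0 x + q *\<^sub>R u1 x) q \<longleftrightarrow>
      q_root d k n (carrier d k n lam) phi mu u0 u1 q"
    and "0 < q \<and> q_root d k n (carrier d k n lam) phi mu u0 u1 q \<longleftrightarrow>
      (\<exists>u p. saddle_step d k n phiH lam phi mu r u p q)"
proof -
  show eq: "scalar_eq d k n (carrier d k n lam) phi mu (\<lambda>x. u0 x + q *\<^sub>R u1 x) q \<longleftrightarrow>
      q_root d k n (carrier d k n lam) phi mu u0 u1 q"
    by (rule scalar_eq_iff_root[OF saddle_affine_energy[OF aff]])
  have sol: "(\<exists>p. saddle_momentum d k n (carrier d k n lam) phi mu q u p) \<longleftrightarrow> u = (\<lambda>x. u0 x + q *\<^sub>R u1 x)" for u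
    using aff unfolding saddle_affine_def by blast
  show "0 < q \<and> q_root d k n (carrier d k n lam) phi mu u0 u1 q \<longleftrightarrow>
      (\<exists>u p. saddle_step d k n phiH lam phi mu r u p q)"
  proof
    assume q: "0 < q \<and> q_root d k n (carrier d k n lam) phi mu u0 u1 q"
    obtain p where "saddle_momentum d k n (carrier d k n lam) phi mu q (\<lambda>x. u0 x + q *\<^sub>R u1 x) p"
      using sol by auto
    then have "saddle_step d k n phiH lam phi mu r (\<lambda>x. u0 x + q *\<^sub>R u1 x) p q"
      using q eq steps by (simp add: saddle_step_def Let_def)
    then show "\<exists>u p. saddle_step d k n phiH lam phi mu r u p q" by blast
  next
    assume "\<exists>u p. saddle_step d k n phiH lam phi mu r u p q"
    then obtain u p where s: "0 < q" "saddle_momentum d k n (carrier d k n lam) phi mu q u p"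
      "scalar_eq d k n (carrier d k n lam) phi mu u q"
      by (auto simp: saddle_step_def Let_def)
    have u: "u = (\<lambda>x. u0 x + q *\<^sub>R u1 x)" using sol s(2) by blast
    show "0 < q \<and> q_root d k n (carrier d k n lam) phi mu u0 u1 q"
      using s(1) s(3)[unfolded u] eq by simp
  qed
qed

text \<open>A positive root fixes the tentative velocity; the transported pressure and the
  correction then exist whatever \<open>q\<close> is, so they impose no further condition on the
  root.\<close>

lemma pc_summary:
  assumes steps: "steps_1_to_3 d k n phiH lam phi mu r" and pos: "pressure_form_pos_def d (n+1) phi"
    and pred: "pc_predicted d k n phi pibar"
    and aff: "pc_affine d k n (carrier d k n lam) phi mu pibar u0 u1"
  shows "scalar_eq d k n (carrier d k n lam) phi mu (\<lambda>x. u0 x + q *\<^sub>R u1 x) q \<longleftrightarrow>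
      q_root d k n (carrier d k n lam) phi mu u0 u1 q"
    and "0 < q \<and> q_root d k n (carrier d k n lam) phi mu u0 u1 q \<longleftrightarrow>
      (\<exists>pitr us dpi u p. pc_step d k n phiH lam phi mu r pitr pibar us q dpi u p)"
proof -
  show eq: "scalar_eq d k n (carrier d k n lam) phi mu (\<lambda>x. u0 x + q *\<^sub>R u1 x) q \<longleftrightarrow>
      q_root d k n (carrier d k n lam) phi mu u0 u1 q"
    by (rule scalar_eq_iff_root[OF pc_affine_energy[OF aff]])
  have sol: "pc_momentum d k n (carrier d k n lam) phi mu pibar q u \<longleftrightarrow> u = (\<lambda>x. u0 x + q *\<^sub>R u1 x)" for u
    using aff unfolding pc_affine_def by blast
  show "0 < q \<and> q_root d k n (carrier d k n lam) phi mu u0 u1 q \<longleftrightarrow>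
      (\<exists>pitr us dpi u p. pc_step d k n phiH lam phi mu r pitr pibar us q dpi u p)"
  proof
    assume q: "0 < q \<and> q_root d k n (carrier d k n lam) phi mu u0 u1 q"
    define us where "us = (\<lambda>x. u0 x + q *\<^sub>R u1 x)"
    have us: "pc_momentum d k n (carrier d k n lam) phi mu pibar q us" using sol us_def by simp
    then have "us \<in> Vh d (n+1)" by (simp add: pc_momentum_iff)
    from pc_correction_ex1[OF pos this] obtain dpi where dpi: "pc_correction d k n phi us dpi" by (elim ex1E)
    obtain pitr where "pc_transported d n phi pitr" using pc_transported_ex1[OF pos] by (elim ex1E)
    then have "pc_step d k n phiH lam phi mu r pitr pibar us q dpi
        (\<lambda>x. us x - (tau d / gam k) *\<^sub>R dgrad d (n+1) phi dpi x) (\<lambda>x. pitr x + dpi x)"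
      using q eq steps pred us dpi by (simp add: pc_step_def Let_def us_def)
    then show "\<exists>pitr us dpi u p. pc_step d k n phiH lam phi mu r pitr pibar us q dpi u p" by blast
  next
    assume "\<exists>pitr us dpi u p. pc_step d k n phiH lam phi mu r pitr pibar us q dpi u p"
    then obtain us where s: "0 < q" "pc_momentum d k n (carrier d k n lam) phi mu pibar q us"
      "scalar_eq d k n (carrier d k n lam) phi mu us q"
      unfolding pc_step_def Let_def by blast
    have us: "us = (\<lambda>x. u0 x + q *\<^sub>R u1 x)" using sol s(2) by blast
    show "0 < q \<and> q_root d k n (carrier d k n lam) phi mu u0 u1 q"
      using s(1) s(3)[unfolded us] eq by simp
  qed
qed

lemma saddle_step_ex1:
  assumes steps: "steps_1_to_3 d k n phiH lam phi mu r"
  shows "\<exists>u p q. saddle_step d k n phiH lam phi mu r u p q \<and>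
    (\<forall>u' p' q'. saddle_step d k n phiH lam phi mu r u' p' q' \<longrightarrow> u' = u \<and> p' = p \<and> q' = q)"
proof -
  obtain u0 u1 where aff: "saddle_affine d k n (carrier d k n lam) phi mu u0 u1"
    using saddle_affine_ex1 by auto
  note sum = saddle_summary[OF steps aff]
  from q_root_ex1[of "carrier d k n lam" u0 u1] obtain q where
    q: "0 < q \<and> q_root d k n (carrier d k n lam) phi mu u0 u1 q"
      "\<forall>q'. 0 < q' \<and> q_root d k n (carrier d k n lam) phi mu u0 u1 q' \<longrightarrow> q' = q"
    by (elim ex1E)
  obtain u p where up: "saddle_step d k n phiH lam phi mu r u p q" using q(1) sum(2) by blast
  have "u' = u \<and> p' = p \<and> q' = q" if s: "saddle_step d k n phiH lam phi mu r u' p' q'" for u' p' q'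
  proof -
    have q': "q' = q" using q(2) sum(2)[of q'] s by blast
    have "saddle_momentum d k n (carrier d k n lam) phi mu q u p"
      "saddle_momentum d k n (carrier d k n lam) phi mu q u' p'"
      using up s unfolding q' by (simp_all add: saddle_step_def Let_def)
    then have "(u', p') = (u, p)" using saddle_momentum_ex1[of q] by auto
    with q' show ?thesis by simp
  qed
  with up show ?thesis by blast
qed

text \<open>Uniqueness follows the order of computation: the two pressure problems that do not
  involve \<open>q\<close>, then \<open>q\<close> as the positive root, the tentative velocity, the
  correction, and finally the explicit updates.\<close>

lemma pc_step_ex1:
  assumes steps: "steps_1_to_3 d k n phiH lam phi mu r" and pos: "pressure_form_pos_def d (n+1) phi"
  shows "\<exists>pitr pibar us q dpi u p. pc_step d k n phiH lam phi mu r pitr pibar us q dpi u p \<and>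
    (\<forall>a b c e f g h. pc_step d k n phiH lam phi mu r a b c e f g h \<longrightarrow>
      a = pitr \<and> b = pibar \<and> c = us \<and> e = q \<and> f = dpi \<and> g = u \<and> h = p)"
proof -
  from pc_predicted_ex1[OF pos] obtain pibar where pibar: "pc_predicted d k n phi pibar"
    "\<forall>b. pc_predicted d k n phi b \<longrightarrow> b = pibar"
    by (elim ex1E)
  from pc_transported_ex1[OF pos] obtain pitr where pitr: "pc_transported d n phi pitr"
    "\<forall>a. pc_transported d n phi a \<longrightarrow> a = pitr"
    by (elim ex1E)
  have pb: "pibar \<in> P0 d (n+1)" using pibar(1) by (simp add: pc_predicted_def)
  obtain u0 u1 where aff: "pc_affine d k n (carrier d k n lam) phi mu pibar u0 u1"
    using pc_affine_ex1[OF pb] by auto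
  note sum = pc_summary[OF steps pos pibar(1) aff]
  from q_root_ex1[of "carrier d k n lam" u0 u1] obtain q where
    q: "0 < q \<and> q_root d k n (carrier d k n lam) phi mu u0 u1 q"
      "\<forall>q'. 0 < q' \<and> q_root d k n (carrier d k n lam) phi mu u0 u1 q' \<longrightarrow> q' = q"
    by (elim ex1E)
  obtain a us dpi u p where st: "pc_step d k n phiH lam phi mu r a pibar us q dpi u p"
    using q(1) sum(2) by blast
  have uniq: "a' = a \<and> b = pibar \<and> c = us \<and> e = q \<and> f = dpi \<and> g = u \<and> h = p"
    if s: "pc_step d k n phiH lam phi mu r a' b c e f g h" for a' b c e f g h
  proof -
    have b: "b = pibar" using pibar(2) s by (simp add: pc_step_def Let_def)
    have e: "e = q" using q(2) sum(2)[of e] s unfolding b by blast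
    have "pc_transported d n phi a'" "pc_transported d n phi a"
      using s st by (simp_all add: pc_step_def Let_def)
    then have a: "a' = a" using pitr(2) by blast
    have m: "pc_momentum d k n (carrier d k n lam) phi mu pibar q us"
      "pc_momentum d k n (carrier d k n lam) phi mu pibar q c"
      using st s unfolding b e by (simp_all add: pc_step_def Let_def)
    then have c: "c = us" using pc_momentum_ex1[OF pb, of q] by blast
    have "us \<in> Vh d (n+1)" using m(1) by (simp add: pc_momentum_iff)
    moreover have "pc_correction d k n phi us dpi" "pc_correction d k n phi us f"
      using st s unfolding c by (simp_all add: pc_step_def Let_def)
    ultimately have f: "f = dpi" using pc_correction_ex1[OF pos] by blast
    have "g = u" "h = p" using st s unfolding a c f by (simp_all add: pc_step_def Let_def)
    with a b c e f show ?thesis by simp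
  qed
  show ?thesis by (intro exI, rule conjI[OF st], intro allI impI, rule uniq)
qed

end

theorem theorem4p2:
  fixes d :: "('d::finite) scheme" and k n :: nat
  assumes dim: "CARD('d) = 2 \<or> CARD('d) = 3"
    and k: "k = 1 \<or> k = 2" and kn: "k = 2 \<Longrightarrow> 1 \<le> n"
    and "admissible_parameters d"
    and "discretization d n"
    and "accepted_states d n"
    and "force d (n+1) \<in> L2 (Omega d)"
    and "finite_integrals d k n"
    and "0 < UE2 d k n"
    and i_transfers: "admissible_transfers d k n"
    and i_bounds: "\<And>phiH lam phi mu r. steps_1_to_3 d k n phiH lam phi mu r \<Longrightarrow> within_bounds d phi"
    and i_mobility: "AE x\<in>Omega d in lebesgue. 0 \<le> mE d k n x"
    and i_q: "0 < qst d n"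
    and ii: "inf_sup_condition d (n+1)"
    and iii: "\<And>phiH lam phi mu r. steps_1_to_3 d k n phiH lam phi mu r \<Longrightarrow>
                pressure_form_pos_def d (n+1) phi"
  shows
    "(\<exists>!(phiH, lam, phi, mu, r, u, p, q). saddle_step d k n phiH lam phi mu r u p q) \<and>
     (\<forall>phiH lam phi mu r. steps_1_to_3 d k n phiH lam phi mu r \<longrightarrow>
        (let uc = carrier d k n lam in
         (\<exists>!(u0, u1). saddle_affine d k n uc phi mu u0 u1) \<and>
         (\<forall>u0 u1. saddle_affine d k n uc phi mu u0 u1 \<longrightarrow>
            (\<forall>q. scalar_eq d k n uc phi mu (\<lambda>x. u0 x + q *\<^sub>R u1 x) q \<longleftrightarrow>
                 q_root d k n uc phi mu u0 u1 q) \<and>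
            (\<exists>!q. 0 < q \<and> q_root d k n uc phi mu u0 u1 q) \<and>
            (\<forall>q. 0 < q \<and> q_root d k n uc phi mu u0 u1 q \<longleftrightarrow>
                 (\<exists>u p. saddle_step d k n phiH lam phi mu r u p q))))) \<and>
     (\<exists>!(phiH, lam, phi, mu, r, pitr, pibar, us, q, dpi, u, p).
        pc_step d k n phiH lam phi mu r pitr pibar us q dpi u p) \<and>
     (\<forall>phiH lam phi mu r pibar. steps_1_to_3 d k n phiH lam phi mu r \<and> pc_predicted d k n phi pibar \<longrightarrow>
        (let uc = carrier d k n lam in
         (\<exists>!(u0, u1). pc_affine d k n uc phi mu pibar u0 u1) \<and>
         (\<forall>u0 u1. pc_affine d k n uc phi mu pibar u0 u1 \<longrightarrow>
            (\<forall>q. scalar_eq d k n uc phi mu (\<lambda>x. u0 x + q *\<^sub>R u1 x) q \<longleftrightarrow>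
                 q_root d k n uc phi mu u0 u1 q) \<and>
            (\<exists>!q. 0 < q \<and> q_root d k n uc phi mu u0 u1 q) \<and>
            (\<forall>q. 0 < q \<and> q_root d k n uc phi mu u0 u1 q \<longleftrightarrow>
                 (\<exists>pitr us dpi u p. pc_step d k n phiH lam phi mu r pitr pibar us q dpi u p)))))"
proof -
  interpret scheme_step d k n
    using assms by unfold_locales
  have mom: "momentum_step d k n lam phi mu" if "steps_1_to_3 d k n phiH lam phi mu r" for phiH lam phi mu r
    using that i_bounds[OF that] by unfold_locales (auto simp: steps_1_to_3_def phase_sav_def Let_def)
  obtain z where z: "case z of (phiH, lam, phi, mu, r) \<Rightarrow> steps_1_to_3 d k n phiH lam phi mu r"
    "\<forall>y. (case y of (phiH, lam, phi, mu, r) \<Rightarrow> steps_1_to_3 d k n phiH lam phi mu r) \<longrightarrow> y = z"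
    using steps_1_to_3_ex1 by (elim ex1E)
  obtain phiH lam phi mu r where z_eq: "z = (phiH, lam, phi, mu, r)" by (cases z)
  have steps: "steps_1_to_3 d k n phiH lam phi mu r" using z(1) by (simp add: z_eq)
  \<comment> \<open>Any full solution contains a solution of Steps 1 to 3, so its first five entries
    are fixed and only uniqueness for given phase data remains.\<close>
  have steps_unique: "a = phiH \<and> b = lam \<and> c = phi \<and> e = mu \<and> f = r"
    if "steps_1_to_3 d k n a b c e f" for a b c e f
    using z(2)[rule_format, of "(a, b, c, e, f)"] that by (simp add: z_eq)
  show ?thesis
  proof (intro conjI allI impI)
    obtain u p q where s: "saddle_step d k n phiH lam phi mu r u p q"
      "\<forall>u' p' q'. saddle_step d k n phiH lam phi mu r u' p' q' \<longrightarrow> u' = u \<and> p' = p \<and> q' = q"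
      using momentum_step.saddle_step_ex1[OF mom[OF steps] steps] by (elim exE conjE)
    show "\<exists>!(phiH, lam, phi, mu, r, u, p, q). saddle_step d k n phiH lam phi mu r u p q"
    proof (rule ex1I[of _ "(phiH, lam, phi, mu, r, u, p, q)"])
      fix y assume y: "case y of (phiH, lam, phi, mu, r, u, p, q) \<Rightarrow> saddle_step d k n phiH lam phi mu r u p q"
      obtain a b c e f w where w: "y = (a, b, c, e, f, w)" by (cases y)
      obtain g h i where "w = (g, h, i)" by (cases w)
      with w have y_eq: "y = (a, b, c, e, f, g, h, i)" by simp
      have st: "saddle_step d k n a b c e f g h i" using y by (simp add: y_eq)
      then have "steps_1_to_3 d k n a b c e f" by (simp add: saddle_step_def Let_def)
      from steps_unique[OF this] st s(2) show "y = (phiH, lam, phi, mu, r, u, p, q)" by (simp add: y_eq)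
    qed (use s(1) in simp)
  next
    fix phiH lam phi mu r assume st: "steps_1_to_3 d k n phiH lam phi mu r"
    interpret momentum_step d k n lam phi mu by (rule mom[OF st])
    show "let uc = carrier d k n lam in
         (\<exists>!(u0, u1). saddle_affine d k n uc phi mu u0 u1) \<and>
         (\<forall>u0 u1. saddle_affine d k n uc phi mu u0 u1 \<longrightarrow>
            (\<forall>q. scalar_eq d k n uc phi mu (\<lambda>x. u0 x + q *\<^sub>R u1 x) q \<longleftrightarrow>
                 q_root d k n uc phi mu u0 u1 q) \<and>
            (\<exists>!q. 0 < q \<and> q_root d k n uc phi mu u0 u1 q) \<and>
            (\<forall>q. 0 < q \<and> q_root d k n uc phi mu u0 u1 q \<longleftrightarrow>
                 (\<exists>u p. saddle_step d k n phiH lam phi mu r u p q)))"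
      unfolding Let_def
      by (intro conjI allI impI saddle_affine_ex1 saddle_summary[OF st] q_root_ex1)
  next
    obtain pitr pibar us q dpi u p where s: "pc_step d k n phiH lam phi mu r pitr pibar us q dpi u p"
      "\<forall>a b c e f g h. pc_step d k n phiH lam phi mu r a b c e f g h \<longrightarrow>
        a = pitr \<and> b = pibar \<and> c = us \<and> e = q \<and> f = dpi \<and> g = u \<and> h = p"
      using momentum_step.pc_step_ex1[OF mom[OF steps] steps iii[OF steps]] by (elim exE conjE)
    show "\<exists>!(phiH, lam, phi, mu, r, pitr, pibar, us, q, dpi, u, p).
        pc_step d k n phiH lam phi mu r pitr pibar us q dpi u p"
    proof (rule ex1I[of _ "(phiH, lam, phi, mu, r, pitr, pibar, us, q, dpi, u, p)"])
      fix y assume y: "case y of (phiH, lam, phi, mu, r, pitr, pibar, us, q, dpi, u, p) \<Rightarrow>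
        pc_step d k n phiH lam phi mu r pitr pibar us q dpi u p"
      obtain a b c e f w where w: "y = (a, b, c, e, f, w)" by (cases y)
      obtain g h i j k' l m where "w = (g, h, i, j, k', l, m)" by (cases w)
      with w have y_eq: "y = (a, b, c, e, f, g, h, i, j, k', l, m)" by simp
      have st: "pc_step d k n a b c e f g h i j k' l m" using y by (simp add: y_eq)
      then have "steps_1_to_3 d k n a b c e f" by (simp add: pc_step_def Let_def)
      from steps_unique[OF this] st s(2)
      show "y = (phiH, lam, phi, mu, r, pitr, pibar, us, q, dpi, u, p)" by (simp add: y_eq)
    qed (use s(1) in simp)
  next
    fix phiH lam phi mu r pibar
    assume st: "steps_1_to_3 d k n phiH lam phi mu r \<and> pc_predicted d k n phi pibar"
    then have st1: "steps_1_to_3 d k n phiH lam phi mu r" and st2: "pc_predicted d k n phi pibar" by auto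
    interpret momentum_step d k n lam phi mu by (rule mom[OF st1])
    have pb: "pibar \<in> P0 d (n+1)" using st2 by (simp add: pc_predicted_def)
    show "let uc = carrier d k n lam in
         (\<exists>!(u0, u1). pc_affine d k n uc phi mu pibar u0 u1) \<and>
         (\<forall>u0 u1. pc_affine d k n uc phi mu pibar u0 u1 \<longrightarrow>
            (\<forall>q. scalar_eq d k n uc phi mu (\<lambda>x. u0 x + q *\<^sub>R u1 x) q \<longleftrightarrow>
                 q_root d k n uc phi mu u0 u1 q) \<and>
            (\<exists>!q. 0 < q \<and> q_root d k n uc phi mu u0 u1 q) \<and>
            (\<forall>q. 0 < q \<and> q_root d k n uc phi mu u0 u1 q \<longleftrightarrow>
                 (\<exists>pitr us dpi u p. pc_step d k n phiH lam phi mu r pitr pibar us q dpi u p)))"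
      unfolding Let_def
      by (intro conjI allI impI pc_affine_ex1[OF pb] pc_summary[OF st1 iii[OF st1] st2] q_root_ex1)
  qed
qed

end
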